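(* Let $G$ be any group (not necessarily finite) and let $\gamma$ be a first-order formula in the group language with constants from $G$, having exactly $m\ge 1$ free variables $x_1,\dots,x_m$. Let $A(\gamma)$ be the matrix of the formula $\gamma$ (an integer matrix with $m$ columns), let $\Delta_i$ be the greatest common divisor of all minors of order $i$ of $A(\gamma)$, and let $n=\frac{\Delta_m}{\Delta_{m-1}}$, with the conventions: $\Delta_i=0$ if $i$ is larger than the number of rows of the matrix; $\Delta_0=1$; $\frac{0}{0}=0$. Let $C\le G$ be the centralizer of the set of all non-isolated coefficients of $\gamma$. Then the number of tuples $(g_1,\dots,g_m)\in G^m$ satisfying $\gamma$ in $G$ is divisible by $\mathrm{GCD}(C,n)$.
   Context: **Formulae.** The language over a group $G$ has the function symbols $\cdot$ and ${}^{-1}$ and a constant symbol $g$ for each $g\in G$. Formulae are ordinary (finite) first-order formulae with equality in this language; free and bound variables of a formula are denoted by different letters. Each atomic subformula is written in the form $u=1$, where $u\in G*F$ and $F$ is the free group generated by all (free and bound) variables of $\gamma$; here $*$ denotes the free product. The elements of $G$ occurring in the words $u$ are called the *coefficients* of $\gamma$. **Isolated coefficients.** A bound variable $t$ is called *isolating* if it occurs in the atomic subformulae only in subwords of the form $t^{-1}gt$ with $g\in G$; the coefficient $g$ (in such an occurrence) is then called *isolated*. The non-isolated coefficients are those elements of $G$ that have at least one occurrence as a coefficient of $\gamma$ that is not isolated. **The graph $\Gamma(\gamma)$.** This is a directed graph (loops and multiple edges are allowed) whose vertices are the bound variables of $\gamma$ and whose edges are labelled by elements of $\mathbb{Z}^m$.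 Each atomic subformula containing bound variables is written (up to cyclic conjugation) as $$v_1(y_1)w_1(x_1,\dots,x_m)\cdots v_r(y_r)w_r(x_1,\dots,x_m)=1,$$ where $y_1,\dots,y_r$ are bound variables (not necessarily different), $v_i(y_i)\in G*\langle y_i\rangle_\infty$ is a word in which $y_i$ occurs ($\langle y_i\rangle_\infty$ is the infinite cyclic group generated by the letter $y_i$), and $w_i\in G*F(x_1,\dots,x_m)$, where $F(x_1,\dots,x_m)$ is the free group with basis $x_1,\dots,x_m$. For each such atomic subformula and each $i$ (subscripts modulo $r$), a directed edge from $y_i$ to $y_{i+1}$ is drawn with label $(\alpha_1,\dots,\alpha_m)\in\mathbb{Z}^m$, where $\alpha_j$ is the exponent sum of $x_j$ in $w_i$; loops labelled by the zero tuple are excluded. This is done for every atomic subformula containing bound variables. **The matrix $A(\gamma)$.** Choose cycles $c_1,c_2,\dots$ in $\Gamma(\gamma)$ generating its first homology group (e.g. generators of the fundamental groups of all connected components). The rows of $A(\gamma)$ are: for each $c_i$, the sum in $\mathbb{Z}^m$ of the labels of the edges of $c_i$, each taken with sign plus or minus according to whether the edge is traversed along or against its direction; and, for each atomic subformula containing no bound variables, the row whose $j$th entry is the exponent sum of $x_j$ in this subformula. The matrix depends on the choice of generating cycles, but the integer linear hull of its rows (and hence each $\Delta_i$) depends only on $\gamma$. **GCD and divisibility.** For a group $G$ and an integer $n$, $\mathrm{GCD}(G,n)$ is the least common multiple of the orders of all subgroups $H$ of $G$ such that $|H|$ divides $n$. Divisibility is understood in the sense of cardinal arithmetic: an infinite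 cardinal is divisible by all nonzero cardinals not exceeding it; zero is divisible by all cardinals and divides only zero. (Thus $\mathrm{GCD}(G,0)=|G|$, and for finite $G$ one has $\mathrm{GCD}(G,n)=\mathrm{GCD}(|G|,n)$.) *)

theory Defs
  imports
    "HOL-Algebra.Coset"
    "HOL-Library.Equipollence"
    "Graph_Theory.Digraph"
    "Jordan_Normal_Form.Determinant"
    "Jordan_Normal_Form.DL_Submatrix"
begin

section \<open>First-order formulae over a group\<close>

type_synonym var = nat

datatype 'a trm =
    Const 'a
  | Var var
  | Mult "'a trm" "'a trm"
  | Inv "'a trm"

datatype 'a fm =
    Eq "'a trm" "'a trm"
  | Neg "'a fm"
  | Conj "'a fm" "'a fm"
  | Disj "'a fm" "'a fm"
  | Imp "'a fm" "'a fm"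
  | Ex var "'a fm"
  | All var "'a fm"

primrec trm_consts :: "'a trm \<Rightarrow> 'a set" where
  "trm_consts (Const g) = {g}"
| "trm_consts (Var x) = {}"
| "trm_consts (Mult s t) = trm_consts s \<union> trm_consts t"
| "trm_consts (Inv t) = trm_consts t"

primrec trm_vars :: "'a trm \<Rightarrow> var set" where
  "trm_vars (Const g) = {}"
| "trm_vars (Var x) = {x}"
| "trm_vars (Mult s t) = trm_vars s \<union> trm_vars t"
| "trm_vars (Inv t) = trm_vars t"

primrec fm_consts :: "'a fm \<Rightarrow> 'a set" where
  "fm_consts (Eq s t) = trm_consts s \<union> trm_consts t"
| "fm_consts (Neg \<phi>) = fm_consts \<phi>"
| "fm_consts (Conj \<phi> \<psi>) = fm_consts \<phi> \<union> fm_consts \<psi>"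
| "fm_consts (Disj \<phi> \<psi>) = fm_consts \<phi> \<union> fm_consts \<psi>"
| "fm_consts (Imp \<phi> \<psi>) = fm_consts \<phi> \<union> fm_consts \<psi>"
| "fm_consts (Ex y \<phi>) = fm_consts \<phi>"
| "fm_consts (All y \<phi>) = fm_consts \<phi>"

primrec free_vars :: "'a fm \<Rightarrow> var set" where
  "free_vars (Eq s t) = trm_vars s \<union> trm_vars t"
| "free_vars (Neg \<phi>) = free_vars \<phi>"
| "free_vars (Conj \<phi> \<psi>) = free_vars \<phi> \<union> free_vars \<psi>"
| "free_vars (Disj \<phi> \<psi>) = free_vars \<phi> \<union> free_vars \<psi>"
| "free_vars (Imp \<phi> \<psi>) = free_vars \<phi> \<union> free_vars \<psi>"
| "free_vars (Ex y \<phi>) = free_vars \<phi> - {y}"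
| "free_vars (All y \<phi>) = free_vars \<phi> - {y}"

primrec bound_vars :: "'a fm \<Rightarrow> var set" where
  "bound_vars (Eq s t) = {}"
| "bound_vars (Neg \<phi>) = bound_vars \<phi>"
| "bound_vars (Conj \<phi> \<psi>) = bound_vars \<phi> \<union> bound_vars \<psi>"
| "bound_vars (Disj \<phi> \<psi>) = bound_vars \<phi> \<union> bound_vars \<psi>"
| "bound_vars (Imp \<phi> \<psi>) = bound_vars \<phi> \<union> bound_vars \<psi>"
| "bound_vars (Ex y \<phi>) = insert y (bound_vars \<phi>)"
| "bound_vars (All y \<phi>) = insert y (bound_vars \<phi>)"

primrec trm_val :: "('a, 'b) monoid_scheme \<Rightarrow> (var \<Rightarrow> 'a) \<Rightarrow> 'a trm \<Rightarrow> 'a" where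
  "trm_val G \<nu> (Const g) = g"
| "trm_val G \<nu> (Var x) = \<nu> x"
| "trm_val G \<nu> (Mult s t) = trm_val G \<nu> s \<otimes>\<^bsub>G\<^esub> trm_val G \<nu> t"
| "trm_val G \<nu> (Inv t) = inv\<^bsub>G\<^esub> (trm_val G \<nu> t)"

primrec sat :: "('a, 'b) monoid_scheme \<Rightarrow> (var \<Rightarrow> 'a) \<Rightarrow> 'a fm \<Rightarrow> bool" where
  "sat G \<nu> (Eq s t) \<longleftrightarrow> trm_val G \<nu> s = trm_val G \<nu> t"
| "sat G \<nu> (Neg \<phi>) \<longleftrightarrow> \<not> sat G \<nu> \<phi>"
| "sat G \<nu> (Conj \<phi> \<psi>) \<longleftrightarrow> sat G \<nu> \<phi> \<and> sat G \<nu> \<psi>"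
| "sat G \<nu> (Disj \<phi> \<psi>) \<longleftrightarrow> sat G \<nu> \<phi> \<or> sat G \<nu> \<psi>"
| "sat G \<nu> (Imp \<phi> \<psi>) \<longleftrightarrow> (sat G \<nu> \<phi> \<longrightarrow> sat G \<nu> \<psi>)"
| "sat G \<nu> (Ex y \<phi>) \<longleftrightarrow> (\<exists>g\<in>carrier G. sat G (\<nu>(y := g)) \<phi>)"
| "sat G \<nu> (All y \<phi>) \<longleftrightarrow> (\<forall>g\<in>carrier G. sat G (\<nu>(y := g)) \<phi>)"

text \<open>Given the list \<open>xs = [x\<^sub>1, \<dots>, x\<^sub>m]\<close> of the free variables, tuples in \<open>G\<^sup>m\<close> are
  lists of length \<open>m\<close>.\<close>

definition solutions :: "('a, 'b) monoid_scheme \<Rightarrow> var list \<Rightarrow> 'a fm \<Rightarrow> 'a list set" where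
  "solutions G xs \<gamma> =
     {gs. length gs = length xs \<and> set gs \<subseteq> carrier G \<and> sat G (the \<circ> map_of (zip xs gs)) \<gamma>}"


section \<open>Atomic subformulae as elements of \<open>G * F\<close>\<close>

text \<open>\<open>Lit x True\<close> is the letter \<open>x\<close> and \<open>Lit x False\<close> is \<open>x\<^sup>-\<^sup>1\<close>.
  Elements of the free product of \<open>G\<close> with the free group on the variables are represented by
  their normal forms: words without coefficients \<open>\<one>\<close>, without two adjacent coefficients, and
  without subwords \<open>x x\<^sup>-\<^sup>1\<close> or \<open>x\<^sup>-\<^sup>1 x\<close>.\<close>

datatype 'a letter = Coef 'a | Lit var bool

primrec letter_inv :: "('a, 'b) monoid_scheme \<Rightarrow> 'a letter \<Rightarrow> 'a letter" where
  "letter_inv G (Coef g) = Coef (inv\<^bsub>G\<^esub> g)"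
| "letter_inv G (Lit x b) = Lit x (\<not> b)"

definition word_inv :: "('a, 'b) monoid_scheme \<Rightarrow> 'a letter list \<Rightarrow> 'a letter list" where
  "word_inv G w = rev (map (letter_inv G) w)"

primrec word_of :: "('a, 'b) monoid_scheme \<Rightarrow> 'a trm \<Rightarrow> 'a letter list" where
  "word_of G (Const g) = [Coef g]"
| "word_of G (Var x) = [Lit x True]"
| "word_of G (Mult s t) = word_of G s @ word_of G t"
| "word_of G (Inv t) = word_inv G (word_of G t)"

text \<open>Normal form of the product of a letter and an element in normal form.\<close>

fun cons_nf :: "('a, 'b) monoid_scheme \<Rightarrow> 'a letter \<Rightarrow> 'a letter list \<Rightarrow> 'a letter list" where
  "cons_nf G (Coef g) (Coef h # w) =
     (if g \<otimes>\<^bsub>G\<^esub> h = \<one>\<^bsub>G\<^esub> then w else Coef (g \<otimes>\<^bsub>G\<^esub> h) # w)"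
| "cons_nf G (Coef g) w = (if g = \<one>\<^bsub>G\<^esub> then w else Coef g # w)"
| "cons_nf G (Lit x b) (Lit y c # w) =
     (if x = y \<and> b \<noteq> c then w else Lit x b # Lit y c # w)"
| "cons_nf G (Lit x b) w = Lit x b # w"

definition normal_form :: "('a, 'b) monoid_scheme \<Rightarrow> 'a letter list \<Rightarrow> 'a letter list" where
  "normal_form G w = foldr (cons_nf G) w []"

text \<open>The atomic subformula \<open>s = t\<close> is written as \<open>u = 1\<close> with \<open>u = s t\<^sup>-\<^sup>1\<close>; an atom already of
  the form \<open>t = \<one>\<close> gives the normal form of \<open>t\<close> itself. The list below
  contains one word \<open>u\<close> for each occurrence of an atomic subformula.\<close>

primrec atom_words :: "('a, 'b) monoid_scheme \<Rightarrow> 'a fm \<Rightarrow> 'a letter list list" where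
  "atom_words G (Eq s t) = [normal_form G (word_of G s @ word_inv G (word_of G t))]"
| "atom_words G (Neg \<phi>) = atom_words G \<phi>"
| "atom_words G (Conj \<phi> \<psi>) = atom_words G \<phi> @ atom_words G \<psi>"
| "atom_words G (Disj \<phi> \<psi>) = atom_words G \<phi> @ atom_words G \<psi>"
| "atom_words G (Imp \<phi> \<psi>) = atom_words G \<phi> @ atom_words G \<psi>"
| "atom_words G (Ex y \<phi>) = atom_words G \<phi>"
| "atom_words G (All y \<phi>) = atom_words G \<phi>"

primrec letter_vars :: "'a letter \<Rightarrow> var set" where
  "letter_vars (Coef g) = {}"
| "letter_vars (Lit x b) = {x}"

definition word_vars :: "'a letter list \<Rightarrow> var set" where
  "word_vars w = \<Union> (letter_vars ` set w)"

definition exp_sum :: "var \<Rightarrow> 'a letter list \<Rightarrow> int" where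
  "exp_sum x w = int (count_list w (Lit x True)) - int (count_list w (Lit x False))"

definition exp_vec :: "var list \<Rightarrow> 'a letter list \<Rightarrow> int vec" where
  "exp_vec xs w = vec (length xs) (\<lambda>j. exp_sum (xs ! j) w)"


section \<open>Isolated coefficients\<close>

definition isolating :: "('a, 'b) monoid_scheme \<Rightarrow> 'a fm \<Rightarrow> var \<Rightarrow> bool" where
  "isolating G \<gamma> t \<longleftrightarrow> t \<in> bound_vars \<gamma> \<and>
     (\<forall>u\<in>set (atom_words G \<gamma>). \<forall>p s.
        (u = p @ Lit t False # s \<longrightarrow> (\<exists>g s'. s = Coef g # Lit t True # s')) \<and>
        (u = p @ Lit t True # s \<longrightarrow> (\<exists>g p'. p = p' @ [Lit t False, Coef g])))"

definition nonisolated_coeffs :: "('a, 'b) monoid_scheme \<Rightarrow> 'a fm \<Rightarrow> 'a set" where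
  "nonisolated_coeffs G \<gamma> = {g. \<exists>u\<in>set (atom_words G \<gamma>). \<exists>p s. u = p @ Coef g # s \<and>
     \<not> (\<exists>t p' s'. isolating G \<gamma> t \<and> p = p' @ [Lit t False] \<and> s = Lit t True # s')}"

definition centralizer :: "('a, 'b) monoid_scheme \<Rightarrow> 'a set \<Rightarrow> 'a set" where
  "centralizer G S = {c \<in> carrier G. \<forall>s\<in>S. c \<otimes>\<^bsub>G\<^esub> s = s \<otimes>\<^bsub>G\<^esub> c}"


section \<open>The graph of a formula\<close>

text \<open>\<open>is_factorization B X u fs\<close>: the list \<open>fs\<close> of triples \<open>(v\<^sub>i, y\<^sub>i, w\<^sub>i)\<close> exhibits a cyclic
  permutation of \<open>u\<close> as \<open>v\<^sub>1 w\<^sub>1 \<dots> v\<^sub>r w\<^sub>r\<close>, for bound variables \<open>B\<close> and free variables \<open>X\<close>.\<close>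

definition is_factorization ::
  "var set \<Rightarrow> var set \<Rightarrow> 'a letter list \<Rightarrow> ('a letter list \<times> var \<times> 'a letter list) list \<Rightarrow> bool"
where
  "is_factorization B X u fs \<longleftrightarrow>
     (\<exists>k. rotate k u = concat (map (\<lambda>(v, y, w). v @ w) fs)) \<and>
     (\<forall>(v, y, w)\<in>set fs. y \<in> B \<and> word_vars v = {y} \<and> word_vars w \<subseteq> X)"

text \<open>Labelled edges are triples (tail, label, head). The edges of all factorizations are collected
  in a list, and the arcs of the graph are the positions in it, which allows for multiple edges.\<close>

definition atom_edges ::
  "var list \<Rightarrow> ('a letter list \<times> var \<times> 'a letter list) list \<Rightarrow> (var \<times> int vec \<times> var) list"
where
  "atom_edges xs fs = filter (\<lambda>(y, l, z). \<not> (y = z \<and> l = 0\<^sub>v (length xs)))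
     (map (\<lambda>i. case fs ! i of (v, y, w) \<Rightarrow>
              (y, exp_vec xs w, fst (snd (fs ! ((i + 1) mod length fs)))))
          [0..<length fs])"

definition edge_graph :: "var set \<Rightarrow> (var \<times> int vec \<times> var) list \<Rightarrow> (var, nat) pre_digraph" where
  "edge_graph B E =
     \<lparr>verts = B, arcs = {..<length E}, tail = (\<lambda>e. fst (E ! e)), head = (\<lambda>e. snd (snd (E ! e)))\<rparr>"

definition edge_label :: "(var \<times> int vec \<times> var) list \<Rightarrow> nat \<Rightarrow> int vec" where
  "edge_label E e = fst (snd (E ! e))"

text \<open>Cycles are closed walks in the underlying undirected graph; \<open>(e, True)\<close> and \<open>(e, False)\<close>
  denote the arc \<open>e\<close> traversed along and against its direction.\<close>

definition step_start :: "('v, 'e) pre_digraph \<Rightarrow> 'e \<times> bool \<Rightarrow> 'v" where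
  "step_start \<Gamma> s = (if snd s then tail \<Gamma> (fst s) else head \<Gamma> (fst s))"

definition step_end :: "('v, 'e) pre_digraph \<Rightarrow> 'e \<times> bool \<Rightarrow> 'v" where
  "step_end \<Gamma> s = (if snd s then head \<Gamma> (fst s) else tail \<Gamma> (fst s))"

definition is_cycle :: "('v, 'e) pre_digraph \<Rightarrow> ('e \<times> bool) list \<Rightarrow> bool" where
  "is_cycle \<Gamma> c \<longleftrightarrow> fst ` set c \<subseteq> arcs \<Gamma> \<and>
     (\<forall>i<length c. step_end \<Gamma> (c ! i) = step_start \<Gamma> (c ! ((i + 1) mod length c)))"

text \<open>The first homology group of a finite graph, as a one-dimensional complex, is the kernel of the
  boundary map from integral 1-chains to integral 0-chains.\<close>

definition H1 :: "('v, 'e) pre_digraph \<Rightarrow> ('e \<Rightarrow> int) set" where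
  "H1 \<Gamma> = {z. \<forall>v\<in>verts \<Gamma>.
     (\<Sum>e | e \<in> arcs \<Gamma> \<and> head \<Gamma> e = v. z e) - (\<Sum>e | e \<in> arcs \<Gamma> \<and> tail \<Gamma> e = v. z e) = 0}"

definition cycle_chain :: "('e \<times> bool) list \<Rightarrow> 'e \<Rightarrow> int" where
  "cycle_chain c e = int (count_list c (e, True)) - int (count_list c (e, False))"

definition generates_H1 :: "('v, 'e) pre_digraph \<Rightarrow> ('e \<times> bool) list list \<Rightarrow> bool" where
  "generates_H1 \<Gamma> cs \<longleftrightarrow> (\<forall>c\<in>set cs. is_cycle \<Gamma> c) \<and>
     (\<forall>z\<in>H1 \<Gamma>. \<exists>k :: nat \<Rightarrow> int.
        \<forall>e\<in>arcs \<Gamma>. z e = (\<Sum>i<length cs. k i * cycle_chain (cs ! i) e))"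


section \<open>The matrix of a formula\<close>

definition cycle_row :: "nat \<Rightarrow> ('e \<Rightarrow> int vec) \<Rightarrow> ('e \<times> bool) list \<Rightarrow> int vec" where
  "cycle_row m l c = vec m (\<lambda>j. \<Sum>(e, b)\<leftarrow>c. if b then l e $ j else - (l e $ j))"

text \<open>The matrix depends on the choice of generating cycles (and of factorizations), hence a predicate.\<close>

definition is_matrix_of :: "('a, 'b) monoid_scheme \<Rightarrow> var list \<Rightarrow> 'a fm \<Rightarrow> int mat \<Rightarrow> bool" where
  "is_matrix_of G xs \<gamma> A \<longleftrightarrow>
     (\<exists>Fs E cs.
        list_all2 (is_factorization (bound_vars \<gamma>) (set xs))
          (filter (\<lambda>u. word_vars u \<inter> bound_vars \<gamma> \<noteq> {}) (atom_words G \<gamma>)) Fs \<and>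
        E = concat (map (atom_edges xs) Fs) \<and>
        generates_H1 (edge_graph (bound_vars \<gamma>) E) cs \<and>
        A = mat_of_rows (length xs)
              (map (cycle_row (length xs) (edge_label E)) cs @
               map (exp_vec xs)
                 (filter (\<lambda>u. word_vars u \<inter> bound_vars \<gamma> = {}) (atom_words G \<gamma>))))"

text \<open>\<open>Gcd {} = 0\<close> and the empty minor is \<open>1\<close>, so the conventions \<open>\<Delta>\<^sub>i = 0\<close> for \<open>i\<close> larger than the
  number of rows and \<open>\<Delta>\<^sub>0 = 1\<close> hold automatically.\<close>

definition minors_gcd :: "int mat \<Rightarrow> nat \<Rightarrow> nat" where
  "minors_gcd A i = nat (Gcd {det (submatrix A I J) | I J.
     I \<subseteq> {..<dim_row A} \<and> J \<subseteq> {..<dim_col A} \<and> card I = i \<and> card J = i})"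

lemma minors_gcd_0: "minors_gcd A 0 = 1"
proof -
  have emp: "I = {}" if "I \<subseteq> {..<k}" "card I = 0" for I and k :: nat
    using that(2) finite_subset[OF that(1)] by simp
  have det: "det (submatrix A {} {}) = 1"
    by (rule det_dim_zero) (simp add: submatrix_def)
  have "{det (submatrix A I J) | I J. I \<subseteq> {..<dim_row A} \<and> J \<subseteq> {..<dim_col A} \<and>
          card I = 0 \<and> card J = 0} = {1}" (is "?S = _")
  proof (rule equalityI; rule subsetI)
    fix d assume "d \<in> ?S"
    then obtain I J where "d = det (submatrix A I J)" "I \<subseteq> {..<dim_row A}" "J \<subseteq> {..<dim_col A}"
      "card I = 0" "card J = 0" by (elim CollectE exE conjE)
    with emp det show "d \<in> {1}" by (metis singletonI)
  next
    fix d :: int assume "d \<in> {1}"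
    then have "d = det (submatrix A {} {})" using det by simp
    then show "d \<in> ?S" by (intro CollectI exI[of _ "{}"]) simp
  qed
  then show ?thesis by (simp only: minors_gcd_def) simp
qed

lemma minors_gcd_gt_rows:
  assumes "dim_row A < i"
  shows "minors_gcd A i = 0"
proof -
  have card: "card I < i" if "I \<subseteq> {..<dim_row A}" for I
    using card_mono[OF finite_lessThan that] assms by simp
  have emp: "{det (submatrix A I J) | I J. I \<subseteq> {..<dim_row A} \<and> J \<subseteq> {..<dim_col A} \<and>
          card I = i \<and> card J = i} = {}" (is "?S = {}")
  proof (rule equals0I)
    fix d assume "d \<in> ?S"
    then obtain I where "I \<subseteq> {..<dim_row A}" "card I = i" by (elim CollectE exE conjE)
    with card[of I] show False by simp
  qed
  show ?thesis by (simp only: minors_gcd_def emp) simp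
qed


section \<open>Divisibility of cardinals\<close>

text \<open>Cardinals are represented by sets of that cardinality, and a natural number \<open>n\<close> by \<open>{..<n}\<close>.
  Restricting the cofactor to subsets of the type of \<open>B\<close> is harmless: it embeds into \<open>B\<close> if
  \<open>A\<close> is nonempty, and \<open>B\<close> is empty otherwise.\<close>

definition card_dvd :: "'a set \<Rightarrow> 'b set \<Rightarrow> bool" where
  "card_dvd A B \<longleftrightarrow> (\<exists>C :: 'b set. B \<approx> A \<times> C)"

lemma card_dvd_finite:
  fixes A :: "'a set" and B :: "'b set"
  assumes "finite A" "finite B"
  shows "card_dvd A B \<longleftrightarrow> card A dvd card B"
proof
  assume "card_dvd A B"
  then obtain C :: "'b set" where C: "B \<approx> A \<times> C" unfolding card_dvd_def by blast
  moreover from C have "finite (A \<times> C)" using assms eqpoll_finite_iff by blast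
  ultimately have "card B = card (A \<times> C)" using assms eqpoll_iff_card by blast
  then show "card A dvd card B" by (simp add: card_cartesian_product)
next
  assume "card A dvd card B"
  then obtain k where k: "card B = card A * k" by blast
  obtain C where C: "C \<subseteq> B" "A = {} \<or> card C = k"
  proof (cases "A = {}")
    case False
    then have "0 < card A" using assms(1) by (simp add: card_gt_0_iff)
    then have "k \<le> card B" using k by simp
    then show ?thesis using that by (metis obtain_subset_with_card_n)
  qed (use that in blast)
  have "finite C" using C(1) assms(2) finite_subset by blast
  moreover have "card B = card (A \<times> C)" using C k by (auto simp: card_cartesian_product)
  ultimately have "B \<approx> A \<times> C" using assms by (simp add: eqpoll_iff_card)
  then show "card_dvd A B" unfolding card_dvd_def by blast
qed

lemma card_dvd_infinite:
  fixes A :: "'a set" and B :: "'b set"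
  assumes "infinite B"
  shows "card_dvd A B \<longleftrightarrow> A \<noteq> {} \<and> A \<lesssim> B"
proof
  assume "card_dvd A B"
  then obtain C :: "'b set" where C: "B \<approx> A \<times> C" unfolding card_dvd_def by blast
  with assms have "infinite (A \<times> C)" using eqpoll_finite_iff by blast
  then have ne: "A \<noteq> {}" "C \<noteq> {}" by auto
  have "A \<lesssim> A \<times> C" using ne(2) by (rule lepoll_times1)
  also have "A \<times> C \<approx> B" using C by (rule eqpoll_sym)
  finally show "A \<noteq> {} \<and> A \<lesssim> B" using ne by blast
next
  assume "A \<noteq> {} \<and> A \<lesssim> B"
  then have ne: "A \<noteq> {}" and le: "A \<lesssim> B" by auto
  have "ordLeq3 (card_of A) (card_of B)" using le card_of_ordLeq unfolding lepoll_def by blast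
  then have "ordIso2 (card_of (B \<times> A)) (card_of B)"
    by (rule card_of_Times_infinite[OF assms ne, THEN conjunct1])
  then have "B \<times> A \<approx> B" by (simp add: eqpoll_iff_card_of_ordIso)
  then have "B \<approx> A \<times> B" using times_commute_eqpoll eqpoll_trans eqpoll_sym by metis
  then show "card_dvd A B" unfolding card_dvd_def by blast
qed

lemma card_dvd_empty_left: "card_dvd {} B \<longleftrightarrow> B = {}"
  unfolding card_dvd_def by (simp add: eqpoll_empty_iff_empty)

lemma card_dvd_empty_right: "card_dvd A {}"
  unfolding card_dvd_def by (rule exI[of _ "{}"]) simp

lemma card_dvd_infinite_finite:
  fixes A :: "'a set" and B :: "'b set"
  assumes "infinite A" "finite B"
  shows "card_dvd A B \<longleftrightarrow> B = {}"
proof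
  assume "card_dvd A B"
  then obtain C :: "'b set" where C: "B \<approx> A \<times> C" unfolding card_dvd_def by blast
  then have "finite (A \<times> C)" using assms eqpoll_finite_iff by blast
  with assms have "C = {}" using finite_cartesian_productD1 by blast
  with C show "B = {}" by (simp add: eqpoll_empty_iff_empty)
qed (simp add: card_dvd_empty_right)

lemma card_dvd_antisym:
  assumes A: "card_dvd A B" and B: "card_dvd B A"
  shows "A \<approx> B"
proof -
  consider "finite A" "finite B" | "infinite A" "infinite B"
    | "finite A" "infinite B" | "infinite A" "finite B" by blast
  then show ?thesis
  proof cases
    case 1
    then show ?thesis using A B by (simp add: card_dvd_finite eqpoll_iff_card dvd_antisym)
  next
    case 2
    then show ?thesis using A B by (simp add: card_dvd_infinite lepoll_antisym)
  next
    case 3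
    then show ?thesis
      using A B card_dvd_infinite_finite[of B A] card_dvd_empty_left[of B] by auto
  next
    case 4
    then show ?thesis
      using A B card_dvd_infinite_finite[of A B] card_dvd_empty_left[of A] by auto
  qed
qed

text \<open>The type \<open>nat + 'a\<close> has sets of every finite cardinality and of every cardinality not
  exceeding that of \<open>'a\<close>, so it accommodates the least common multiple.\<close>

definition is_card_lcm :: "'a set set \<Rightarrow> (nat + 'a) set \<Rightarrow> bool" where
  "is_card_lcm S L \<longleftrightarrow> (\<forall>H\<in>S. card_dvd H L) \<and>
     (\<forall>M :: (nat + 'a) set. (\<forall>H\<in>S. card_dvd H M) \<longrightarrow> card_dvd L M)"

definition card_GCD :: "('a, 'b) monoid_scheme \<Rightarrow> nat \<Rightarrow> (nat + 'a) set" where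
  "card_GCD G n = (SOME L. is_card_lcm {H. subgroup H G \<and> card_dvd H {..<n}} L)"

lemma card_dvd_nat: "0 < n \<Longrightarrow> card_dvd H {..<n} \<longleftrightarrow> finite H \<and> card H dvd n"
  using card_dvd_infinite_finite[of H "{..<n}"] card_dvd_finite[of H "{..<n}"]
  by (cases "finite H") (auto simp: lessThan_empty_iff)

lemma is_card_lcm_unique: "is_card_lcm S L \<Longrightarrow> is_card_lcm S L' \<Longrightarrow> L \<approx> L'"
  unfolding is_card_lcm_def by (meson card_dvd_antisym)

lemma is_card_lcm_GCD_0:
  fixes G :: "('a, 'b) monoid_scheme"
  assumes "group G"
  shows "is_card_lcm {H. subgroup H G \<and> card_dvd H {..<0::nat}} (Inr ` carrier G)"
proof -
  interpret group G by fact
  have eq: "(Inr ` carrier G :: (nat + 'a) set) \<approx> carrier G"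
    by (simp add: inj_on_image_eqpoll_self)
  have "card_dvd H (Inr ` carrier G :: (nat + 'a) set)" if H: "subgroup H G" for H
  proof (cases "finite (carrier G)")
    case True
    then have "finite H" by (rule finite_subset[OF subgroup.subset[OF H]])
    moreover have "card H dvd card (carrier G)"
      using lagrange_finite[OF True H] unfolding Coset.order_def by (metis dvd_triv_right)
    ultimately show ?thesis using True by (simp add: card_dvd_finite card_image)
  next
    case False
    then have "infinite (Inr ` carrier G :: (nat + 'a) set)" by (simp add: finite_image_iff)
    moreover have "H \<noteq> {}" using subgroup.one_closed[OF H] by blast
    moreover have "H \<lesssim> (Inr ` carrier G :: (nat + 'a) set)"
      by (rule lepoll_trans2[OF subset_imp_lepoll[OF subgroup.subset[OF H]] eqpoll_sym[OF eq]])
    ultimately show ?thesis by (simp add: card_dvd_infinite)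
  qed
  moreover have "card_dvd (Inr ` carrier G :: (nat + 'a) set) M"
    if "\<forall>H\<in>{H. subgroup H G \<and> card_dvd H {..<0::nat}}. card_dvd H M" for M :: "(nat + 'a) set"
  proof -
    have "card_dvd (carrier G) M" using subgroup_self by (intro that[rule_format]) (simp add: card_dvd_empty_right)
    then obtain C :: "(nat + 'a) set" where "M \<approx> carrier G \<times> C" unfolding card_dvd_def by blast
    then have "M \<approx> (Inr ` carrier G :: (nat + 'a) set) \<times> C"
      by (rule eqpoll_trans[OF _ times_eqpoll_cong[OF eqpoll_sym[OF eq] eqpoll_refl]])
    then show ?thesis unfolding card_dvd_def by blast
  qed
  ultimately show ?thesis unfolding is_card_lcm_def by blast
qed

lemma is_card_lcm_GCD_pos:
  fixes G :: "('a, 'b) monoid_scheme"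
  assumes "0 < n"
  shows "is_card_lcm {H. subgroup H G \<and> card_dvd H {..<n}}
    (Inl ` {..<Lcm {card H | H. subgroup H G \<and> finite H \<and> card H dvd n}})"
    (is "is_card_lcm ?S (Inl ` {..<?l})")
proof -
  let ?N = "{card H | H. subgroup H G \<and> finite H \<and> card H dvd n}"
  have S: "?S = {H. subgroup H G \<and> finite H \<and> card H dvd n}" using assms by (simp add: card_dvd_nat)
  have "?l dvd n" by (rule Lcm_least) auto
  then have l: "0 < ?l" using assms dvd_pos_nat by blast
  have cl: "card (Inl ` {..<?l} :: (nat + 'a) set) = ?l" by (simp add: card_image)
  have "card_dvd H (Inl ` {..<?l} :: (nat + 'a) set)" if "H \<in> ?S" for H
  proof -
    have "card H dvd ?l" using that unfolding S by (intro dvd_Lcm) blast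
    moreover have "finite H" using that unfolding S by simp
    ultimately show ?thesis using cl by (simp add: card_dvd_finite)
  qed
  moreover have "card_dvd (Inl ` {..<?l} :: (nat + 'a) set) M"
    if M: "\<forall>H\<in>?S. card_dvd H M" for M :: "(nat + 'a) set"
  proof (cases "finite M")
    case True
    have "?l dvd card M"
    proof (rule Lcm_least)
      fix d assume "d \<in> ?N"
      then obtain H where H: "d = card H" "H \<in> ?S" "finite H" unfolding S by blast
      then have "card_dvd H M" using M by blast
      then show "d dvd card M" using H True by (simp add: card_dvd_finite)
    qed
    then show ?thesis using True cl by (simp add: card_dvd_finite)
  next
    case False
    have "(Inl ` {..<?l} :: (nat + 'a) set) \<lesssim> M"
      using False by (simp add: finite_lepoll_infinite)
    moreover have "(Inl ` {..<?l} :: (nat + 'a) set) \<noteq> {}" using l by (simp add: lessThan_empty_iff)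
    ultimately show ?thesis using False by (simp add: card_dvd_infinite)
  qed
  ultimately show ?thesis unfolding is_card_lcm_def by blast
qed

lemma is_card_lcm_card_GCD:
  assumes "group G"
  shows "is_card_lcm {H. subgroup H G \<and> card_dvd H {..<n}} (card_GCD G n)"
proof (cases "n = 0")
  case True
  show ?thesis
    unfolding card_GCD_def True by (rule someI, rule is_card_lcm_GCD_0[OF assms])
next
  case False
  then have "0 < n" by simp
  then show ?thesis
    unfolding card_GCD_def by (intro someI, rule is_card_lcm_GCD_pos)
qed

lemma card_GCD_0:
  fixes G :: "('a, 'b) monoid_scheme"
  assumes "group G"
  shows "card_GCD G 0 \<approx> carrier G"
proof (rule eqpoll_trans)
  show "card_GCD G 0 \<approx> (Inr ` carrier G :: (nat + 'a) set)"
    using is_card_lcm_card_GCD[OF assms] is_card_lcm_GCD_0[OF assms] by (rule is_card_lcm_unique)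
qed (simp add: inj_on_image_eqpoll_self)

lemma card_GCD_pos:
  fixes G :: "('a, 'b) monoid_scheme"
  assumes "group G" "0 < n"
  shows "card_GCD G n \<approx> {..<Lcm {card H | H. subgroup H G \<and> finite H \<and> card H dvd n}}"
    (is "_ \<approx> {..<?l}")
proof (rule eqpoll_trans)
  show "card_GCD G n \<approx> (Inl ` {..<?l} :: (nat + 'a) set)"
    using is_card_lcm_card_GCD[OF assms(1)] is_card_lcm_GCD_pos[OF assms(2), of G]
    by (rule is_card_lcm_unique)
qed (simp add: inj_on_image_eqpoll_self)

end

theory Submission
  imports Defs "HOL-Algebra.Multiplicative_Group" "HOL-Number_Theory.Cong"
begin

text \<open>Signed minors of order \<open>m - 1\<close>, divided by their greatest common divisor \<open>\<Delta>\<^sub>m\<^sub>-\<^sub>1\<close>, are integer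
  vectors killed modulo \<open>n\<close> by the rows of \<open>A\<close>; a combination of them assigns degrees in \<open>\<int>/n\<close> to the
  free variables such that some word \<open>f\<close> has degree \<open>1\<close>. As the labels of all cycles have degree \<open>0\<close>, the
  bound variables carry potentials \<open>p\<close> which turn every edge label into a difference of potentials.

  Let \<open>H \<le> C\<close> be a finite subgroup whose order divides \<open>n\<close> (or \<open>H = C\<close> if \<open>n = 0\<close>), and let \<open>\<phi>\<close> be a
  solution. Conjugating \<open>\<phi>\<close> by elements of \<open>H\<close> gives solutions. So does replacing the value \<open>b\<close> of \<open>f\<close>
  by \<open>b k\<close> while keeping the values of all words of degree \<open>0\<close>, for \<open>k\<close> in a suitable subgroup
  \<open>K \<le> H\<close> depending on \<open>\<phi>\<close>: by Brauer's lemma \<open>(b k)\<^sup>n = b\<^sup>n\<close>, so \<open>(b k)\<^sup>e b\<^sup>-\<^sup>e\<close> depends only on \<open>e\<close>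
  modulo \<open>n\<close>, and a bound variable \<open>y\<close> is to be conjugated by this element with \<open>e = p y\<close>. The solutions
  obtained from \<open>\<phi>\<close> by both operations are in bijection with \<open>H\<close>, and such families partition the set
  of all solutions.\<close>

section \<open>Minors and the degree map\<close>

text \<open>For an arbitrary \<open>k\<close> in \<open>H\<close> the quantity
  \<open>(b k)^e b^-e\<close> need not depend on \<open>e\<close> modulo \<open>n\<close> only, and
  a value of degree \<open>e\<close> need not act on \<open>H\<close> as \<open>b^e\<close> does.
  The subgroup \<open>core \<phi>\<close> is the part of \<open>H\<close> free of both defects: it
  commutes with every value of degree 0, among them \<open>b^n\<close> when \<open>n > 0\<close>,
  and is normalised by \<open>b\<close>. What is lost in passing from \<open>H\<close> to
  \<open>core \<phi>\<close> is regained by conjugation: conjugating \<phi> by \<open>h\<close>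
  yields a twist of \<phi> exactly when \<open>h\<close> lies in \<open>core \<phi>\<close>, so the
  conjugates of the family of twists number \<open>|H : K|\<close>, each of size \<open>|K|\<close>.
  The resulting bijection with \<open>H\<close> rests on chosen coset representatives and is not an
  action of one group.

  Both operations preserve satisfaction for the same reason. Each multiplies a free variable
  \<open>x\<close> by \<open>\<beta> q\<close> on the left and by the inverse of
  \<open>\<beta> (q - d x)\<close> on the right, for all \<open>q\<close> at once; along an atom the
  inserted factors cancel, and the bound variables are changed by maps of \<open>G\<close> onto
  itself.

  If \<open>n = 0\<close>, the gcd of order \<open>m - 1\<close> may itself vanish, and signed
  minors of the last order with nonzero gcd take over. Congruence modulo 0 is equality, and
  \<open>H\<close> may be infinite there.\<close>

lemma pick_enum:
  assumes "strict_mono_on {..<k} h" "i < k"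
  shows "pick (h ` {..<k}) i = h i"
proof -
  have "{a \<in> h ` {..<k}. a < h i} = h ` {..<i}"
    using assms by (auto simp: strict_mono_on_less image_iff)
  moreover have "inj_on h {..<i}"
    using strict_mono_on_imp_inj_on[OF assms(1)] by (rule inj_on_subset) (use assms(2) in auto)
  ultimately have "card {a \<in> h ` {..<k}. a < h i} = i" by (simp add: card_image)
  then show ?thesis using pick_card_in_set[of "h i" "h ` {..<k}"] assms(2) by simp
qed

lemma pick_bij:
  assumes "finite I" "card I = k"
  shows "bij_betw (pick I) {..<k} I"
proof -
  have inj: "inj_on (pick I) {..<k}"
    using assms by (intro linorder_inj_onI) (auto dest: pick_mono_le)
  have "pick I ` {..<k} \<subseteq> I" using assms pick_in_set_le by blast
  then have "pick I ` {..<k} = I"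
    by (rule card_subset_eq[OF assms(1)]) (simp add: card_image[OF inj] assms(2))
  then show ?thesis using inj by (simp add: bij_betw_def)
qed

lemma pick_remove:
  assumes J: "finite J" "card J = Suc k" and j: "j \<le> k" and i: "i < k"
  shows "pick (J - {pick J j}) i = pick J (if i < j then i else Suc i)"
proof -
  let ?s = "\<lambda>i. if i < j then i else Suc i"
  have bij: "bij_betw (pick J) {..<Suc k} J" by (rule pick_bij[OF J])
  have mono: "strict_mono_on {..<k} (\<lambda>i. pick J (?s i))"
    using J(2) by (intro strict_mono_onI) (auto intro!: pick_mono_le simp del: pick.simps)
  have s: "?s ` {..<k} = {..<Suc k} - {j}"
  proof (intro equalityI subsetI)
    fix x assume x: "x \<in> {..<Suc k} - {j}"
    show "x \<in> ?s ` {..<k}"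
    proof (cases "x < j")
      case True
      then show ?thesis using x j by (intro image_eqI[of _ _ x]) auto
    next
      case False
      then show ?thesis using x j by (intro image_eqI[of _ _ "x - 1"]) auto
    qed
  qed (use j in \<open>auto split: if_splits\<close>)
  have "(\<lambda>i. pick J (?s i)) ` {..<k} = pick J ` (?s ` {..<k})" by (rule image_image[symmetric])
  also have "\<dots> = J - {pick J j}"
    unfolding s using bij j by (auto simp: bij_betw_def inj_on_def)
  finally show ?thesis using pick_enum[OF mono i] by simp
qed

text \<open>A minor whose rows are listed by \<open>f\<close>, in any order and possibly with repetitions.\<close>

definition row_minor :: "int mat \<Rightarrow> (nat \<Rightarrow> nat) \<Rightarrow> nat \<Rightarrow> nat set \<Rightarrow> int" where
  "row_minor A f k J = det (mat k k (\<lambda>(i, j). A $$ (f i, pick J j)))"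

lemma det_submatrix_eq_row_minor:
  assumes "I \<subseteq> {..<dim_row A}" "J \<subseteq> {..<dim_col A}" "card I = k" "card J = k"
  shows "det (submatrix A I J) = row_minor A (pick I) k J"
proof -
  have "{i. i < dim_row A \<and> i \<in> I} = I" "{i. i < dim_col A \<and> i \<in> J} = J" using assms by auto
  then show ?thesis using assms by (simp add: submatrix_def row_minor_def)
qed

text \<open>A repeated row gives 0; otherwise sorting the rows produces a genuine minor up to sign.
  This allows any row of \<open>A\<close> to be placed on top of the chosen ones.\<close>

lemma minors_gcd_dvd_row_minor:
  assumes f: "f ` {..<k} \<subseteq> {..<dim_row A}" and J: "J \<subseteq> {..<dim_col A}" "card J = k"
  shows "int (minors_gcd A k) dvd row_minor A f k J"
proof (cases "inj_on f {..<k}")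
  case False
  then obtain i j where ij: "i < k" "j < k" "i \<noteq> j" "f i = f j" by (auto simp: inj_on_def)
  have "row_minor A f k J = 0"
    unfolding row_minor_def
    by (rule det_identical_rows[of _ k i j]) (use ij in \<open>auto intro!: eq_vecI\<close>)
  then show ?thesis by simp
next
  case True
  let ?I = "f ` {..<k}"
  have cI: "card ?I = k" using True by (simp add: card_image)
  have bij: "bij_betw (pick ?I) {..<k} ?I" by (rule pick_bij) (use cI in auto)
  \<comment> \<open>\<open>p i\<close> is the rank of \<open>f i\<close> among the chosen rows; the
    identity beyond \<open>k\<close> is what \<open>permutes\<close> demands.\<close>
  define p where "p i = (if i < k then the_inv_into {..<k} (pick ?I) (f i) else i)" for i
  have pk: "pick ?I (p i) = f i" if "i < k" for i
    using that bij by (auto simp: p_def bij_betw_def intro!: f_the_inv_into_f)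
  have lt: "p i < k" if "i < k" for i
    using that bij the_inv_into_into[of "pick ?I" "{..<k}" "f i" "{..<k}"]
    by (auto simp: p_def bij_betw_def)
  have "inj_on p {0..<k}" using pk True by (auto simp: inj_on_def) (metis lessThan_iff)
  moreover have "p ` {0..<k} \<subseteq> {0..<k}" using lt by auto
  ultimately have "bij_betw p {0..<k} {0..<k}"
    by (simp add: bij_betw_def endo_inj_surj)
  then have perm: "p permutes {0..<k}" by (rule bij_imp_permutes) (simp add: p_def)
  let ?B = "mat k k (\<lambda>(i, j). A $$ (pick ?I i, pick J j))"
  have "row_minor A f k J = det (mat k k (\<lambda>(i, j). ?B $$ (p i, j)))"
    unfolding row_minor_def by (rule arg_cong[of _ _ det]) (use lt pk in \<open>auto intro!: eq_matI\<close>)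
  also have "\<dots> = signof p * det ?B" by (rule det_permute_rows[OF _ perm]) simp
  also have "det ?B = det (submatrix A ?I J)"
    using det_submatrix_eq_row_minor[OF f J(1) cI J(2)] by (simp add: row_minor_def)
  finally have eq: "row_minor A f k J = signof p * det (submatrix A ?I J)" .
  have "Gcd {det (submatrix A I J) | I J.
     I \<subseteq> {..<dim_row A} \<and> J \<subseteq> {..<dim_col A} \<and> card I = k \<and> card J = k} dvd det (submatrix A ?I J)"
    by (rule Gcd_dvd) (use f J cI in blast)
  then show ?thesis unfolding eq minors_gcd_def by simp
qed

text \<open>For \<open>card J = k + 1\<close> this is the cofactor at column \<open>c\<close> once a
  further row stands above the rows \<open>f\<close>. The value 0 outside \<open>J\<close> makes it
  a vector indexed by all columns, a candidate for the degrees of the free variables.\<close>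

definition signed_minor :: "int mat \<Rightarrow> (nat \<Rightarrow> nat) \<Rightarrow> nat \<Rightarrow> nat set \<Rightarrow> nat \<Rightarrow> int" where
  "signed_minor A f k J c =
     (if c \<in> J then (- 1) ^ card {a \<in> J. a < c} * row_minor A f k (J - {c}) else 0)"

lemma row_minor_Suc:
  assumes J: "finite J" "card J = Suc k"
  shows "row_minor A f (Suc k) J = (\<Sum>c\<in>J. A $$ (f 0, c) * signed_minor A (f \<circ> Suc) k J c)"
proof -
  let ?B = "mat (Suc k) (Suc k) (\<lambda>(i, j). A $$ (f i, pick J j))"
  have bij: "bij_betw (pick J) {..<Suc k} J" by (rule pick_bij[OF J])
  have cof: "cofactor ?B 0 j = signed_minor A (f \<circ> Suc) k J (pick J j)" if "j < Suc k" for j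
  proof -
    have "mat_delete ?B 0 j = mat k k (\<lambda>(i, j'). A $$ (f (Suc i), pick (J - {pick J j}) j'))"
      using that by (auto intro!: eq_matI simp: mat_delete_def pick_remove[OF J])
    moreover have "card {a \<in> J. a < pick J j} = j" using that J by (intro card_pick_le) simp
    moreover have "pick J j \<in> J" using that J by (intro pick_in_set_le) simp
    ultimately show ?thesis by (simp add: cofactor_def signed_minor_def row_minor_def)
  qed
  have "row_minor A f (Suc k) J = (\<Sum>j<Suc k. ?B $$ (0, j) * cofactor ?B 0 j)"
    unfolding row_minor_def by (rule laplace_expansion_row) auto
  also have "\<dots> = (\<Sum>j<Suc k. A $$ (f 0, pick J j) * signed_minor A (f \<circ> Suc) k J (pick J j))"
    by (rule sum.cong) (auto simp: cof simp del: sum.lessThan_Suc)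
  also have "\<dots> = (\<Sum>c\<in>J. A $$ (f 0, c) * signed_minor A (f \<circ> Suc) k J c)"
    by (rule sum.reindex_bij_betw[OF bij])
  finally show ?thesis .
qed

lemma minors_gcd_dvd_signed_minor:
  assumes "f ` {..<k} \<subseteq> {..<dim_row A}" and "J \<subseteq> {..<dim_col A}" "card J = Suc k"
  shows "int (minors_gcd A k) dvd signed_minor A f k J c"
proof (cases "c \<in> J")
  case True
  have "int (minors_gcd A k) dvd row_minor A f k (J - {c})"
    by (rule minors_gcd_dvd_row_minor[OF assms(1)]) (use assms(2,3) True in auto)
  then show ?thesis using True by (simp add: signed_minor_def dvd_mult)
qed (simp add: signed_minor_def)

text \<open>Its contrapositive selects minors: with \<open>x = 0\<close> it yields a nonzero minor,
  with \<open>x\<close> equal to \<open>p\<close> times the gcd a minor without an excess factor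
  \<open>p\<close>.\<close>

lemma dvd_minors_gcdI:
  assumes "\<And>I J. I \<subseteq> {..<dim_row A} \<Longrightarrow> J \<subseteq> {..<dim_col A} \<Longrightarrow> card I = k \<Longrightarrow> card J = k \<Longrightarrow>
    x dvd row_minor A (pick I) k J"
  shows "x dvd int (minors_gcd A k)"
  unfolding minors_gcd_def
  by (simp, rule Gcd_greatest) (use assms det_submatrix_eq_row_minor in fastforce)

text \<open>Laplace expansion along the top row. It makes the division that defines \<open>n\<close>
  exact.\<close>

lemma minors_gcd_dvd_Suc: "minors_gcd A k dvd minors_gcd A (Suc k)"
proof -
  have "int (minors_gcd A k) dvd int (minors_gcd A (Suc k))"
  proof (rule dvd_minors_gcdI)
    fix I J assume IJ: "I \<subseteq> {..<dim_row A}" "J \<subseteq> {..<dim_col A}" "card I = Suc k" "card J = Suc k"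
    have fJ: "finite J" "finite I" using IJ finite_subset by blast+
    have "pick I ` {..<Suc k} = I" using pick_bij[OF fJ(2) IJ(3)] by (simp add: bij_betw_def)
    then have "(pick I \<circ> Suc) ` {..<k} \<subseteq> {..<dim_row A}" using IJ(1) by fastforce
    then show "int (minors_gcd A k) dvd row_minor A (pick I) (Suc k) J"
      unfolding row_minor_Suc[OF fJ(1) IJ(4)]
      by (intro dvd_sum dvd_mult minors_gcd_dvd_signed_minor IJ)
  qed
  then show ?thesis by simp
qed

text \<open>The vector of signed minors is a generalised cross product of the chosen rows: by Laplace
  expansion its product with any row of \<open>A\<close> is a minor of the next order.\<close>

lemma minors_gcd_dvd_cross_product:
  assumes f: "f ` {..<k} \<subseteq> {..<dim_row A}" and J: "J \<subseteq> {..<dim_col A}" "card J = Suc k"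
    and a: "a < dim_row A"
  shows "int (minors_gcd A (Suc k)) dvd (\<Sum>c<dim_col A. A $$ (a, c) * signed_minor A f k J c)"
proof -
  let ?g = "case_nat a f"
  have fJ: "finite J" using J(1) finite_subset by blast
  have g: "?g \<circ> Suc = f" by (auto simp: fun_eq_iff)
  have "?g ` {..<Suc k} \<subseteq> {..<dim_row A}"
    using f a by (auto simp: less_Suc_eq_0_disj image_subset_iff)
  then have "int (minors_gcd A (Suc k)) dvd row_minor A ?g (Suc k) J"
    by (rule minors_gcd_dvd_row_minor[OF _ J])
  also have "row_minor A ?g (Suc k) J = (\<Sum>c\<in>J. A $$ (a, c) * signed_minor A f k J c)"
    using row_minor_Suc[OF fJ J(2), of A ?g] unfolding g by simp
  also have "\<dots> = (\<Sum>c<dim_col A. A $$ (a, c) * signed_minor A f k J c)"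
    by (rule sum.mono_neutral_left) (use J(1) in \<open>auto simp: signed_minor_def\<close>)
  finally show ?thesis .
qed

section \<open>Integer vectors orthogonal to the rows, exactly or modulo \<open>n\<close>\<close>

lemma bezout_sum:
  fixes d :: "nat \<Rightarrow> int"
  shows "\<exists>c. (\<Sum>j<m. c j * d j) = Gcd (d ` {..<m})"
proof (induction m)
  case (Suc m)
  then obtain c where c: "(\<Sum>j<m. c j * d j) = Gcd (d ` {..<m})" by blast
  obtain u v where uv: "u * d m + v * Gcd (d ` {..<m}) = gcd (d m) (Gcd (d ` {..<m}))"
    using bezout_int by blast
  let ?c = "\<lambda>j. if j = m then u else v * c j"
  have "(\<Sum>j<Suc m. ?c j * d j) = u * d m + v * (\<Sum>j<m. c j * d j)"
    by (simp add: sum_distrib_left mult.assoc)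
  then show ?case using c uv by (intro exI[of _ ?c]) (simp add: lessThan_Suc)
qed simp

text \<open>A nonzero minor of order \<open>k\<close> is enlarged by a column \<open>c\<close>. The
  vector of signed minors is orthogonal to all rows, as minors of order \<open>k + 1\<close> vanish,
  and is nonzero at \<open>c\<close>. Division by the gcd of its entries makes it primitive, so
  Bezout coefficients give the value 1.\<close>

lemma exists_degree_zero:
  assumes "k < dim_col A" "minors_gcd A k \<noteq> 0" "minors_gcd A (Suc k) = 0"
  shows "\<exists>d c :: nat \<Rightarrow> int. (\<forall>a<dim_row A. (\<Sum>j<dim_col A. A $$ (a, j) * d j) = 0) \<and>
    (\<Sum>j<dim_col A. c j * d j) = 1"
proof -
  have "\<not> 0 dvd int (minors_gcd A k)" using assms(2) by simp
  then obtain I J where IJ: "I \<subseteq> {..<dim_row A}" "J \<subseteq> {..<dim_col A}" "card I = k" "card J = k"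
    and nz: "row_minor A (pick I) k J \<noteq> 0"
    using dvd_minors_gcdI[of A k 0] by (metis dvd_0_left_iff)
  have fin: "finite I" "finite J" using IJ finite_subset by blast+
  have "J \<noteq> {..<dim_col A}" using IJ(4) assms(1) by auto
  then obtain c where c: "c < dim_col A" "c \<notin> J" using IJ(2) by blast
  let ?J = "insert c J"
  let ?y = "signed_minor A (pick I) k ?J"
  let ?g = "Gcd (?y ` {..<dim_col A})"
  have J: "?J \<subseteq> {..<dim_col A}" "card ?J = Suc k" using c IJ fin by auto
  have pI: "pick I ` {..<k} \<subseteq> {..<dim_row A}"
    using pick_bij[OF fin(1) IJ(3)] IJ(1) by (simp add: bij_betw_def)
  have "?y c \<noteq> 0" using nz c(2) by (simp add: signed_minor_def)
  then have g: "?g \<noteq> 0" using c(1) by (auto simp: Gcd_0_iff)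
  have y: "?y j = ?g * (?y j div ?g)" if "j < dim_col A" for j
    using that by (simp add: Gcd_dvd)
  obtain b where b: "(\<Sum>j<dim_col A. b j * ?y j) = ?g" using bezout_sum by blast
  have "(\<Sum>j<dim_col A. A $$ (a, j) * (?y j div ?g)) = 0" if "a < dim_row A" for a
  proof -
    have "?g * (\<Sum>j<dim_col A. A $$ (a, j) * (?y j div ?g)) = (\<Sum>j<dim_col A. A $$ (a, j) * ?y j)"
      unfolding sum_distrib_left using y by (intro sum.cong) (auto simp: mult.left_commute)
    also have "\<dots> = 0"
      using minors_gcd_dvd_cross_product[OF pI J that] assms(3) by simp
    finally show ?thesis using g by simp
  qed
  moreover have "(\<Sum>j<dim_col A. b j * (?y j div ?g)) = 1"
  proof -
    have "?g * (\<Sum>j<dim_col A. b j * (?y j div ?g)) = (\<Sum>j<dim_col A. b j * ?y j)"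
      unfolding sum_distrib_left using y by (intro sum.cong) (auto simp: mult.left_commute)
    then show ?thesis using b g by simp
  qed
  ultimately show ?thesis
    by (intro exI[of _ "\<lambda>j. ?y j div ?g"] exI[of _ b]) simp
qed

text \<open>Some minor of order \<open>k\<close> is not divisible by \<open>p\<close> times the gcd.
  The signed minors divided by the gcd then have an entry prime to \<open>p\<close>, at the added
  column, while their products with the rows stay divisible by \<open>n\<close>. Different primes
  may call for different minors.\<close>

lemma exists_degree_prime:
  assumes m: "dim_col A = Suc k" and nz: "minors_gcd A k \<noteq> 0"
    and n: "minors_gcd A (Suc k) = n * minors_gcd A k" and p: "prime p"
  shows "\<exists>d :: nat \<Rightarrow> int. (\<forall>a<dim_row A. int n dvd (\<Sum>j<dim_col A. A $$ (a, j) * d j)) \<and>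
    (\<exists>j<dim_col A. \<not> int p dvd d j)"
proof -
  let ?\<Delta> = "int (minors_gcd A k)"
  have "\<not> int p * ?\<Delta> dvd ?\<Delta>"
    using dvd_times_right_cancel_iff[of ?\<Delta> "int p" 1] nz p by (auto simp: prime_nat_iff)
  then obtain I J where IJ: "I \<subseteq> {..<dim_row A}" "J \<subseteq> {..<dim_col A}" "card I = k" "card J = k"
    and nd: "\<not> int p * ?\<Delta> dvd row_minor A (pick I) k J"
    using dvd_minors_gcdI[of A k "int p * ?\<Delta>"] by blast
  have fin: "finite I" "finite J" using IJ finite_subset by blast+
  have "J \<noteq> {..<dim_col A}" using IJ(4) unfolding m by (metis card_lessThan n_not_Suc_n)
  then obtain c where c: "c < dim_col A" "c \<notin> J" using IJ(2) by blast
  let ?J = "insert c J"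
  let ?y = "signed_minor A (pick I) k ?J"
  let ?z = "\<lambda>j. ?y j div ?\<Delta>"
  have J: "?J \<subseteq> {..<dim_col A}" "card ?J = Suc k" using c IJ fin by auto
  have pI: "pick I ` {..<k} \<subseteq> {..<dim_row A}"
    using pick_bij[OF fin(1) IJ(3)] IJ(1) by (simp add: bij_betw_def)
  have y: "?y j = ?\<Delta> * ?z j" for j
    using minors_gcd_dvd_signed_minor[OF pI J, of j] by simp
  have "int n dvd (\<Sum>j<dim_col A. A $$ (a, j) * ?z j)" if "a < dim_row A" for a
  proof -
    have "?\<Delta> * (\<Sum>j<dim_col A. A $$ (a, j) * ?z j) = (\<Sum>j<dim_col A. A $$ (a, j) * ?y j)"
      unfolding sum_distrib_left by (rule sum.cong[OF refl], subst (2) y) (simp add: algebra_simps)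
    then have "?\<Delta> * int n dvd ?\<Delta> * (\<Sum>j<dim_col A. A $$ (a, j) * ?z j)"
      using minors_gcd_dvd_cross_product[OF pI J that] n by (simp add: mult.commute)
    then show ?thesis using nz by simp
  qed
  moreover have "\<not> int p dvd ?z c"
  proof
    assume "int p dvd ?z c"
    then have "int p * ?\<Delta> dvd ?y c" by (subst y) (simp add: mult.commute)
    then show False using nd c(2) by (auto simp: signed_minor_def minus_one_power_iff split: if_splits)
  qed
  ultimately show ?thesis using c(1) by (intro exI[of _ ?z]) auto
qed

text \<open>In terms of the Smith normal form: \<open>\<int>\<^sup>m\<close> modulo the rows of \<open>A\<close> maps onto \<open>\<int>/n\<close>.\<close>

lemma exists_degree:
  assumes m: "dim_col A = m" "m \<ge> 1" and n: "n = minors_gcd A m div minors_gcd A (m - 1)"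
  shows "\<exists>d c :: nat \<Rightarrow> int. (\<forall>a<dim_row A. int n dvd (\<Sum>j<m. A $$ (a, j) * d j)) \<and>
    [(\<Sum>j<m. c j * d j) = 1] (mod int n)"
proof (cases "n = 0")
  case True
  \<comment> \<open>A zero quotient means that the gcd of order \<open>m\<close> or already that of
    order \<open>m - 1\<close> is 0; the last nonzero gcd below order \<open>m\<close> covers both
    cases.\<close>
  define k where "k = Max {k. k < m \<and> minors_gcd A k \<noteq> 0}"
  have fin: "finite {k. k < m \<and> minors_gcd A k \<noteq> 0}" by simp
  have "0 \<in> {k. k < m \<and> minors_gcd A k \<noteq> 0}" using m by (simp add: minors_gcd_0)
  then have "k \<in> {k. k < m \<and> minors_gcd A k \<noteq> 0}"
    unfolding k_def by (intro Max_in[OF fin]) blast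
  then have k: "k < m" "minors_gcd A k \<noteq> 0" by auto
  have "minors_gcd A (Suc k) = 0"
  proof (cases "Suc k = m")
    case True
    then show ?thesis
      using n \<open>n = 0\<close> k(2) minors_gcd_dvd_Suc[of A k] by (auto simp: dvd_div_eq_0_iff)
  next
    case False
    show ?thesis
    proof (rule ccontr)
      assume "minors_gcd A (Suc k) \<noteq> 0"
      then have "Suc k \<in> {k. k < m \<and> minors_gcd A k \<noteq> 0}" using False k(1) by simp
      then have "Suc k \<le> k" unfolding k_def by (rule Max_ge[OF fin])
      then show False by simp
    qed
  qed
  from exists_degree_zero[OF _ k(2) this] k(1) m(1) show ?thesis by (metis cong_refl dvd_0_right)
next
  case False
  obtain k where k: "m = Suc k" using m by (cases m) auto
  have nz: "minors_gcd A k \<noteq> 0" using False n k by (intro notI) simp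
  have nk: "minors_gcd A (Suc k) = n * minors_gcd A k"
    using n k minors_gcd_dvd_Suc[of A k] by simp
  have "\<forall>p. \<exists>d :: nat \<Rightarrow> int. prime p \<longrightarrow>
     (\<forall>a<dim_row A. int n dvd (\<Sum>j<m. A $$ (a, j) * d j)) \<and> (\<exists>j<m. \<not> int p dvd d j)"
    using exists_degree_prime[OF _ nz nk] m k by metis
  then obtain z :: "nat \<Rightarrow> nat \<Rightarrow> int" where z: "\<And>p a. prime p \<Longrightarrow> a < dim_row A \<Longrightarrow>
     int n dvd (\<Sum>j<m. A $$ (a, j) * z p j)" "\<And>p. prime p \<Longrightarrow> \<exists>j<m. \<not> int p dvd z p j"
    by metis
  let ?P = "prime_factors n"
  \<comment> \<open>As in the Chinese remainder theorem: modulo a prime \<open>p\<close> dividing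
    \<open>n\<close> only the summand of \<open>p\<close> survives, multiplied by a number prime to
    \<open>p\<close>.\<close>
  define d where "d j = (\<Sum>p\<in>?P. int (\<Prod>(?P - {p})) * z p j)" for j
  have dA: "int n dvd (\<Sum>j<m. A $$ (a, j) * d j)" if a: "a < dim_row A" for a
  proof -
    have "(\<Sum>j<m. A $$ (a, j) * d j) =
        (\<Sum>p\<in>?P. int (\<Prod>(?P - {p})) * (\<Sum>j<m. A $$ (a, j) * z p j))"
      unfolding d_def sum_distrib_left by (subst sum.swap) (simp add: algebra_simps)
    also have "int n dvd \<dots>" by (intro dvd_sum dvd_mult z(1) a) auto
    finally show ?thesis .
  qed
  let ?g = "Gcd (d ` {..<m})"
  have "coprime (int n) ?g"
  proof (rule ccontr)
    assume "\<not> coprime (int n) ?g"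
    then have "nat (gcd (int n) ?g) \<noteq> 1" by (simp add: coprime_iff_gcd_eq_1)
    then obtain p where p: "prime p" "p dvd nat (gcd (int n) ?g)" using prime_factor_nat by blast
    then have "int p dvd gcd (int n) ?g" by (simp flip: int_dvd_int_iff)
    then have pn: "p \<in> ?P" and "int p dvd ?g" using False p(1) by (auto simp: in_prime_factors_iff)
    then have pd: "int p dvd d j" if "j < m" for j using that by (meson Gcd_dvd dvd_trans imageI lessThan_iff)
    obtain j where j: "j < m" "\<not> int p dvd z p j" using z(2) p(1) by blast
    have "d j = int (\<Prod>(?P - {p})) * z p j + (\<Sum>q\<in>?P - {p}. int (\<Prod>(?P - {q})) * z q j)"
      unfolding d_def by (rule sum.remove) (use pn in auto)
    moreover have "int p dvd (\<Sum>q\<in>?P - {p}. int (\<Prod>(?P - {q})) * z q j)"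
    proof (intro dvd_sum dvd_mult2)
      fix q assume "q \<in> ?P - {p}"
      then have "p \<in> ?P - {q}" using pn by auto
      then show "int p dvd int (\<Prod>(?P - {q}))" by (auto intro: dvd_prodI)
    qed
    ultimately have "int p dvd int (\<Prod>(?P - {p})) * z p j"
      using pd[OF j(1)] by (simp add: dvd_add_left_iff)
    then have "int p dvd int (\<Prod>(?P - {p}))" using j(2) p(1) by (simp add: prime_dvd_mult_iff del: of_nat_prod)
    then have "p dvd \<Prod>(?P - {p})" by (simp only: int_dvd_int_iff)
    then obtain q where q: "q \<in> ?P - {p}" "p dvd q" using p(1) by (auto simp: prime_dvd_prod_iff)
    then show False using p(1) primes_dvd_imp_eq by (auto simp: in_prime_factors_iff)
  qed
  moreover obtain c where c: "(\<Sum>j<m. c j * d j) = ?g" using bezout_sum by blast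
  \<comment> \<open>The gcd of the entries is only known to be coprime to \<open>n\<close>; its
    inverse modulo \<open>n\<close> normalises the value to 1.\<close>
  ultimately obtain u where u: "[?g * u = 1] (mod int n)"
    by (metis cong_solve_coprime_int coprime_commute)
  have "(\<Sum>j<m. (u * c j) * d j) = u * (\<Sum>j<m. c j * d j)"
    by (simp add: sum_distrib_left mult.assoc)
  then have "(\<Sum>j<m. (u * c j) * d j) = ?g * u" using c by (simp add: mult.commute)
  with dA u show ?thesis by metis
qed

section \<open>Potentials on the graph of a formula\<close>

definition boundary :: "('v, 'e) pre_digraph \<Rightarrow> ('e \<Rightarrow> int) \<Rightarrow> 'v \<Rightarrow> int" where
  "boundary \<Gamma> z v =
     (\<Sum>e | e \<in> arcs \<Gamma> \<and> head \<Gamma> e = v. z e) - (\<Sum>e | e \<in> arcs \<Gamma> \<and> tail \<Gamma> e = v. z e)"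

lemma boundary_add: "boundary \<Gamma> (\<lambda>e. z e + z' e) v = boundary \<Gamma> z v + boundary \<Gamma> z' v"
  by (simp add: boundary_def sum.distrib)

lemma boundary_minus: "boundary \<Gamma> (\<lambda>e. - z e) v = - boundary \<Gamma> z v"
  by (simp add: boundary_def sum_negf)

lemma boundary_arc:
  assumes "finite (arcs \<Gamma>)" "e \<in> arcs \<Gamma>"
  shows "boundary \<Gamma> (\<lambda>e'. of_bool (e' = e)) v = of_bool (v = head \<Gamma> e) - of_bool (v = tail \<Gamma> e)"
proof -
  have "(\<Sum>e' | e' \<in> arcs \<Gamma> \<and> P e'. of_bool (e' = e)) = (of_bool (P e) :: int)" for P
    using assms by (simp add: of_bool_def sum.delta)
  then show ?thesis unfolding boundary_def by (auto simp: of_bool_def)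
qed

lemma sum_list_cycle_chain:
  fixes \<delta> :: "'e \<Rightarrow> int"
  assumes "finite E" "fst ` set c \<subseteq> E"
  shows "(\<Sum>(e, b)\<leftarrow>c. if b then \<delta> e else - \<delta> e) = (\<Sum>e\<in>E. cycle_chain c e * \<delta> e)"
  using assms(2)
proof (induction c)
  case Nil
  then show ?case by (simp add: cycle_chain_def)
next
  case (Cons s c)
  obtain e b where s: "s = (e, b)" by fastforce
  have "cycle_chain (s # c) e' = cycle_chain c e' + (if e' = e then if b then 1 else -1 else 0)" for e'
    by (auto simp: s cycle_chain_def)
  then have "(\<Sum>e\<in>E. cycle_chain (s # c) e * \<delta> e) =
      (\<Sum>e\<in>E. cycle_chain c e * \<delta> e) + (\<Sum>e'\<in>E. if e' = e then if b then \<delta> e else - \<delta> e else 0)"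
    unfolding sum.distrib[symmetric] by (intro sum.cong) (auto simp: algebra_simps)
  also have "\<dots> = (\<Sum>e\<in>E. cycle_chain c e * \<delta> e) + (if b then \<delta> e else - \<delta> e)"
    using assms(1) Cons.prems s by simp
  finally show ?case using Cons s by simp
qed

text \<open>Two vertices are joined by a chain whose boundary is their difference; such chains replace walks
  in the construction of a potential from the vanishing of \<open>\<delta>\<close> on cycles.\<close>

definition joins :: "('v, 'e) pre_digraph \<Rightarrow> 'v \<Rightarrow> 'v \<Rightarrow> ('e \<Rightarrow> int) \<Rightarrow> bool" where
  "joins \<Gamma> u v z \<longleftrightarrow> (\<forall>x. boundary \<Gamma> z x = of_bool (x = v) - of_bool (x = u))"

lemma joins_refl: "joins \<Gamma> v v (\<lambda>_. 0)"
  by (simp add: joins_def boundary_def)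

lemma joins_sym: "joins \<Gamma> u v z \<Longrightarrow> joins \<Gamma> v u (\<lambda>e. - z e)"
  by (simp add: joins_def boundary_minus)

lemma joins_trans: "joins \<Gamma> u v z \<Longrightarrow> joins \<Gamma> v w z' \<Longrightarrow> joins \<Gamma> u w (\<lambda>e. z e + z' e)"
  by (simp add: joins_def boundary_add)

text \<open>The potential of \<open>v\<close> is the sum of \<delta> over a chain leading to
  \<open>v\<close> from a representative of its component. The chain of the tail of an arc, plus the
  arc, minus the chain of its head is closed, which forces the difference across the arc.\<close>

lemma potential_exists:
  fixes \<Gamma> :: "('v, 'e) pre_digraph" and \<delta> :: "'e \<Rightarrow> int"
  assumes fin: "finite (arcs \<Gamma>)"
    and cyc: "\<And>z. z \<in> H1 \<Gamma> \<Longrightarrow> n dvd (\<Sum>e\<in>arcs \<Gamma>. z e * \<delta> e)"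
  shows "\<exists>p :: 'v \<Rightarrow> int. \<forall>e\<in>arcs \<Gamma>. [p (head \<Gamma> e) - p (tail \<Gamma> e) = \<delta> e] (mod n)"
proof -
  let ?s = "\<lambda>z. \<Sum>e\<in>arcs \<Gamma>. z e * \<delta> e"
  \<comment> \<open>The choice depends only on the set of vertices joined to \<open>v\<close>, hence
    agrees at both ends of an arc.\<close>
  define r where "r v = (SOME u. \<exists>z. joins \<Gamma> u v z)" for v
  define y where "y v = (SOME z. joins \<Gamma> (r v) v z)" for v
  have y: "joins \<Gamma> (r v) v (y v)" for v
  proof -
    have "\<exists>u z. joins \<Gamma> u v z" by (intro exI) (rule joins_refl)
    then have "\<exists>z. joins \<Gamma> (r v) v z" unfolding r_def by (rule someI_ex)
    then show ?thesis unfolding y_def by (rule someI_ex)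
  qed
  have "[?s (y (head \<Gamma> e)) - ?s (y (tail \<Gamma> e)) = \<delta> e] (mod n)" if e: "e \<in> arcs \<Gamma>" for e
  proof -
    let ?u = "tail \<Gamma> e" and ?v = "head \<Gamma> e" and ?z = "\<lambda>e'. of_bool (e' = e) :: int"
    have z: "joins \<Gamma> ?u ?v ?z" using boundary_arc[OF fin e] by (simp add: joins_def)
    have "(\<exists>z. joins \<Gamma> x ?u z) \<longleftrightarrow> (\<exists>z. joins \<Gamma> x ?v z)" for x
      using joins_trans z joins_sym by metis
    then have r: "r ?u = r ?v" by (simp add: r_def)
    have "joins \<Gamma> (r ?v) (r ?v) (\<lambda>e. (y ?u e + ?z e) + - y ?v e)"
      by (rule joins_trans[OF joins_trans[OF y[of ?u, unfolded r] z] joins_sym[OF y[of ?v]]])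
    then have "(\<lambda>e. (y ?u e + ?z e) + - y ?v e) \<in> H1 \<Gamma>"
      by (simp add: joins_def H1_def boundary_def)
    then have "n dvd ?s (\<lambda>e. (y ?u e + ?z e) + - y ?v e)" by (rule cyc)
    also have "?s (\<lambda>e. (y ?u e + ?z e) + - y ?v e) = ?s (y ?u) + ?s ?z - ?s (y ?v)"
      by (simp add: algebra_simps sum.distrib sum_subtractf)
    also have "?s ?z = \<delta> e" using fin e by (simp add: of_bool_def if_distrib[of "\<lambda>x. x * _"] cong: if_cong)
    finally have "n dvd - (?s (y ?u) + \<delta> e - ?s (y ?v))" by (simp only: dvd_minus_iff)
    then show ?thesis by (simp add: cong_iff_dvd_diff diff_diff_eq)
  qed
  then show ?thesis by (intro exI[of _ "\<lambda>v. ?s (y v)"] ballI)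
qed

lemma generates_H1_dvd:
  fixes \<Gamma> :: "('v, 'e) pre_digraph" and \<delta> :: "'e \<Rightarrow> int"
  assumes fin: "finite (arcs \<Gamma>)" and gen: "generates_H1 \<Gamma> cs"
    and cs: "\<And>c. c \<in> set cs \<Longrightarrow> n dvd (\<Sum>(e, b)\<leftarrow>c. if b then \<delta> e else - \<delta> e)"
    and z: "z \<in> H1 \<Gamma>"
  shows "n dvd (\<Sum>e\<in>arcs \<Gamma>. z e * \<delta> e)"
proof -
  obtain k where k: "\<And>e. e \<in> arcs \<Gamma> \<Longrightarrow> z e = (\<Sum>i<length cs. k i * cycle_chain (cs ! i) e)"
    using gen z unfolding generates_H1_def by blast
  have "(\<Sum>e\<in>arcs \<Gamma>. z e * \<delta> e) =
      (\<Sum>i<length cs. k i * (\<Sum>e\<in>arcs \<Gamma>. cycle_chain (cs ! i) e * \<delta> e))"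
    by (subst sum_distrib_left, subst sum.swap) (auto simp: k sum_distrib_right mult.assoc intro!: sum.cong)
  also have "n dvd \<dots>"
  proof (rule dvd_sum, rule dvd_mult)
    fix i assume "i \<in> {..<length cs}"
    then have i: "cs ! i \<in> set cs" by simp
    then have "fst ` set (cs ! i) \<subseteq> arcs \<Gamma>" using gen by (auto simp: generates_H1_def is_cycle_def)
    from sum_list_cycle_chain[OF fin this, of \<delta>] cs[OF i]
    show "n dvd (\<Sum>e\<in>arcs \<Gamma>. cycle_chain (cs ! i) e * \<delta> e)" by simp
  qed
  finally show ?thesis .
qed

section \<open>Degrees of words and levels of their letters\<close>

definition letter_deg :: "(var \<Rightarrow> int) \<Rightarrow> 'a letter \<Rightarrow> int" where
  "letter_deg d l = (case l of Coef g \<Rightarrow> 0 | Lit x b \<Rightarrow> if b then d x else - d x)"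

lemma letter_deg_simps [simp]:
  "letter_deg d (Coef g) = 0" "letter_deg d (Lit x b) = (if b then d x else - d x)"
  by (simp_all add: letter_deg_def)

abbreviation word_deg :: "(var \<Rightarrow> int) \<Rightarrow> 'a letter list \<Rightarrow> int" where
  "word_deg d w \<equiv> \<Sum>l\<leftarrow>w. letter_deg d l"

lemma word_vars_simps [simp]:
  "word_vars [] = {}" "word_vars (l # w) = letter_vars l \<union> word_vars w"
  "word_vars (v @ w) = word_vars v \<union> word_vars w"
  by (auto simp: word_vars_def)

lemma exp_sum_Cons:
  "exp_sum x (l # w) = (case l of Coef g \<Rightarrow> 0 | Lit y b \<Rightarrow> if y = x then if b then 1 else -1 else 0) + exp_sum x w"
  by (auto simp: exp_sum_def split: letter.split)

lemma word_deg_exp_sum: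
  assumes "distinct xs"
  shows "(\<Sum>j<length xs. exp_sum (xs ! j) w * d (xs ! j)) = word_deg (\<lambda>x. if x \<in> set xs then d x else 0) w"
proof -
  have "(\<Sum>x\<in>set xs. exp_sum x w * d x) = word_deg (\<lambda>x. if x \<in> set xs then d x else 0) w"
  proof (induction w)
    case (Cons l w)
    have "(\<Sum>x\<in>set xs. (case l of Coef g \<Rightarrow> 0 | Lit y b \<Rightarrow> if y = x then if b then 1 else -1 else 0) * d x) =
       letter_deg (\<lambda>x. if x \<in> set xs then d x else 0) l"
    proof (cases l)
      case (Lit y b)
      have "(\<Sum>x\<in>set xs. (if y = x then if b then 1 else -1 else 0) * d x) =
        (\<Sum>x\<in>set xs. if y = x then (if b then d y else - d y) else 0)"
        by (rule sum.cong) auto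
      then show ?thesis using Lit by (simp add: sum.delta')
    qed simp
    then show ?case using Cons by (simp add: exp_sum_Cons distrib_right sum.distrib)
  qed (simp add: exp_sum_def)
  then show ?thesis by (simp add: sum.distinct_set_conv_list[OF assms] sum_list_sum_nth atLeast0LessThan)
qed

text \<open>\<open>potential B d p n u q\<close>: reading \<open>u\<close> from the left and starting with \<open>q\<close>, subtract the degrees of
  the letters met; a bound letter \<open>y\<close> is then always met at level \<open>p y\<close>, and the total degree is zero.\<close>

definition potential ::
  "var set \<Rightarrow> (var \<Rightarrow> int) \<Rightarrow> (var \<Rightarrow> int) \<Rightarrow> int \<Rightarrow> 'a letter list \<Rightarrow> int \<Rightarrow> bool" where
  "potential B d p n u q \<longleftrightarrow> [word_deg d u = 0] (mod n) \<and>
     (\<forall>a y b c. u = a @ Lit y b # c \<longrightarrow> y \<in> B \<longrightarrow> [q - word_deg d a = p y] (mod n))"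

text \<open>A letter of \<open>v\<close>, now read after \<open>w\<close>, has its level shifted by
  the total degree, which is 0 modulo \<open>n\<close>. The factorisation of an atom is only given
  up to such cyclic permutations.\<close>

lemma potential_swap:
  assumes "potential B d p n (v @ w) q"
  shows "potential B d p n (w @ v) (q - word_deg d v)"
  unfolding potential_def
proof (intro conjI allI impI)
  have z: "[word_deg d v + word_deg d w = 0] (mod n)" using assms by (simp add: potential_def)
  then show "[word_deg d (w @ v) = 0] (mod n)" by (simp add: add.commute)
  fix a y b c assume u: "w @ v = a @ Lit y b # c" and y: "y \<in> B"
  from u consider us where "w = a @ us" "us @ v = Lit y b # c" "us \<noteq> []"
    | us where "w @ us = a" "v = us @ Lit y b # c"
    by (auto simp: append_eq_append_conv2) (metis append.right_neutral append_Nil)+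
  then show "[q - word_deg d v - word_deg d a = p y] (mod n)"
  proof cases
    case 1
    then obtain us' where "w = a @ Lit y b # us'" by (cases us) auto
    then have "v @ w = (v @ a) @ Lit y b # us'" by simp
    with assms y have "[q - word_deg d (v @ a) = p y] (mod n)" unfolding potential_def by blast
    then show ?thesis by (simp add: algebra_simps)
  next
    case 2
    then have "v @ w = us @ Lit y b # (c @ w)" by simp
    with assms y have "[q - word_deg d us = p y] (mod n)" unfolding potential_def by blast
    moreover have "[q - word_deg d us - (word_deg d v + word_deg d w) = q - word_deg d us - 0] (mod n)"
      using z by (intro cong_diff cong_refl)
    moreover have "q - word_deg d v - word_deg d a = q - word_deg d us - (word_deg d v + word_deg d w)"
      using 2(1) by auto
    ultimately show ?thesis by (metis cong_trans diff_zero)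
  qed
qed

lemma potential_rotate:
  assumes "potential B d p n (rotate k u) q"
  shows "\<exists>q. potential B d p n u q"
  using assms
proof (induction k arbitrary: q)
  case (Suc k)
  then show ?case
  proof (cases "rotate k u")
    case (Cons l w)
    then have "potential B d p n (w @ [l]) q" using Suc.prems by simp
    from potential_swap[OF this] show ?thesis using Suc.IH Cons by auto
  qed auto
qed auto

lemma word_deg_0:
  assumes "\<And>x. x \<in> word_vars w \<Longrightarrow> d x = 0"
  shows "word_deg d w = 0"
  using assms
proof (induction w)
  case (Cons l w)
  then show ?case by (cases l) auto
qed simp

text \<open>The level stays constant inside a block \<open>v\<close>, which consists of coefficients
  and letters of a bound variable, all of degree 0; passing \<open>w\<close> lowers it by the degree
  of the edge label, from \<open>p y\<close> to \<open>p y'\<close>.\<close>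

lemma potential_factorization:
  assumes fact: "is_factorization B X u fs" and ne: "word_vars u \<inter> B \<noteq> {}"
    and BX: "X \<inter> B = {}" and d0: "\<And>y. y \<in> B \<Longrightarrow> d y = 0"
    and edges: "\<And>i v y w v' y' w'. i < length fs \<Longrightarrow> fs ! i = (v, y, w) \<Longrightarrow>
      fs ! ((i + 1) mod length fs) = (v', y', w') \<Longrightarrow> [p y - p y' = word_deg d w] (mod n)"
  shows "\<exists>q. potential B d p n u q"
proof -
  let ?cat = "\<lambda>fs. concat (map (\<lambda>(v, y, w). v @ w) fs)"
  let ?y = "\<lambda>i. fst (snd (fs ! i))"
  obtain k where k: "rotate k u = ?cat fs" using fact by (auto simp: is_factorization_def)
  have fs: "y \<in> B \<and> word_vars v = {y} \<and> word_vars w \<subseteq> X" if "(v, y, w) \<in> set fs" for v y w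
    using fact that by (auto simp: is_factorization_def)
  have "fs \<noteq> []" using k ne by auto
  then have len: "0 < length fs" by simp
  have dv: "word_deg d v = 0" if "(v, y, w) \<in> set fs" for v y w
    by (rule word_deg_0) (use fs[OF that] d0 in auto)
  \<comment> \<open>At \<open>i = length fs\<close> the remainder leads back to block 0: the level
    returns to its start, so the total degree is 0 modulo \<open>n\<close>.\<close>
  have lev: "[p (?y 0) - word_deg d (?cat (take i fs)) = p (?y (i mod length fs))] (mod n)"
    if "i \<le> length fs" for i
    using that
  proof (induction i)
    case (Suc i)
    then have i: "i < length fs" by simp
    obtain v y w where vyw: "fs ! i = (v, y, w)" by (metis prod_cases3)
    obtain v' y' w' where vyw': "fs ! (Suc i mod length fs) = (v', y', w')" by (metis prod_cases3)
    have "(v, y, w) \<in> set fs" using i vyw by (metis nth_mem)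
    then have deg: "word_deg d (?cat (take (Suc i) fs)) = word_deg d (?cat (take i fs)) + word_deg d w"
      using i vyw dv by (simp add: take_Suc_conv_app_nth)
    have "[p y - p y' = word_deg d w] (mod n)" using edges[OF i vyw] vyw' by simp
    moreover have "[p (?y 0) - word_deg d (?cat (take i fs)) = p y] (mod n)"
      using Suc.IH i vyw by simp
    ultimately have "[p (?y 0) - word_deg d (?cat (take i fs)) - word_deg d w = p y - (p y - p y')] (mod n)"
      by (intro cong_diff) (auto intro: cong_sym)
    then show ?case using vyw' deg by (simp add: diff_diff_eq)
  qed (use len in simp)
  have "potential B d p n (?cat fs) (p (?y 0))"
    unfolding potential_def
  proof (intro conjI allI impI)
    show "[word_deg d (?cat fs) = 0] (mod n)"
      using lev[of "length fs"] by (simp add: cong_iff_dvd_diff)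
    fix a y b c assume eq: "?cat fs = a @ Lit y b # c" and y: "y \<in> B"
    have "\<exists>i v y' w v1 v2. i < length fs \<and> fs ! i = (v, y', w) \<and> v @ w = v1 @ Lit y b # v2 \<and>
        a = ?cat (take i fs) @ v1"
      using eq
    proof (induction fs arbitrary: a)
      case (Cons t fs)
      obtain v y' w where t: "t = (v, y', w)" by (metis prod_cases3)
      from Cons.prems t consider us where "v @ w = a @ us" "us @ ?cat fs = Lit y b # c" "us \<noteq> []"
        | us where "(v @ w) @ us = a" "?cat fs = us @ Lit y b # c"
        by (auto simp: append_eq_append_conv2[of "v @ w", simplified]) (metis append.right_neutral append_Nil append_assoc)+
      then show ?case
      proof cases
        case 1
        then obtain us' where "v @ w = a @ Lit y b # us'" by (cases us) auto
        then show ?thesis using t by (intro exI[of _ 0]) auto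
      next
        case 2
        from Cons.IH[OF 2(2)] obtain i v' y'' w' v1 v2 where
          "i < length fs \<and> fs ! i = (v', y'', w') \<and> v' @ w' = v1 @ Lit y b # v2 \<and> us = ?cat (take i fs) @ v1"
          by blast
        then show ?thesis using 2(1) t by (intro exI[of _ "Suc i"]) auto
      qed
    qed simp
    then obtain i v y' w v1 v2 where i: "i < length fs" "fs ! i = (v, y', w)"
      "v @ w = v1 @ Lit y b # v2" and a: "a = ?cat (take i fs) @ v1" by blast
    have mem: "(v, y', w) \<in> set fs" using i by (metis nth_mem)
    have "y \<notin> word_vars w" using fs[OF mem] BX y by auto
    then have "w \<noteq> us @ Lit y b # v2" for us by auto
    with i(3) obtain us where us: "v = v1 @ us" "us @ w = Lit y b # v2"
      unfolding append_eq_append_conv2 by metis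
    moreover from us have "us \<noteq> []" using \<open>w \<noteq> [] @ Lit y b # v2\<close> by auto
    ultimately obtain v3 where v: "v = v1 @ Lit y b # v3" by (cases us) auto
    then have "y = y'" "word_vars v1 \<subseteq> {y'}" using fs[OF mem] by auto
    moreover have "word_deg d v1 = 0" by (rule word_deg_0) (use calculation d0 y in auto)
    ultimately show "[p (?y 0) - word_deg d a = p y] (mod n)"
      using lev[of i] i a by simp
  qed
  then show ?thesis using potential_rotate k by metis
qed

section \<open>Divisibility by the order of a subgroup\<close>

lemma (in group) inv_cancel [simp]:
  assumes "x \<in> carrier G" "y \<in> carrier G"
  shows "inv x \<otimes> (x \<otimes> y) = y" "x \<otimes> (inv x \<otimes> y) = y"
  using assms by (simp_all flip: m_assoc)

text \<open>As an iterate of \<theta> is the identity, the orbits partition \<open>U\<close>, and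
  the size of each is its least period, a multiple of \<open>M\<close>.\<close>

lemma dvd_card_if_dvd_periods:
  fixes \<theta> :: "'a \<Rightarrow> 'a"
  assumes fin: "finite U" and \<theta>: "\<And>x. x \<in> U \<Longrightarrow> \<theta> x \<in> U"
    and N: "N > 0" "\<And>x. x \<in> U \<Longrightarrow> (\<theta> ^^ N) x = x"
    and M: "\<And>x l. x \<in> U \<Longrightarrow> (\<theta> ^^ l) x = x \<Longrightarrow> M dvd l"
  shows "M dvd card U"
proof -
  define r where "r = {(x, y). x \<in> U \<and> (\<exists>i. y = (\<theta> ^^ i) x)}"
  have U: "(\<theta> ^^ i) x \<in> U" if "x \<in> U" for i x
    using that by (induction i) (auto intro: \<theta>)
  have Ni: "(\<theta> ^^ (N * i)) x = x" if "x \<in> U" for i x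
    using that by (induction i) (auto simp: funpow_add N(2))
  have shift: "(\<theta> ^^ (N * i - i)) ((\<theta> ^^ (i + j)) x) = (\<theta> ^^ j) x" if "x \<in> U" for i j x
  proof -
    have "(N * i - i) + (i + j) = j + N * i" using N(1) by (cases N) auto
    then have "(\<theta> ^^ (N * i - i)) ((\<theta> ^^ (i + j)) x) = (\<theta> ^^ j) ((\<theta> ^^ (N * i)) x)"
      by (metis comp_apply funpow_add)
    then show ?thesis using Ni[OF that] by simp
  qed
  have "equiv U r"
  proof (rule equivI)
    show "r \<subseteq> U \<times> U" using U by (auto simp: r_def)
    show "refl_on U r" by (auto simp: r_def refl_on_def intro: exI[of _ 0] U)
    show "sym r"
    proof (rule symI)
      fix x y assume "(x, y) \<in> r"
      then obtain i where i: "x \<in> U" "y = (\<theta> ^^ i) x" by (auto simp: r_def)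
      then have "x = (\<theta> ^^ (N * i - i)) y" using shift[of x i 0] by simp
      then show "(y, x) \<in> r" using i U by (auto simp: r_def)
    qed
    show "trans r"
      by (rule transI) (auto simp: r_def, metis comp_apply funpow_add)
  qed
  moreover have "M dvd card Y" if quot: "Y \<in> U // r" for Y
  proof -
    obtain x where x: "x \<in> U" and Y: "Y = r `` {x}" using quot by (rule quotientE)
    define l where "l = (LEAST l. l > 0 \<and> (\<theta> ^^ l) x = x)"
    have l: "l > 0" "(\<theta> ^^ l) x = x"
      unfolding l_def using LeastI[of "\<lambda>l. l > 0 \<and> (\<theta> ^^ l) x = x" N] N x by auto
    have least: "l \<le> k" if "k > 0" "(\<theta> ^^ k) x = x" for k
      unfolding l_def using that by (intro Least_le) simp
    have lk: "(\<theta> ^^ (l * k)) x = x" for k by (induction k) (auto simp: funpow_add l(2))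
    have "Y = (\<lambda>i. (\<theta> ^^ i) x) ` {..<l}"
    proof (intro equalityI subsetI)
      fix y assume "y \<in> Y"
      then obtain i where i: "y = (\<theta> ^^ i) x" by (auto simp: Y r_def)
      have "(\<theta> ^^ i) x = (\<theta> ^^ (i mod l)) ((\<theta> ^^ (l * (i div l))) x)"
        by (metis comp_apply funpow_add mod_mult_div_eq)
      then have "y = (\<theta> ^^ (i mod l)) x" using i lk by simp
      then show "y \<in> (\<lambda>i. (\<theta> ^^ i) x) ` {..<l}" using l(1) by auto
    qed (auto simp: Y r_def x)
    moreover have "inj_on (\<lambda>i. (\<theta> ^^ i) x) {..<l}"
    proof (rule linorder_inj_onI)
      fix i j assume ij: "i < j" "i \<in> {..<l}" "j \<in> {..<l}"
      show "(\<theta> ^^ i) x \<noteq> (\<theta> ^^ j) x"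
      proof
        assume "(\<theta> ^^ i) x = (\<theta> ^^ j) x"
        then have "(\<theta> ^^ (N * i - i)) ((\<theta> ^^ (i + 0)) x) = (\<theta> ^^ (N * i - i)) ((\<theta> ^^ (i + (j - i))) x)"
          using ij(1) by simp
        then have "(\<theta> ^^ (j - i)) x = x" unfolding shift[OF x] by simp
        then show False using least[of "j - i"] ij by auto
      qed
    qed auto
    ultimately have "card Y = l" by (simp add: card_image)
    then show ?thesis using M[OF x l(2)] by simp
  qed
  ultimately show ?thesis by (rule equiv_imp_dvd_card[OF fin])
qed

lemma (in group) conj_pow:
  assumes "h \<in> carrier G" "x \<in> carrier G"
  shows "(h \<otimes> x \<otimes> inv h) [^] (i :: nat) = h \<otimes> x [^] i \<otimes> inv h"
proof (induction i)
  case (Suc i)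
  have "(h \<otimes> x \<otimes> inv h) [^] Suc i = h \<otimes> x [^] i \<otimes> (inv h \<otimes> h) \<otimes> x \<otimes> inv h"
    using Suc assms by (simp add: m_assoc del: l_inv)
  then show ?case using assms by (simp add: m_assoc)
qed (use assms in simp)

text \<open>A special case of Brauer's lemma: \<open>(a u)\<^sup>n\<close> and \<open>a\<^sup>n\<close> are conjugate in \<open>U\<close>. The orbits of the
  permutation \<open>x \<mapsto> a\<^sup>-\<^sup>1 x a u\<close> of \<open>U\<close> would otherwise all have lengths divisible by a prime power
  not dividing \<open>n\<close>.\<close>

lemma (in group) Brauer_pow_eq:
  assumes U: "subgroup U G" "finite U" "card U dvd n" "n > 0" and a: "a \<in> carrier G"
    and conj: "\<And>x. x \<in> U \<Longrightarrow> inv a \<otimes> x \<otimes> a \<in> U"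
    and cent: "\<And>x. x \<in> U \<Longrightarrow> a [^] n \<otimes> x = x \<otimes> a [^] n"
    and u: "u \<in> U"
  shows "(a \<otimes> u) [^] n = a [^] n"
proof (rule ccontr)
  assume neq: "(a \<otimes> u) [^] n \<noteq> a [^] n"
  have UG: "x \<in> carrier G" if "x \<in> U" for x using U(1) that by (rule subgroup.mem_carrier)
  note uG = UG[OF u]
  define \<theta> where "\<theta> x = inv a \<otimes> x \<otimes> a \<otimes> u" for x
  have \<theta>U: "\<theta> x \<in> U" if "x \<in> U" for x
    unfolding \<theta>_def using that u conj by (blast intro: subgroup.m_closed[OF U(1)])
  have \<theta>i: "(\<theta> ^^ i) x = inv (a [^] i) \<otimes> x \<otimes> (a \<otimes> u) [^] i" if x: "x \<in> carrier G" for i x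
  proof (induction i)
    case (Suc i)
    have "(\<theta> ^^ Suc i) x = inv a \<otimes> (\<theta> ^^ i) x \<otimes> a \<otimes> u" by (simp add: \<theta>_def)
    also have "\<dots> = (inv a \<otimes> inv (a [^] i)) \<otimes> x \<otimes> ((a \<otimes> u) [^] i \<otimes> (a \<otimes> u))"
      unfolding Suc using a uG x by (simp add: m_assoc)
    also have "inv a \<otimes> inv (a [^] i) = inv (a [^] Suc i)"
      using a by (simp add: inv_mult_group[symmetric])
    finally show ?case by simp
  qed (use x in simp)
  \<comment> \<open>\<open>c\<close> measures the failure of the claim. It lies in \<open>U\<close>,
    being the \<open>n\<close>-th iterate of \<theta> at \<one>, and since \<open>a^n\<close>
    commutes with \<open>U\<close>, that iterate is right multiplication by
    \<open>c\<close>.\<close>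
  define c where "c = inv (a [^] n) \<otimes> (a \<otimes> u) [^] n"
  have "(\<theta> ^^ i) x \<in> U" if "x \<in> U" for i x
    using that by (induction i) (auto intro: \<theta>U)
  from this[OF subgroup.one_closed[OF U(1)], of n] have cU: "c \<in> U"
    using a uG by (simp add: \<theta>i c_def)
  note cG = UG[OF cU]
  have \<theta>n: "(\<theta> ^^ n) x = x \<otimes> c" if x: "x \<in> U" for x
  proof -
    have "inv (a [^] n) \<otimes> x = x \<otimes> inv (a [^] n)"
      using cent[OF x] a UG[OF x] by (metis inv_closed inv_solve_left inv_solve_right' m_assoc m_closed nat_pow_closed)
    then show ?thesis using a uG UG[OF x] by (simp add: \<theta>i c_def m_assoc[symmetric])
  qed
  have \<theta>nt: "(\<theta> ^^ (n * t)) x = x \<otimes> c [^] t" if x: "x \<in> U" for x t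
  proof (induction t)
    case (Suc t)
    have "c [^] t \<in> U"
      by (induction t) (auto intro: subgroup.one_closed[OF U(1)] subgroup.m_closed[OF U(1)] cU)
    then have "x \<otimes> c [^] t \<in> U" by (rule subgroup.m_closed[OF U(1) x])
    then have "(\<theta> ^^ (n + n * t)) x = x \<otimes> c [^] t \<otimes> c"
      using Suc \<theta>n by (simp add: funpow_add)
    then show ?case using x UG cG by (simp add: m_assoc)
  qed (use x UG in simp)
  have "c \<noteq> \<one>"
  proof
    assume "c = \<one>"
    then have "inv (a [^] n) \<otimes> (a \<otimes> u) [^] n = \<one>" by (simp add: c_def)
    then show False using neq a uG by (metis inv_closed inv_equality inv_inv m_closed nat_pow_closed inv_comm)
  qed
  moreover have "c [^] card U = \<one>"
    using group.pow_order_eq_1[OF subgroup_imp_group[OF U(1)], of c] cU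
    by (simp add: Coset.order_def nat_pow_consistent[symmetric])
  then have "ord c dvd card U" using cG by (simp add: pow_eq_id)
  then have "ord c > 0" using U(2) cU by (auto intro!: Nat.gr0I)
  ultimately have ord: "ord c \<noteq> 1" "ord c > 0"
    using ord_eq_1[OF cG] by auto
  then obtain p where p: "prime p" "p dvd ord c" using prime_factor_nat by blast
  let ?e = "Suc (multiplicity p n)"
  have "p ^ ?e dvd card U"
  proof (rule dvd_card_if_dvd_periods[OF U(2) \<theta>U])
    show "0 < n * ord c" using ord U(4) by simp
    show "(\<theta> ^^ (n * ord c)) x = x" if "x \<in> U" for x
      using \<theta>nt[OF that] cG UG[OF that] by (simp add: pow_ord_eq_1)
    fix x l assume x: "x \<in> U" and l: "(\<theta> ^^ l) x = x"
    show "p ^ ?e dvd l"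
    proof (cases "l = 0")
      case False
      \<comment> \<open>\<open>n t\<close> is the least common multiple of \<open>l\<close> and
        \<open>n\<close>, so \<open>c^t = 1\<close> and \<open>p\<close> divides \<open>t\<close>.
        If the exponent of \<open>p\<close> in \<open>l\<close> did not exceed that in
        \<open>n\<close>, the gcd would carry all of it and \<open>l\<close> would contain one
        factor \<open>p\<close> more.\<close>
      define t where "t = l div gcd l n"
      have lcm: "n * t = l * (n div gcd l n)" unfolding t_def
        by (metis div_mult_swap dvd_div_mult gcd_dvd1 gcd_dvd2 mult.commute)
      have "(\<theta> ^^ (l * k)) x = x" for k by (induction k) (auto simp: funpow_add l)
      then have "x \<otimes> c [^] t = x" using \<theta>nt[OF x, of t] lcm by simp
      then have "c [^] t = \<one>" using UG[OF x] cG by (simp add: r_cancel_one')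
      then have "p dvd t" using p(2) cG by (auto simp: pow_eq_id intro: dvd_trans)
      then have pl: "p * gcd l n dvd l"
        unfolding t_def using gcd_dvd1[of l n] by (metis dvd_div_mult_self mult_dvd_mono dvd_refl)
      have "?e \<le> multiplicity p l"
      proof (rule ccontr)
        assume "\<not> ?e \<le> multiplicity p l"
        then have "p ^ multiplicity p l dvd n" by (simp add: multiplicity_dvd')
        then have "p ^ multiplicity p l dvd gcd l n" by (simp add: multiplicity_dvd)
        then have "p ^ Suc (multiplicity p l) dvd l"
          using pl by (metis dvd_trans mult_dvd_mono dvd_refl power_Suc)
        then show False using False p(1)
          by (metis Suc_n_not_le_n multiplicity_geI not_prime_unit)
      qed
      then show ?thesis by (rule multiplicity_dvd')
    qed simp
  qed
  then have "p ^ ?e dvd n" using U(3) by (rule dvd_trans)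
  then show False using U(4) p(1)
    by (metis Suc_n_not_le_n multiplicity_geI not_prime_unit neq0_conv)
qed

text \<open>The classes need not be orbits of one group: a bijection with \<open>H\<close> is chosen
  for the representative of each class.\<close>

lemma partition_eqpoll:
  assumes refl: "\<And>\<phi>. \<phi> \<in> \<Phi> \<Longrightarrow> \<phi> \<in> R \<phi>" and sub: "\<And>\<phi>. \<phi> \<in> \<Phi> \<Longrightarrow> R \<phi> \<subseteq> \<Phi>"
    and eq: "\<And>\<phi> \<psi>. \<phi> \<in> \<Phi> \<Longrightarrow> \<psi> \<in> R \<phi> \<Longrightarrow> R \<psi> = R \<phi>"
    and card: "\<And>\<phi>. \<phi> \<in> \<Phi> \<Longrightarrow> H \<approx> R \<phi>"
  shows "\<exists>Q\<subseteq>\<Phi>. \<Phi> \<approx> H \<times> Q"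
proof -
  obtain F where F: "\<And>\<phi>. \<phi> \<in> \<Phi> \<Longrightarrow> bij_betw (F \<phi>) H (R \<phi>)"
    using card unfolding eqpoll_def by metis
  define rep where "rep \<phi> = (SOME \<psi>. \<psi> \<in> R \<phi>)" for \<phi>
  have rep: "rep \<phi> \<in> R \<phi>" if "\<phi> \<in> \<Phi>" for \<phi>
    unfolding rep_def using refl[OF that] by (rule someI)
  then have rep\<Phi>: "rep \<phi> \<in> \<Phi>" "R (rep \<phi>) = R \<phi>" if "\<phi> \<in> \<Phi>" for \<phi>
    using that sub eq by blast+
  let ?Q = "rep ` \<Phi>"
  have repQ: "rep q = q" if "q \<in> ?Q" for q
    using that rep\<Phi>(2) by (auto simp: rep_def)
  have Q: "?Q \<subseteq> \<Phi>" using rep\<Phi> by blast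
  have "bij_betw (\<lambda>(h, q). F q h) (H \<times> ?Q) \<Phi>"
  proof (rule bij_betw_imageI)
    show "inj_on (\<lambda>(h, q). F q h) (H \<times> ?Q)"
    proof (rule inj_onI, clarify)
      fix h h' \<phi> \<phi>' assume h: "h \<in> H" "h' \<in> H" and \<phi>: "\<phi> \<in> \<Phi>" "\<phi>' \<in> \<Phi>"
        and e: "F (rep \<phi>) h = F (rep \<phi>') h'"
      have "F (rep \<phi>) h \<in> R \<phi>" "F (rep \<phi>') h' \<in> R \<phi>'"
        using F[OF rep\<Phi>(1)] \<phi> h rep\<Phi>(2) by (auto simp: bij_betw_def)
      then have "R \<phi> = R \<phi>'" using eq \<phi> e by metis
      then have r: "rep \<phi> = rep \<phi>'" by (simp add: rep_def)
      then show "h = h' \<and> rep \<phi> = rep \<phi>'"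
        using e h F[OF rep\<Phi>(1)[OF \<phi>(1)]] by (auto simp: bij_betw_def inj_on_def)
    qed
    show "(\<lambda>(h, q). F q h) ` (H \<times> ?Q) = \<Phi>"
    proof (intro equalityI subsetI)
      fix \<psi> assume "\<psi> \<in> (\<lambda>(h, q). F q h) ` (H \<times> ?Q)"
      then obtain h q where hq: "h \<in> H" "q \<in> ?Q" "\<psi> = F q h" by auto
      then have "\<psi> \<in> R q" using F[of q] Q by (auto simp: bij_betw_def)
      then show "\<psi> \<in> \<Phi>" using sub hq(2) Q by blast
    next
      fix \<psi> assume \<psi>: "\<psi> \<in> \<Phi>"
      then have "\<psi> \<in> R (rep \<psi>)" using refl rep\<Phi>(2) by simp
      then obtain h where "h \<in> H" "\<psi> = F (rep \<psi>) h"
        using F[OF rep\<Phi>(1)[OF \<psi>]] by (auto simp: bij_betw_def)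
      then show "\<psi> \<in> (\<lambda>(h, q). F q h) ` (H \<times> ?Q)" using \<psi> by force
    qed
  qed
  then have "\<Phi> \<approx> H \<times> ?Q" unfolding eqpoll_def using bij_betw_inv by blast
  with Q show ?thesis by blast
qed

text \<open>\<open>H\<close> acts on \<open>\<Phi>\<close> by \<open>c\<close>, and on each fibre of a coarser structure a subgroup \<open>K \<phi>\<close> acts freely
  by \<open>t \<phi>\<close>; the stabiliser of the fibre of \<open>\<phi>\<close> is \<open>K \<phi>\<close> itself. Hence the \<open>H\<close>-orbit of a fibre
  consists of \<open>|H : K \<phi>|\<close> fibres of cardinality \<open>|K \<phi>|\<close>.\<close>

lemma (in group) fibred_action_eqpoll:
  assumes H: "subgroup H G"
    and c: "\<And>h \<phi>. h \<in> H \<Longrightarrow> \<phi> \<in> \<Phi> \<Longrightarrow> c h \<phi> \<in> \<Phi>" "\<And>\<phi>. \<phi> \<in> \<Phi> \<Longrightarrow> c \<one> \<phi> = \<phi>"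
      "\<And>h h' \<phi>. h \<in> H \<Longrightarrow> h' \<in> H \<Longrightarrow> \<phi> \<in> \<Phi> \<Longrightarrow> c h (c h' \<phi>) = c (h \<otimes> h') \<phi>"
    and K: "\<And>\<phi>. \<phi> \<in> \<Phi> \<Longrightarrow> subgroup (K \<phi>) G" "\<And>\<phi>. \<phi> \<in> \<Phi> \<Longrightarrow> K \<phi> \<subseteq> H"
    and t: "\<And>\<phi> k. \<phi> \<in> \<Phi> \<Longrightarrow> k \<in> K \<phi> \<Longrightarrow> t \<phi> k \<in> \<Phi>" "\<And>\<phi>. \<phi> \<in> \<Phi> \<Longrightarrow> t \<phi> \<one> = \<phi>"
      "\<And>\<phi> k k'. \<phi> \<in> \<Phi> \<Longrightarrow> k \<in> K \<phi> \<Longrightarrow> k' \<in> K \<phi> \<Longrightarrow> t (t \<phi> k) k' = t \<phi> (k \<otimes> k')"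
      "\<And>\<phi> k. \<phi> \<in> \<Phi> \<Longrightarrow> k \<in> K \<phi> \<Longrightarrow> K (t \<phi> k) = K \<phi>"
      "\<And>\<phi> k k'. \<phi> \<in> \<Phi> \<Longrightarrow> k \<in> K \<phi> \<Longrightarrow> k' \<in> K \<phi> \<Longrightarrow> t \<phi> k = t \<phi> k' \<Longrightarrow> k = k'"
    and ct: "\<And>h \<phi> k. h \<in> H \<Longrightarrow> \<phi> \<in> \<Phi> \<Longrightarrow> k \<in> K \<phi> \<Longrightarrow> h \<otimes> k \<otimes> inv h \<in> K (c h \<phi>)"
      "\<And>h \<phi> k. h \<in> H \<Longrightarrow> \<phi> \<in> \<Phi> \<Longrightarrow> k \<in> K \<phi> \<Longrightarrow> c h (t \<phi> k) = t (c h \<phi>) (h \<otimes> k \<otimes> inv h)"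
    and stab: "\<And>h \<phi> k. h \<in> H \<Longrightarrow> \<phi> \<in> \<Phi> \<Longrightarrow> k \<in> K \<phi> \<Longrightarrow> c h \<phi> = t \<phi> k \<Longrightarrow> h \<in> K \<phi>"
      "\<And>h \<phi>. \<phi> \<in> \<Phi> \<Longrightarrow> h \<in> K \<phi> \<Longrightarrow> \<exists>k\<in>K \<phi>. c h \<phi> = t \<phi> k"
  shows "\<exists>Q\<subseteq>\<Phi>. \<Phi> \<approx> H \<times> Q"
proof (rule partition_eqpoll)
  let ?R = "\<lambda>\<phi>. {c h (t \<phi> k) | h k. h \<in> H \<and> k \<in> K \<phi>}"
  note Hm = subgroup.m_closed[OF H] and Hi = subgroup.m_inv_closed[OF H] and H1 = subgroup.one_closed[OF H]
    and HG = subgroup.mem_carrier[OF H]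
  note Km = subgroup.m_closed[OF K(1)] and Ki = subgroup.m_inv_closed[OF K(1)]
    and K1 = subgroup.one_closed[OF K(1)] and KG = subgroup.mem_carrier[OF K(1)]
  show "\<phi> \<in> ?R \<phi>" if "\<phi> \<in> \<Phi>" for \<phi>
    using that H1 K1[OF that] c(2) t(2) by (intro CollectI exI[of _ \<one>]) simp
  show "?R \<phi> \<subseteq> \<Phi>" if "\<phi> \<in> \<Phi>" for \<phi> using that c(1) t(1) by blast
  \<comment> \<open>The opposite inclusion is an instance of this one: \<phi> is reached from \<psi>
    by a conjugate of the inverse of \<open>k\<close> and the inverse of \<open>h\<close>.\<close>
  have half: "?R (c h (t \<phi> k)) \<subseteq> ?R \<phi>" if \<phi>: "\<phi> \<in> \<Phi>" and h: "h \<in> H" and k: "k \<in> K \<phi>" for \<phi> h k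
  proof
    let ?\<chi> = "t \<phi> k"
    have \<chi>: "?\<chi> \<in> \<Phi>" "K ?\<chi> = K \<phi>" using t \<phi> k by auto
    fix \<psi> assume "\<psi> \<in> ?R (c h ?\<chi>)"
    then obtain h' k' where h': "h' \<in> H" and k': "k' \<in> K (c h ?\<chi>)" and \<psi>: "\<psi> = c h' (t (c h ?\<chi>) k')" by blast
    have c\<chi>: "c h ?\<chi> \<in> \<Phi>" using c(1) h \<chi>(1) .
    let ?k = "inv h \<otimes> k' \<otimes> h"
    have "inv h \<otimes> k' \<otimes> inv (inv h) \<in> K (c (inv h) (c h ?\<chi>))"
      by (rule ct(1)[OF Hi[OF h] c\<chi> k'])
    moreover have "c (inv h) (c h ?\<chi>) = ?\<chi>"
      using c(2)[OF \<chi>(1)] c(3)[OF Hi[OF h] h \<chi>(1)] HG[OF h] by simp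
    ultimately have kk: "?k \<in> K \<phi>" using HG[OF h] \<chi>(2) by simp
    have "h \<otimes> ?k \<otimes> inv h = (h \<otimes> inv h) \<otimes> k' \<otimes> (h \<otimes> inv h)"
      using HG[OF h] KG[OF c\<chi> k'] by (simp only: m_assoc m_closed inv_closed)
    then have "h \<otimes> ?k \<otimes> inv h = k'" using HG[OF h] KG[OF c\<chi> k'] by simp
    then have "t (c h ?\<chi>) k' = c h (t ?\<chi> ?k)" using ct(2)[OF h \<chi>(1), of ?k] kk \<chi>(2) by simp
    also have "t ?\<chi> ?k = t \<phi> (k \<otimes> ?k)" by (rule t(3)[OF \<phi> k kk])
    finally have "\<psi> = c (h' \<otimes> h) (t \<phi> (k \<otimes> ?k))"
      using \<psi> c(3)[OF h' h] t(1)[OF \<phi> Km[OF \<phi> k kk]] by simp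
    then show "\<psi> \<in> ?R \<phi>" using Hm[OF h' h] Km[OF \<phi> k kk] by blast
  qed
  show "?R \<psi> = ?R \<phi>" if \<phi>: "\<phi> \<in> \<Phi>" and \<psi>: "\<psi> \<in> ?R \<phi>" for \<phi> \<psi>
  proof
    obtain h k where h: "h \<in> H" and k: "k \<in> K \<phi>" and \<psi>: "\<psi> = c h (t \<phi> k)" using \<psi> by blast
    let ?\<chi> = "t \<phi> k"
    have \<chi>: "?\<chi> \<in> \<Phi>" "K ?\<chi> = K \<phi>" using t \<phi> k by auto
    show "?R \<psi> \<subseteq> ?R \<phi>" unfolding \<psi> by (rule half[OF \<phi> h k])
    let ?k = "h \<otimes> inv k \<otimes> inv h"
    have k': "inv k \<in> K ?\<chi>" using Ki[OF \<phi> k] \<chi>(2) by simp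
    have \<psi>\<Phi>: "\<psi> \<in> \<Phi>" unfolding \<psi> using c(1) h \<chi>(1) .
    have kk: "?k \<in> K \<psi>" unfolding \<psi> by (rule ct(1)[OF h \<chi>(1) k'])
    have "t \<psi> ?k = c h (t ?\<chi> (inv k))" unfolding \<psi> by (rule ct(2)[OF h \<chi>(1) k', symmetric])
    also have "t ?\<chi> (inv k) = \<phi>"
      using t(2)[OF \<phi>] t(3)[OF \<phi> k Ki[OF \<phi> k]] KG[OF \<phi> k] by simp
    finally have "c (inv h) (t \<psi> ?k) = \<phi>"
      using c(2)[OF \<phi>] c(3)[OF Hi[OF h] h \<phi>] HG[OF h] by simp
    then show "?R \<phi> \<subseteq> ?R \<psi>" using half[OF \<psi>\<Phi> Hi[OF h] kk] by simp
  qed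
  show "H \<approx> ?R \<phi>" if \<phi>: "\<phi> \<in> \<Phi>" for \<phi>
  proof -
    note [simp] = HG KG[OF \<phi>]
    have KH: "k \<in> H" if "k \<in> K \<phi>" for k using K(2)[OF \<phi>] that by blast
    \<comment> \<open>A representative of the left coset of \<open>h\<close> modulo
      \<open>K \<phi>\<close>, chosen by a condition that depends on the coset alone.\<close>
    define s where "s h = (SOME x. x \<in> H \<and> inv x \<otimes> h \<in> K \<phi>)" for h
    have s: "s h \<in> H" "inv (s h) \<otimes> h \<in> K \<phi>" if "h \<in> H" for h
      using someI[of "\<lambda>x. x \<in> H \<and> inv x \<otimes> h \<in> K \<phi>" h] that K1[OF \<phi>] by (auto simp: s_def)
    have s_eq: "s h = s h'" if h: "h \<in> H" "h' \<in> H" and hh: "inv h \<otimes> h' \<in> K \<phi>" for h h'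
    proof -
      have "inv x \<otimes> h \<in> K \<phi> \<longleftrightarrow> inv x \<otimes> h' \<in> K \<phi>" if x: "x \<in> H" for x
      proof -
        have "inv x \<otimes> h' = (inv x \<otimes> h) \<otimes> (inv h \<otimes> h')"
          using h x by (simp add: m_assoc[symmetric]) (simp add: m_assoc)
        moreover have "inv x \<otimes> h = (inv x \<otimes> h') \<otimes> inv (inv h \<otimes> h')"
          using h x by (simp add: inv_mult_group m_assoc[symmetric]) (simp add: m_assoc)
        ultimately show ?thesis using Km[OF \<phi>] Ki[OF \<phi>] hh by metis
      qed
      then show ?thesis unfolding s_def by metis
    qed
    \<comment> \<open>The representative selects a fibre in the orbit, the remaining factor in
      \<open>K \<phi>\<close> a point of it.\<close>
    define F where "F h = c (s h) (t \<phi> (inv (s h) \<otimes> h))" for h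
    have "inj_on F H"
    proof (rule inj_onI)
      fix h h' assume h: "h \<in> H" "h' \<in> H" and e: "F h = F h'"
      let ?x = "s h" and ?x' = "s h'"
      let ?k = "inv ?x \<otimes> h" and ?k' = "inv ?x' \<otimes> h'"
      note x = s[OF h(1)] and x' = s[OF h(2)]
      let ?\<chi> = "t \<phi> ?k"
      have \<chi>: "?\<chi> \<in> \<Phi>" "K ?\<chi> = K \<phi>" using t \<phi> x by auto
      have \<chi>': "t \<phi> ?k' \<in> \<Phi>" using t \<phi> x' by auto
      \<comment> \<open>Cancelling the action of \<open>?x'\<close> exhibits an element that moves
        one point of the fibre of \<phi> to another; such an element lies in
        \<open>K \<phi>\<close>, so both cosets agree.\<close>
      have "c (inv ?x' \<otimes> ?x) ?\<chi> = c (inv ?x') (F h)"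
        unfolding F_def by (rule c(3)[OF Hi[OF x'(1)] x(1) \<chi>(1), symmetric])
      also have "\<dots> = t \<phi> ?k'"
        unfolding e F_def[of h'] using c(2)[OF \<chi>'] c(3)[OF Hi[OF x'(1)] x'(1) \<chi>'] x' by simp
      also have "\<dots> = t ?\<chi> (inv ?k \<otimes> ?k')"
        unfolding t(3)[OF \<phi> x(2) Km[OF \<phi> Ki[OF \<phi> x(2)] x'(2)]]
        using KG[OF \<phi> x(2)] KG[OF \<phi> x'(2)] by (simp add: m_assoc[symmetric] del: m_closed)
      finally have "inv ?x' \<otimes> ?x \<in> K ?\<chi>"
        by (rule stab(1)[OF Hm[OF Hi[OF x'(1)] x(1)] \<chi>(1), rotated])
          (use Km[OF \<phi> Ki[OF \<phi> x(2)] x'(2)] \<chi>(2) in simp)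
      then have xx: "inv ?x' \<otimes> ?x \<in> K \<phi>" using \<chi>(2) by simp
      have "inv h \<otimes> h' = inv ?k \<otimes> inv (inv ?x' \<otimes> ?x) \<otimes> ?k'"
      proof -
        have "inv ?k \<otimes> inv (inv ?x' \<otimes> ?x) \<otimes> ?k' = inv h \<otimes> (?x \<otimes> inv ?x) \<otimes> (?x' \<otimes> inv ?x') \<otimes> h'"
          using h x(1) x'(1) by (simp add: inv_mult_group m_assoc del: r_inv)
        then show ?thesis using h x(1) x'(1) by simp
      qed
      then have "inv h \<otimes> h' \<in> K \<phi>" using Km[OF \<phi>] Ki[OF \<phi>] xx x(2) x'(2) by metis
      then have xe: "?x = ?x'" by (rule s_eq[OF h])
      have "c (inv ?x) (F h) = ?\<chi>"
        unfolding F_def using c(2)[OF \<chi>(1)] c(3)[OF Hi[OF x(1)] x(1) \<chi>(1)] x by simp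
      moreover have "c (inv ?x') (F h') = t \<phi> ?k'"
        unfolding F_def using c(2)[OF \<chi>'] c(3)[OF Hi[OF x'(1)] x'(1) \<chi>'] x' by simp
      ultimately have "?\<chi> = t \<phi> ?k'" using e xe by simp
      then have "?k = ?k'" by (rule t(5)[OF \<phi> x(2) x'(2)])
      then have "?x \<otimes> (inv ?x \<otimes> h) = ?x \<otimes> (inv ?x \<otimes> h')" using xe by simp
      then show "h = h'" using x(1) h by simp
    qed
    moreover have "F ` H = ?R \<phi>"
    proof (intro equalityI subsetI)
      fix \<psi> assume "\<psi> \<in> F ` H"
      then show "\<psi> \<in> ?R \<phi>" using s unfolding F_def by blast
    next
      fix \<psi> assume "\<psi> \<in> ?R \<phi>"
      then obtain h k where h: "h \<in> H" and k: "k \<in> K \<phi>" and \<psi>: "\<psi> = c h (t \<phi> k)" by blast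
      let ?x = "s h" and ?\<chi> = "t \<phi> k"
      let ?u = "inv ?x \<otimes> h"
      note x = s[OF h]
      have \<chi>: "?\<chi> \<in> \<Phi>" "K ?\<chi> = K \<phi>" using t \<phi> k by auto
      \<comment> \<open>The part of \<open>h\<close> that stabilises the fibre is traded for a
        further \<open>k1\<close> in \<open>K \<phi>\<close>, leaving the action of a coset
        representative.\<close>
      obtain k1 where k1: "k1 \<in> K \<phi>" "c ?u ?\<chi> = t ?\<chi> k1"
        using stab(2)[OF \<chi>(1), of ?u] x(2) \<chi>(2) by auto
      have k2: "k \<otimes> k1 \<in> K \<phi>" using Km[OF \<phi> k k1(1)] .
      have "h = ?x \<otimes> ?u" using h x(1) by (simp add: m_assoc[symmetric])
      then have "\<psi> = c ?x (c ?u ?\<chi>)" using \<psi> c(3)[OF x(1) KH[OF x(2)] \<chi>(1)] by simp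
      also have "c ?u ?\<chi> = t \<phi> (k \<otimes> k1)" using k1(2) t(3)[OF \<phi> k k1(1)] by simp
      finally have \<psi>': "\<psi> = c ?x (t \<phi> (k \<otimes> k1))" .
      let ?h = "?x \<otimes> (k \<otimes> k1)"
      have hH: "?h \<in> H" using Hm x(1) KH[OF k2] by blast
      have "inv h \<otimes> ?h = inv ?u \<otimes> (k \<otimes> k1)"
        using h x(1) KG[OF \<phi> k2] by (simp add: inv_mult_group m_assoc)
      then have "inv h \<otimes> ?h \<in> K \<phi>" using Km[OF \<phi> Ki[OF \<phi> x(2)] k2] by simp
      then have sx: "s ?h = ?x" using s_eq[OF h hH] by simp
      have "inv ?x \<otimes> ?h = k \<otimes> k1" using x(1) KG[OF \<phi> k2] by (simp add: m_assoc[symmetric])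
      then have "F ?h = \<psi>" unfolding F_def sx \<psi>' by simp
      then show "\<psi> \<in> F ` H" using hH by blast
    qed
    ultimately show ?thesis unfolding eqpoll_def bij_betw_def by blast
  qed
qed

section \<open>Values of words and satisfaction\<close>

primrec letter_val :: "('a, 'b) monoid_scheme \<Rightarrow> (var \<Rightarrow> 'a) \<Rightarrow> 'a letter \<Rightarrow> 'a" where
  "letter_val G \<nu> (Coef g) = g"
| "letter_val G \<nu> (Lit x b) = (if b then \<nu> x else inv\<^bsub>G\<^esub> (\<nu> x))"

primrec word_val :: "('a, 'b) monoid_scheme \<Rightarrow> (var \<Rightarrow> 'a) \<Rightarrow> 'a letter list \<Rightarrow> 'a" where
  "word_val G \<nu> [] = \<one>\<^bsub>G\<^esub>"
| "word_val G \<nu> (l # w) = letter_val G \<nu> l \<otimes>\<^bsub>G\<^esub> word_val G \<nu> w"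

definition words :: "'a set \<Rightarrow> var set \<Rightarrow> 'a letter list set" where
  "words S X = {w. \<forall>l\<in>set w. case l of Coef g \<Rightarrow> g \<in> S | Lit x b \<Rightarrow> x \<in> X}"

lemma words_simps [simp]:
  "[] \<in> words S X"
  "Coef g # w \<in> words S X \<longleftrightarrow> g \<in> S \<and> w \<in> words S X"
  "Lit x b # w \<in> words S X \<longleftrightarrow> x \<in> X \<and> w \<in> words S X"
  "v @ w \<in> words S X \<longleftrightarrow> v \<in> words S X \<and> w \<in> words S X"
  by (auto simp: words_def)

lemma words_mono: "w \<in> words S X \<Longrightarrow> S \<subseteq> S' \<Longrightarrow> X \<subseteq> X' \<Longrightarrow> w \<in> words S' X'"
  by (fastforce simp: words_def split: letter.splits)

lemma words_induct [consumes 1, case_names Nil Coef Lit]: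
  assumes "w \<in> words S X" "P []"
    and "\<And>g w. g \<in> S \<Longrightarrow> w \<in> words S X \<Longrightarrow> P w \<Longrightarrow> P (Coef g # w)"
    and "\<And>x b w. x \<in> X \<Longrightarrow> w \<in> words S X \<Longrightarrow> P w \<Longrightarrow> P (Lit x b # w)"
  shows "P w"
  using assms(1)
proof (induction w)
  case (Cons l w)
  then show ?case using assms by (cases l) auto
qed (rule assms(2))

lemma word_inv_simps [simp]:
  "word_inv G [] = []" "word_inv G (l # w) = word_inv G w @ [letter_inv G l]"
  by (simp_all add: word_inv_def)

lemma word_deg_word_inv: "word_deg d (word_inv G w) = - word_deg d w"
proof (induction w)
  case (Cons l w)
  then show ?case by (cases l) auto
qed simp

lemma words_word_inv:
  assumes "\<And>g. g \<in> S \<Longrightarrow> inv\<^bsub>G\<^esub> g \<in> S" "w \<in> words S X"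
  shows "word_inv G w \<in> words S X"
  using assms(2) by (induction rule: words_induct) (auto intro: assms(1))

lemma words_cons_nf:
  assumes "l # w \<in> words (carrier G) X" "group G"
  shows "cons_nf G l w \<in> words (carrier G) X"
proof -
  interpret group G by fact
  show ?thesis using assms(1) by (cases "(G, l, w)" rule: cons_nf.cases) auto
qed

lemma word_vars_iff: "x \<in> word_vars w \<longleftrightarrow> (\<exists>b. Lit x b \<in> set w)"
  by (auto simp: word_vars_def) (metis letter.exhaust letter_vars.simps empty_iff singletonD, metis letter_vars.simps(2) singletonI)

section \<open>Evaluation of terms, words and normal forms\<close>

context group
begin

lemma inv_comm_commute:
  assumes "x \<otimes> y = y \<otimes> x" "x \<in> carrier G" "y \<in> carrier G"
  shows "inv x \<otimes> y = y \<otimes> inv x"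
  using assms by (metis inv_closed inv_solve_left m_assoc m_closed inv_solve_right')

lemma word_val_closed [simp, intro]:
  "w \<in> words (carrier G) X \<Longrightarrow> (\<And>x. x \<in> X \<Longrightarrow> \<nu> x \<in> carrier G) \<Longrightarrow> word_val G \<nu> w \<in> carrier G"
  by (induction rule: words_induct) auto

lemma word_val_append:
  assumes "v \<in> words (carrier G) X" "w \<in> words (carrier G) X" "\<And>x. x \<in> X \<Longrightarrow> \<nu> x \<in> carrier G"
  shows "word_val G \<nu> (v @ w) = word_val G \<nu> v \<otimes> word_val G \<nu> w"
  using assms(1) by (induction rule: words_induct) (use assms(2,3) in \<open>auto simp: m_assoc\<close>)

lemma word_val_word_inv:
  assumes "w \<in> words (carrier G) X" "\<And>x. x \<in> X \<Longrightarrow> \<nu> x \<in> carrier G"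
  shows "word_val G \<nu> (word_inv G w) = inv (word_val G \<nu> w)"
  using assms(1)
proof (induction rule: words_induct)
  case (Coef g w)
  then show ?case using assms(2) words_word_inv[of "carrier G" G w X]
    by (simp add: word_val_append[of _ X] inv_mult_group)
next
  case (Lit x b w)
  then show ?case using assms(2) words_word_inv[of "carrier G" G w X]
    by (simp add: word_val_append[of _ X] inv_mult_group)
qed simp

lemma words_word_of:
  "trm_consts t \<subseteq> carrier G \<Longrightarrow> trm_vars t \<subseteq> X \<Longrightarrow> word_of G t \<in> words (carrier G) X"
  by (induction t) (auto intro: words_word_inv)

lemma word_val_word_of:
  assumes "trm_consts t \<subseteq> carrier G" "\<And>x. x \<in> trm_vars t \<Longrightarrow> \<nu> x \<in> carrier G"
  shows "word_val G \<nu> (word_of G t) = trm_val G \<nu> t" "trm_val G \<nu> t \<in> carrier G"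
proof -
  have "trm_consts t \<subseteq> carrier G \<Longrightarrow> trm_vars t \<subseteq> X \<Longrightarrow> (\<And>x. x \<in> X \<Longrightarrow> \<nu> x \<in> carrier G) \<Longrightarrow>
     word_val G \<nu> (word_of G t) = trm_val G \<nu> t \<and> trm_val G \<nu> t \<in> carrier G" for X
    by (induction t)
      (auto simp: word_val_append[of _ X] word_val_word_inv[of _ X] words_word_of)
  then show "word_val G \<nu> (word_of G t) = trm_val G \<nu> t" "trm_val G \<nu> t \<in> carrier G"
    using assms by (metis order_refl)+
qed

lemma word_val_cons_nf:
  assumes "l # w \<in> words (carrier G) X" "\<And>x. x \<in> X \<Longrightarrow> \<nu> x \<in> carrier G"
  shows "word_val G \<nu> (cons_nf G l w) = letter_val G \<nu> l \<otimes> word_val G \<nu> w"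
  using assms
  by (cases "(G, l, w)" rule: cons_nf.cases) (auto simp flip: m_assoc intro: word_val_closed[of _ X])

lemma normal_form:
  assumes "w \<in> words (carrier G) X"
  shows "normal_form G w \<in> words (carrier G) X"
    and "(\<And>x. x \<in> X \<Longrightarrow> \<nu> x \<in> carrier G) \<Longrightarrow> word_val G \<nu> (normal_form G w) = word_val G \<nu> w"
proof -
  have 1: "normal_form G w \<in> words (carrier G) X" if "w \<in> words (carrier G) X" for w
    using that unfolding normal_form_def
    by (induction rule: words_induct) (auto intro!: words_cons_nf group_axioms)
  then show "normal_form G w \<in> words (carrier G) X" using assms .
  show "word_val G \<nu> (normal_form G w) = word_val G \<nu> w" if "\<And>x. x \<in> X \<Longrightarrow> \<nu> x \<in> carrier G"
    using assms
  proof (induction rule: words_induct)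
    case (Coef g w)
    then show ?case using 1[of w] that by (simp add: normal_form_def word_val_cons_nf[of _ _ X])
  next
    case (Lit x b w)
    then show ?case using 1[of w] that by (simp add: normal_form_def word_val_cons_nf[of _ _ X])
  qed (simp add: normal_form_def)
qed

lemma sat_Eq_iff:
  assumes "fm_consts (Eq s t) \<subseteq> carrier G" "\<And>x. x \<in> free_vars (Eq s t) \<Longrightarrow> \<nu> x \<in> carrier G"
    and u: "u = normal_form G (word_of G s @ word_inv G (word_of G t))"
  shows "u \<in> words (carrier G) (free_vars (Eq s t))"
    and "sat G \<nu> (Eq s t) \<longleftrightarrow> word_val G \<nu> u = \<one>"
proof -
  let ?X = "free_vars (Eq s t)"
  have s: "word_of G s \<in> words (carrier G) ?X" and t: "word_of G t \<in> words (carrier G) ?X"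
    using assms(1) by (auto intro!: words_word_of)
  have t': "word_inv G (word_of G t) \<in> words (carrier G) ?X" by (rule words_word_inv[OF _ t]) simp
  have "word_val G \<nu> u = word_val G \<nu> (word_of G s @ word_inv G (word_of G t))"
    unfolding u by (rule normal_form(2)[of _ ?X]) (use s t' assms(2) in simp_all)
  also have "\<dots> = word_val G \<nu> (word_of G s) \<otimes> word_val G \<nu> (word_inv G (word_of G t))"
    by (rule word_val_append[OF s t']) (rule assms(2))
  also have "word_val G \<nu> (word_inv G (word_of G t)) = inv (word_val G \<nu> (word_of G t))"
    by (rule word_val_word_inv[OF t]) (rule assms(2))
  finally have "word_val G \<nu> u = trm_val G \<nu> s \<otimes> inv (trm_val G \<nu> t)"
    using assms(1,2) by (simp add: word_val_word_of)
  moreover have "trm_val G \<nu> s \<in> carrier G" "trm_val G \<nu> t \<in> carrier G"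
    using assms by (auto intro!: word_val_word_of)
  ultimately show "sat G \<nu> (Eq s t) \<longleftrightarrow> word_val G \<nu> u = \<one>"
    by (metis inv_closed inv_equality inv_inv r_inv sat.simps(1))
  show "u \<in> words (carrier G) ?X" unfolding u by (rule normal_form) (use s t' in simp)
qed

lemma atom_words_carrier:
  assumes "fm_consts \<phi> \<subseteq> carrier G" "u \<in> set (atom_words G \<phi>)"
  shows "u \<in> words (carrier G) (free_vars \<phi> \<union> bound_vars \<phi>)"
  using assms
proof (induction \<phi>)
  case (Eq s t)
  have "word_of G s @ word_inv G (word_of G t) \<in> words (carrier G) (free_vars (Eq s t))"
    using Eq.prems(1) by (auto intro!: words_word_of words_word_inv)
  then show ?case using Eq.prems(2) normal_form(1) by simp
qed (auto intro: words_mono[OF _ order_refl])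

end

lemma sat_cong:
  assumes "\<And>x. x \<in> free_vars \<phi> \<Longrightarrow> \<nu> x = \<nu>' x"
  shows "sat G \<nu> \<phi> \<longleftrightarrow> sat G \<nu>' \<phi>"
  using assms
proof (induction \<phi> arbitrary: \<nu> \<nu>')
  case (Eq s t)
  have "trm_val G \<nu> t = trm_val G \<nu>' t" if "\<And>x. x \<in> trm_vars t \<Longrightarrow> \<nu> x = \<nu>' x" for t
    using that by (induction t) auto
  from this[of s] this[of t] show ?case using Eq.prems by simp
next
  case (Neg \<phi>)
  show ?case using Neg.IH[of \<nu> \<nu>'] Neg.prems by simp
next
  case (Conj \<phi> \<psi>)
  show ?case using Conj.IH[of \<nu> \<nu>'] Conj.prems by simp
next
  case (Disj \<phi> \<psi>)
  show ?case using Disj.IH[of \<nu> \<nu>'] Disj.prems by simp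
next
  case (Imp \<phi> \<psi>)
  show ?case using Imp.IH[of \<nu> \<nu>'] Imp.prems by simp
next
  case (Ex y \<phi>)
  have "sat G (\<nu>(y := g)) \<phi> \<longleftrightarrow> sat G (\<nu>'(y := g)) \<phi>" for g by (rule Ex.IH) (use Ex.prems in auto)
  then show ?case by simp
next
  case (All y \<phi>)
  have "sat G (\<nu>(y := g)) \<phi> \<longleftrightarrow> sat G (\<nu>'(y := g)) \<phi>" for g by (rule All.IH) (use All.prems in auto)
  then show ?case by simp
qed

text \<open>A change of the values of the variables which, along every atom, amounts to multiplying each letter
  on the left by \<open>\<beta> q\<close> and on the right by \<open>(\<beta> q')\<^sup>-\<^sup>1\<close>, where \<open>q\<close> and \<open>q'\<close> are the levels of the
  potential before and after the letter; inside a block \<open>t\<^sup>-\<^sup>1 g t\<close> with isolating \<open>t\<close> nothing is inserted.\<close>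

locale gauge = group G for G (structure) +
  fixes \<gamma> :: "'a fm" and X :: "var set" and d p :: "var \<Rightarrow> int" and n :: int and \<beta> :: "int \<Rightarrow> 'a"
  assumes coeffs: "fm_consts \<gamma> \<subseteq> carrier G" and free: "free_vars \<gamma> = X"
    and disj: "X \<inter> bound_vars \<gamma> = {}" and d0: "\<And>y. y \<in> bound_vars \<gamma> \<Longrightarrow> d y = 0"
    and pot: "\<And>u. u \<in> set (atom_words G \<gamma>) \<Longrightarrow> \<exists>q. potential (bound_vars \<gamma>) d p n u q"
    and \<beta>_closed [simp, intro]: "\<And>q. \<beta> q \<in> carrier G"
    and \<beta>_cong: "\<And>q q'. [q = q'] (mod n) \<Longrightarrow> \<beta> q = \<beta> q'"
    and \<beta>_comm: "\<And>q g. g \<in> nonisolated_coeffs G \<gamma> \<Longrightarrow> \<beta> q \<otimes> g = g \<otimes> \<beta> q"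
begin

text \<open>Without the left factor an isolating \<open>t\<close> turns \<open>t^-1 g t\<close> into
  its conjugate by \<open>\<beta> (p t)\<close>, even where \<beta> does not commute with
  \<open>g\<close>.\<close>

definition move :: "var \<Rightarrow> 'a \<Rightarrow> 'a" where
  "move y g = (if isolating G \<gamma> y then g \<otimes> inv \<beta> (p y) else \<beta> (p y) \<otimes> g \<otimes> inv \<beta> (p y))"

lemma conj_chain:
  assumes "b \<in> carrier G" "b' \<in> carrier G" "e \<in> carrier G" "v \<in> carrier G" "w \<in> carrier G"
  shows "(b \<otimes> v \<otimes> inv b') \<otimes> (b' \<otimes> w \<otimes> inv e) = b \<otimes> (v \<otimes> w) \<otimes> inv e"
  using assms by (simp add: m_assoc)

lemma word_val_move:
  assumes u: "u \<in> set (atom_words G \<gamma>)" and pq: "potential (bound_vars \<gamma>) d p n u q"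
    and \<nu>: "\<And>x. x \<in> word_vars u \<Longrightarrow> \<nu> x \<in> carrier G"
    and \<nu>'X: "\<And>x q. x \<in> X \<Longrightarrow> x \<in> word_vars u \<Longrightarrow> \<nu>' x = \<beta> q \<otimes> \<nu> x \<otimes> inv \<beta> (q - d x)"
    and \<nu>'B: "\<And>y. y \<in> bound_vars \<gamma> \<Longrightarrow> y \<in> word_vars u \<Longrightarrow> \<nu>' y = move y (\<nu> y)"
  shows "word_val G \<nu>' u = \<beta> q \<otimes> word_val G \<nu> u \<otimes> inv \<beta> q"
proof -
  have uC: "u \<in> words (carrier G) (X \<union> bound_vars \<gamma>)"
    using atom_words_carrier[OF coeffs u] free by simp
  \<comment> \<open>The prefix must not stop inside a block \<open>t^-1 g t\<close>, where no factor
    is inserted. Such a block is consumed as three letters at once, whence the induction on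
    length.\<close>
  have out: "word_val G \<nu>' c = \<beta> (q - word_deg d a) \<otimes> word_val G \<nu> c \<otimes> inv \<beta> (q - word_deg d u)
      \<and> word_val G \<nu> c \<in> carrier G"
    if "u = a @ c" and "\<And>t a' g. isolating G \<gamma> t \<Longrightarrow> a \<noteq> a' @ [Lit t False] \<and> a \<noteq> a' @ [Lit t False, Coef g]"
    for a c
    using that
  proof (induction c arbitrary: a rule: length_induct)
    case (1 c)
    note IH = 1(1)[rule_format] and ua = 1(2) and outside = 1(3)
    let ?q = "q - word_deg d a"
    show ?case
    proof (cases c)
      case Nil
      then show ?thesis using ua by simp
    next
      case (Cons l c')
      have step: ?thesis
        if v: "letter_val G \<nu>' l = \<beta> ?q \<otimes> letter_val G \<nu> l \<otimes> inv \<beta> (?q - letter_deg d l)"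
          and vc: "letter_val G \<nu> l \<in> carrier G"
          and o: "\<And>t a' g. isolating G \<gamma> t \<Longrightarrow> a @ [l] \<noteq> a' @ [Lit t False] \<and> a @ [l] \<noteq> a' @ [Lit t False, Coef g]"
      proof -
        have "word_val G \<nu>' c' = \<beta> (?q - letter_deg d l) \<otimes> word_val G \<nu> c' \<otimes> inv \<beta> (q - word_deg d u)
            \<and> word_val G \<nu> c' \<in> carrier G"
          using IH[of c' "a @ [l]"] ua Cons o by (simp add: diff_diff_eq)
        then show ?thesis using v vc Cons by (simp add: conj_chain)
      qed
      show ?thesis
      proof (cases l)
        case (Coef g)
        have "g \<in> carrier G" using uC ua Cons Coef by simp
        \<comment> \<open>An isolated occurrence would have the inverse of an isolating letter just
          before it, which is excluded for \<open>a\<close>.\<close>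
        moreover have "g \<in> nonisolated_coeffs G \<gamma>"
          unfolding nonisolated_coeffs_def using u ua Cons Coef outside by blast
        then have "\<beta> ?q \<otimes> g = g \<otimes> \<beta> ?q" by (rule \<beta>_comm)
        ultimately show ?thesis using Coef outside
          by (intro step) (auto simp: m_assoc Cons_eq_append_conv append_eq_Cons_conv)
      next
        case (Lit x b)
        have xu: "x \<in> word_vars u" and xXB: "x \<in> X \<union> bound_vars \<gamma>"
          using uC ua Cons Lit by auto
        have xc: "\<nu> x \<in> carrier G" using \<nu> xu .
        show ?thesis
        proof (cases "x \<in> bound_vars \<gamma>")
          case False
          then have x: "x \<in> X" using xXB by simp
          have "\<not> isolating G \<gamma> x" using False by (simp add: isolating_def)
          moreover have "letter_val G \<nu>' l = \<beta> ?q \<otimes> letter_val G \<nu> l \<otimes> inv \<beta> (?q - letter_deg d l)"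
          proof (cases b)
            case True
            then show ?thesis using \<nu>'X[OF x xu, of ?q] xc Lit by simp
          next
            case False
            \<comment> \<open>The hypothesis is taken at the level behind the inverse letter, which
              is higher by \<open>d x\<close>.\<close>
            then show ?thesis using \<nu>'X[OF x xu, of "?q + d x"] xc Lit
              by (simp add: inv_mult_group m_assoc)
          qed
          ultimately show ?thesis using xc Lit by (intro step) auto
        next
          case True
          have "[?q = p x] (mod n)" using pq ua Cons Lit True unfolding potential_def by blast
          then have \<beta>: "\<beta> ?q = \<beta> (p x)" by (rule \<beta>_cong)
          have dx: "d x = 0" using True by (rule d0)
          have \<nu>': "\<nu>' x = move x (\<nu> x)" using \<nu>'B True xu .
          show ?thesis
          proof (cases "isolating G \<gamma> x")
            case False
            then have "letter_val G \<nu>' l = \<beta> ?q \<otimes> letter_val G \<nu> l \<otimes> inv \<beta> (?q - letter_deg d l)"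
              using \<nu>' xc Lit dx \<beta> by (simp add: move_def inv_mult_group m_assoc)
            then show ?thesis using xc Lit False by (intro step) auto
          next
            case iso: True
            have "\<not> b"
            proof
              assume b
              then have "u = a @ Lit x True # c'" using ua Cons Lit by simp
              then obtain g a' where "a = a' @ [Lit x False, Coef g]"
                using iso u unfolding isolating_def by metis
              then show False using outside iso by blast
            qed
            then have "u = a @ Lit x False # c'" using ua Cons Lit by simp
            then obtain g s where s: "c' = Coef g # Lit x True # s"
              using iso u unfolding isolating_def by metis
            have g: "g \<in> carrier G" using uC ua Cons s Lit by simp
            let ?a = "a @ [Lit x False, Coef g, Lit x True]"
            have "word_val G \<nu>' s = \<beta> (q - word_deg d ?a) \<otimes> word_val G \<nu> s \<otimes> inv \<beta> (q - word_deg d u)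
               \<and> word_val G \<nu> s \<in> carrier G"
              using ua Cons s Lit \<open>\<not> b\<close> by (intro IH) auto
            moreover have "q - word_deg d ?a = ?q" using dx by simp
            ultimately have s': "word_val G \<nu>' s = \<beta> ?q \<otimes> word_val G \<nu> s \<otimes> inv \<beta> (q - word_deg d u)"
              "word_val G \<nu> s \<in> carrier G" by auto
            have "inv (\<nu>' x) = \<beta> ?q \<otimes> inv (\<nu> x) \<otimes> inv \<one>" "\<nu>' x = \<one> \<otimes> \<nu> x \<otimes> inv \<beta> ?q"
              using \<nu>' iso \<beta> xc by (auto simp: move_def inv_mult_group)
            then have "word_val G \<nu>' c = (\<beta> ?q \<otimes> inv (\<nu> x) \<otimes> inv \<one>) \<otimes> ((\<one> \<otimes> g \<otimes> inv \<one>) \<otimes>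
                ((\<one> \<otimes> \<nu> x \<otimes> inv \<beta> ?q) \<otimes> (\<beta> ?q \<otimes> word_val G \<nu> s \<otimes> inv \<beta> (q - word_deg d u))))"
              using Cons Lit \<open>\<not> b\<close> s s'(1) g by simp
            also have "\<dots> = \<beta> ?q \<otimes> (inv (\<nu> x) \<otimes> (g \<otimes> (\<nu> x \<otimes> word_val G \<nu> s))) \<otimes> inv \<beta> (q - word_deg d u)"
              using xc g s'(2) by (simp add: m_assoc)
            finally show ?thesis using Cons Lit \<open>\<not> b\<close> s s'(2) g xc by simp
          qed
        qed
      qed
    qed
  qed
  have "[word_deg d u = 0] (mod n)" using pq by (simp add: potential_def)
  then have "[q - word_deg d u = q - 0] (mod n)" by (intro cong_diff cong_refl)
  then have "\<beta> (q - word_deg d u) = \<beta> q" using \<beta>_cong by simp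
  then show ?thesis using out[of "[]" u] by simp
qed

lemma move_closed: "g \<in> carrier G \<Longrightarrow> move y g \<in> carrier G"
  by (simp add: move_def)

lemma move_surj:
  assumes "g \<in> carrier G"
  shows "\<exists>g'\<in>carrier G. move y g' = g"
proof (cases "isolating G \<gamma> y")
  case True
  then show ?thesis using assms by (intro bexI[of _ "g \<otimes> \<beta> (p y)"]) (auto simp: move_def m_assoc)
next
  case False
  then show ?thesis using assms
    by (intro bexI[of _ "inv \<beta> (p y) \<otimes> g \<otimes> \<beta> (p y)"]) (auto simp: move_def m_assoc inv_solve_left')
qed

text \<open>Every atom value is conjugated by some \<open>\<beta> q\<close>, so being \<one> is
  unaffected, and quantifiers do not notice \<open>move\<close>, which maps \<open>G\<close> onto
  itself.\<close>

lemma sat_gauge: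
  assumes \<nu>: "\<And>x. x \<in> X \<Longrightarrow> \<nu> x \<in> carrier G"
    and \<nu>': "\<And>x q. x \<in> X \<Longrightarrow> \<nu>' x = \<beta> q \<otimes> \<nu> x \<otimes> inv \<beta> (q - d x)"
  shows "sat G \<nu> \<gamma> \<longleftrightarrow> sat G \<nu>' \<gamma>"
proof -
  let ?B = "bound_vars \<gamma>"
  let ?T = "\<lambda>\<mu> x. if x \<in> X then \<nu>' x else if x \<in> ?B then move x (\<mu> x) else \<mu> x"
  have im: "move y ` carrier G = carrier G" for y
    using move_surj[of _ y] move_closed[of _ y] by fast
  have quant: "(\<exists>g\<in>carrier G. P g) \<longleftrightarrow> (\<exists>g\<in>carrier G. P (move y g))"
    "(\<forall>g\<in>carrier G. P g) \<longleftrightarrow> (\<forall>g\<in>carrier G. P (move y g))" for P y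
  proof -
    have "(\<exists>g\<in>carrier G. P g) \<longleftrightarrow> (\<exists>g\<in>move y ` carrier G. P g)"
      "(\<forall>g\<in>carrier G. P g) \<longleftrightarrow> (\<forall>g\<in>move y ` carrier G. P g)" by (simp_all only: im)
    then show "(\<exists>g\<in>carrier G. P g) \<longleftrightarrow> (\<exists>g\<in>carrier G. P (move y g))"
      "(\<forall>g\<in>carrier G. P g) \<longleftrightarrow> (\<forall>g\<in>carrier G. P (move y g))" by simp_all
  qed
  \<comment> \<open>Levels and isolation refer to the whole of \<gamma>; the induction therefore
    runs over formulae whose atoms and bound variables occur in \<gamma>, and their free variables
    may be bound in \<gamma>.\<close>
  have "sat G \<mu> \<phi> \<longleftrightarrow> sat G (?T \<mu>) \<phi>"
    if "set (atom_words G \<phi>) \<subseteq> set (atom_words G \<gamma>)" "bound_vars \<phi> \<subseteq> ?B" "free_vars \<phi> \<subseteq> X \<union> ?B"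
      "fm_consts \<phi> \<subseteq> carrier G"
      "\<And>x. x \<in> X \<Longrightarrow> \<mu> x = \<nu> x" "\<And>x. x \<in> free_vars \<phi> \<Longrightarrow> \<mu> x \<in> carrier G" for \<mu> \<phi>
    using that
  proof (induction \<phi> arbitrary: \<mu>)
    case (Eq s t)
    define u where u: "u = normal_form G (word_of G s @ word_inv G (word_of G t))"
    have uin: "u \<in> set (atom_words G \<gamma>)" using Eq.prems(1) u by simp
    obtain q where q: "potential ?B d p n u q" using pot[OF uin] by blast
    have uw: "u \<in> words (carrier G) (free_vars (Eq s t))"
      by (rule sat_Eq_iff[OF Eq.prems(4) Eq.prems(6) u])
    have uv: "x \<in> free_vars (Eq s t)" if "x \<in> word_vars u" for x
      using that uw by (auto simp: word_vars_iff words_def)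
    have T: "?T \<mu> x \<in> carrier G" if "x \<in> free_vars (Eq s t)" for x
      using that Eq.prems(3,6) \<nu> \<nu>'[of x 0] by (auto intro: move_closed)
    have "word_val G (?T \<mu>) u = \<beta> q \<otimes> word_val G \<mu> u \<otimes> inv \<beta> q"
    proof (rule word_val_move[OF uin q])
      fix x q assume "x \<in> X" "x \<in> word_vars u"
      then show "?T \<mu> x = \<beta> q \<otimes> \<mu> x \<otimes> inv \<beta> (q - d x)" using \<nu>' Eq.prems(5) by simp
    next
      fix x assume "x \<in> ?B" "x \<in> word_vars u"
      then show "?T \<mu> x = move x (\<mu> x)" using disj by auto
    qed (use uv Eq.prems(6) in blast)
    moreover have w: "word_val G \<mu> u \<in> carrier G" using uw Eq.prems(6) by (rule word_val_closed)
    moreover have "word_val G \<mu> u = inv \<beta> q \<otimes> (\<beta> q \<otimes> word_val G \<mu> u \<otimes> inv \<beta> q) \<otimes> \<beta> q"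
      using w by (simp add: m_assoc)
    ultimately have "word_val G (?T \<mu>) u = \<one> \<longleftrightarrow> word_val G \<mu> u = \<one>"
      by (metis \<beta>_closed inv_closed l_inv r_inv r_one)
    then show ?case
      using sat_Eq_iff(2)[OF Eq.prems(4) Eq.prems(6) u] sat_Eq_iff(2)[OF Eq.prems(4) T u] by simp
  next
    case (Ex y \<phi>)
    have y: "y \<in> ?B" "y \<notin> X" using Ex.prems disj by auto
    have "sat G (\<mu>(y := g)) \<phi> \<longleftrightarrow> sat G ((?T \<mu>)(y := move y g)) \<phi>" if "g \<in> carrier G" for g
    proof -
      have "sat G (\<mu>(y := g)) \<phi> \<longleftrightarrow> sat G (?T (\<mu>(y := g))) \<phi>"
        using Ex.prems y that by (intro Ex.IH) auto
      moreover have "?T (\<mu>(y := g)) = (?T \<mu>)(y := move y g)" using y by auto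
      ultimately show ?thesis by simp
    qed
    then show ?case using quant(1)[of "\<lambda>g. sat G ((?T \<mu>)(y := g)) \<phi>" y] by auto
  next
    case (All y \<phi>)
    have y: "y \<in> ?B" "y \<notin> X" using All.prems disj by auto
    have "sat G (\<mu>(y := g)) \<phi> \<longleftrightarrow> sat G ((?T \<mu>)(y := move y g)) \<phi>" if "g \<in> carrier G" for g
    proof -
      have "sat G (\<mu>(y := g)) \<phi> \<longleftrightarrow> sat G (?T (\<mu>(y := g))) \<phi>"
        using All.prems y that by (intro All.IH) auto
      moreover have "?T (\<mu>(y := g)) = (?T \<mu>)(y := move y g)" using y by auto
      ultimately show ?thesis by simp
    qed
    then show ?case using quant(2)[of "\<lambda>g. sat G ((?T \<mu>)(y := g)) \<phi>" y] by auto
  qed auto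
  from this[of \<gamma> \<nu>] have "sat G \<nu> \<gamma> \<longleftrightarrow> sat G (?T \<nu>) \<gamma>" using coeffs free \<nu> by auto
  also have "\<dots> \<longleftrightarrow> sat G \<nu>' \<gamma>" by (rule sat_cong) (use free in simp)
  finally show ?thesis .
qed

end

section \<open>Twisted assignments\<close>

lemma (in group) conj_int_pow:
  assumes "h \<in> carrier G" "x \<in> carrier G"
  shows "(h \<otimes> x \<otimes> inv h) [^] (i :: int) = h \<otimes> x [^] i \<otimes> inv h"
proof (cases i rule: int_cases2)
  case (nonneg k)
  then show ?thesis using conj_pow[OF assms] by (simp add: int_pow_int)
next
  case (nonpos k)
  then show ?thesis using conj_pow[OF assms, of k] assms
    by (simp add: int_pow_neg int_pow_int inv_mult_group m_assoc)
qed

text \<open>\<open>f\<close> is a word of degree \<open>1\<close> in \<open>\<int>/n\<close>, and \<open>tw b k e\<close> compares the \<open>e\<close>-th powers of \<open>b k\<close>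
  and of \<open>b\<close>, the values of \<open>f\<close> after and before a twist.\<close>

locale twisting = group G for G (structure) +
  fixes X :: "var set" and S :: "'a set" and d :: "var \<Rightarrow> int" and n :: nat
    and f :: "'a letter list" and H :: "'a set"
  assumes S: "S \<subseteq> carrier G" and S_inv: "\<And>s. s \<in> S \<Longrightarrow> inv s \<in> S"
    and f: "f \<in> words S X" "[word_deg d f = 1] (mod int n)"
    and H: "subgroup H G"
    and comm: "\<And>h s. h \<in> H \<Longrightarrow> s \<in> S \<Longrightarrow> h \<otimes> s = s \<otimes> h"
    and ord: "n > 0 \<Longrightarrow> finite H \<and> card H dvd n"
begin

abbreviation pts :: "(var \<Rightarrow> 'a) set" where "pts \<equiv> X \<rightarrow>\<^sub>E carrier G"

definition base :: "(var \<Rightarrow> 'a) \<Rightarrow> 'a" where "base \<phi> = word_val G \<phi> f"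

definition deg0_vals :: "(var \<Rightarrow> 'a) \<Rightarrow> 'a set" where
  "deg0_vals \<phi> = {word_val G \<phi> w | w. w \<in> words S X \<and> [word_deg d w = 0] (mod int n)}"

text \<open>The largest subgroup of \<open>H\<close> that centralises \<open>deg0_vals \<phi>\<close> and is normalised by \<open>base \<phi>\<close>.\<close>

definition core :: "(var \<Rightarrow> 'a) \<Rightarrow> 'a set" where
  "core \<phi> = {k \<in> H. (\<forall>g\<in>deg0_vals \<phi>. k \<otimes> g = g \<otimes> k) \<and>
     (\<forall>i :: int. base \<phi> [^] i \<otimes> k \<otimes> inv (base \<phi> [^] i) \<in> H)}"

definition tw :: "'a \<Rightarrow> 'a \<Rightarrow> int \<Rightarrow> 'a" where
  "tw b k e = (b \<otimes> k) [^] e \<otimes> inv (b [^] e)"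

definition twist :: "(var \<Rightarrow> 'a) \<Rightarrow> 'a \<Rightarrow> var \<Rightarrow> 'a" where
  "twist \<phi> k = (\<lambda>x\<in>X. tw (base \<phi>) k (d x) \<otimes> \<phi> x)"

definition conjugate :: "'a \<Rightarrow> (var \<Rightarrow> 'a) \<Rightarrow> var \<Rightarrow> 'a" where
  "conjugate h \<phi> = (\<lambda>x\<in>X. h \<otimes> \<phi> x \<otimes> inv h)"

lemma HG [simp]: "h \<in> H \<Longrightarrow> h \<in> carrier G"
  by (rule subgroup.mem_carrier[OF H])

lemmas H_m = subgroup.m_closed[OF H] and H_i = subgroup.m_inv_closed[OF H]

lemma SG [simp]: "s \<in> S \<Longrightarrow> s \<in> carrier G"
  using S by blast

lemma val_closed [simp]: "\<phi> \<in> pts \<Longrightarrow> w \<in> words S X \<Longrightarrow> word_val G \<phi> w \<in> carrier G"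
  by (rule word_val_closed[OF words_mono[OF _ S order_refl]]) (auto dest: PiE_mem)

lemma val_append:
  "\<phi> \<in> pts \<Longrightarrow> v \<in> words S X \<Longrightarrow> w \<in> words S X \<Longrightarrow>
    word_val G \<phi> (v @ w) = word_val G \<phi> v \<otimes> word_val G \<phi> w"
  by (rule word_val_append[of _ X]) (auto dest: PiE_mem intro: words_mono[OF _ S order_refl])

lemma val_inv:
  "\<phi> \<in> pts \<Longrightarrow> w \<in> words S X \<Longrightarrow> word_val G \<phi> (word_inv G w) = inv (word_val G \<phi> w)"
  by (rule word_val_word_inv[of _ X]) (auto dest: PiE_mem intro: words_mono[OF _ S order_refl])

lemma base_closed [simp]: "\<phi> \<in> pts \<Longrightarrow> base \<phi> \<in> carrier G"
  by (simp add: base_def f)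

lemma deg0_closed: "\<phi> \<in> pts \<Longrightarrow> g \<in> deg0_vals \<phi> \<Longrightarrow> g \<in> carrier G"
  by (auto simp: deg0_vals_def)

lemma pow_word:
  assumes \<phi>: "\<phi> \<in> pts"
  shows "\<exists>v\<in>words S X. word_val G \<phi> v = base \<phi> [^] i \<and> word_deg d v = i * word_deg d f"
proof (induction i rule: int_induct[of _ 0])
  case base
  show ?case by (rule bexI[of _ "[]"]) auto
next
  case (step1 i)
  then obtain v where v: "v \<in> words S X" "word_val G \<phi> v = base \<phi> [^] i" "word_deg d v = i * word_deg d f"
    by blast
  have "word_val G \<phi> (v @ f) = base \<phi> [^] (i + 1)"
    using v \<phi> f by (simp add: val_append int_pow_mult base_def)
  then show ?case using v f by (intro bexI[of _ "v @ f"]) (auto simp: algebra_simps)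
next
  case (step2 i)
  then obtain v where v: "v \<in> words S X" "word_val G \<phi> v = base \<phi> [^] i" "word_deg d v = i * word_deg d f"
    by blast
  have f': "word_inv G f \<in> words S X" using S_inv f(1) by (rule words_word_inv)
  have "base \<phi> [^] (i - 1) = base \<phi> [^] i \<otimes> inv (base \<phi>)"
    using \<phi> by (simp add: int_pow_diff)
  then have "word_val G \<phi> (v @ word_inv G f) = base \<phi> [^] (i - 1)"
    using v \<phi> f f' by (simp add: val_append val_inv base_def)
  then show ?case using v f' by (intro bexI[of _ "v @ word_inv G f"]) (auto simp: algebra_simps word_deg_word_inv)
qed

text \<open>Powers of the base value are values of words, of degree congruent to the exponent. They
  correct a word of any degree to degree 0, where membership in \<open>core\<close> gives
  information.\<close>

lemma deg0_I:
  assumes \<phi>: "\<phi> \<in> pts" and w: "w \<in> words S X" and z: "[i + word_deg d w + j = 0] (mod int n)"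
  shows "base \<phi> [^] i \<otimes> word_val G \<phi> w \<otimes> base \<phi> [^] j \<in> deg0_vals \<phi>"
proof -
  obtain v where v: "v \<in> words S X" "word_val G \<phi> v = base \<phi> [^] i" "word_deg d v = i * word_deg d f"
    using pow_word[OF \<phi>] by blast
  obtain v' where v': "v' \<in> words S X" "word_val G \<phi> v' = base \<phi> [^] j" "word_deg d v' = j * word_deg d f"
    using pow_word[OF \<phi>] by blast
  have "[i * word_deg d f + word_deg d w + j * word_deg d f = i * 1 + word_deg d w + j * 1] (mod int n)"
    by (intro cong_add cong_mult cong_refl f(2))
  then have "[word_deg d (v @ w @ v') = 0] (mod int n)"
    using v v' z by (simp add: add.assoc) (metis cong_trans)
  moreover have "word_val G \<phi> (v @ w @ v') = base \<phi> [^] i \<otimes> word_val G \<phi> w \<otimes> base \<phi> [^] j"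
    using v v' w \<phi> by (simp add: val_append m_assoc)
  moreover have "v @ w @ v' \<in> words S X" using v v' w by simp
  ultimately show ?thesis unfolding deg0_vals_def
    by (intro CollectI exI[of _ "v @ w @ v'"] conjI) (rule sym, assumption | assumption)+
qed

lemma core_H: "k \<in> core \<phi> \<Longrightarrow> k \<in> H"
  by (simp add: core_def)

lemma coreG [simp]: "k \<in> core \<phi> \<Longrightarrow> k \<in> carrier G"
  by (simp add: core_def)

lemma core_subgroup:
  assumes \<phi>: "\<phi> \<in> pts"
  shows "subgroup (core \<phi>) G"
proof (rule subgroupI)
  have "\<one> \<in> core \<phi>" using \<phi> deg0_closed subgroup.one_closed[OF H] by (simp add: core_def)
  then show "core \<phi> \<noteq> {}" by blast
  show "inv k \<in> core \<phi>" if k: "k \<in> core \<phi>" for k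
    unfolding core_def
  proof (intro CollectI conjI ballI allI)
    show "inv k \<in> H" using core_H[OF k] by (rule H_i)
    show "inv k \<otimes> g = g \<otimes> inv k" if "g \<in> deg0_vals \<phi>" for g
      using that k deg0_closed[OF \<phi>] by (intro inv_comm_commute) (auto simp: core_def)
    fix i :: int
    have "inv (base \<phi> [^] i \<otimes> k \<otimes> inv (base \<phi> [^] i)) \<in> H"
      using k by (intro H_i) (simp add: core_def)
    then show "base \<phi> [^] i \<otimes> inv k \<otimes> inv (base \<phi> [^] i) \<in> H"
      using k \<phi> by (simp add: inv_mult_group m_assoc)
  qed
  show "k \<otimes> k' \<in> core \<phi>" if k: "k \<in> core \<phi>" "k' \<in> core \<phi>" for k k'
    unfolding core_def
  proof (intro CollectI conjI ballI allI)
    show "k \<otimes> k' \<in> H" using k by (intro H_m core_H)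
    show "k \<otimes> k' \<otimes> g = g \<otimes> (k \<otimes> k')" if g: "g \<in> deg0_vals \<phi>" for g
    proof -
      have "k \<otimes> g = g \<otimes> k" "k' \<otimes> g = g \<otimes> k'" using k g by (auto simp: core_def)
      then show ?thesis using k deg0_closed[OF \<phi> g] by (metis coreG m_assoc)
    qed
    fix i :: int
    have "(base \<phi> [^] i \<otimes> k \<otimes> inv (base \<phi> [^] i)) \<otimes> (base \<phi> [^] i \<otimes> k' \<otimes> inv (base \<phi> [^] i)) \<in> H"
      by (rule H_m) (use k in \<open>auto simp: core_def\<close>)
    then show "base \<phi> [^] i \<otimes> (k \<otimes> k') \<otimes> inv (base \<phi> [^] i) \<in> H"
      using k \<phi> by (simp add: m_assoc)
  qed
qed auto

lemmas core_m = subgroup.m_closed[OF core_subgroup] and core_i = subgroup.m_inv_closed[OF core_subgroup]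
  and core_1 = subgroup.one_closed[OF core_subgroup]

text \<open>Conjugation by powers of the base value maps values of degree 0 to such values, so
  commuting with all of them is preserved.\<close>

lemma core_conj:
  assumes \<phi>: "\<phi> \<in> pts" and k: "k \<in> core \<phi>"
  shows "base \<phi> [^] (j :: int) \<otimes> k \<otimes> inv (base \<phi> [^] j) \<in> core \<phi>"
  unfolding core_def
proof (intro CollectI conjI ballI allI)
  let ?b = "base \<phi> [^] j"
  show "?b \<otimes> k \<otimes> inv ?b \<in> H" using k by (simp add: core_def)
  show "?b \<otimes> k \<otimes> inv ?b \<otimes> g = g \<otimes> (?b \<otimes> k \<otimes> inv ?b)" if g: "g \<in> deg0_vals \<phi>" for g
  proof -
    obtain w where w: "w \<in> words S X" "g = word_val G \<phi> w" "[word_deg d w = 0] (mod int n)"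
      using g by (auto simp: deg0_vals_def)
    let ?g = "inv ?b \<otimes> g \<otimes> ?b"
    have "?g \<in> deg0_vals \<phi>"
      using deg0_I[OF \<phi> w(1), of "-j" j] w \<phi> by (simp add: int_pow_neg)
    then have "k \<otimes> ?g = ?g \<otimes> k" using k by (simp add: core_def)
    then have "?b \<otimes> (k \<otimes> ?g) \<otimes> inv ?b = ?b \<otimes> (?g \<otimes> k) \<otimes> inv ?b" by simp
    then show ?thesis using \<phi> k deg0_closed[OF \<phi> g] by (simp add: m_assoc)
  qed
  fix i :: int
  have "base \<phi> [^] (i + j) \<otimes> k \<otimes> inv (base \<phi> [^] (i + j)) \<in> H" using k by (simp add: core_def)
  then show "base \<phi> [^] i \<otimes> (?b \<otimes> k \<otimes> inv ?b) \<otimes> inv (base \<phi> [^] i) \<in> H"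
    using \<phi> k by (simp add: int_pow_mult inv_mult_group m_assoc)
qed

text \<open>Dividing a value by the power of the base value of equal degree leaves degree 0: on
  \<open>core \<phi>\<close> both conjugate in the same way.\<close>

lemma val_core:
  assumes \<phi>: "\<phi> \<in> pts" and k: "k \<in> core \<phi>" and w: "w \<in> words S X"
  shows "word_val G \<phi> w \<otimes> k =
    base \<phi> [^] word_deg d w \<otimes> k \<otimes> inv (base \<phi> [^] word_deg d w) \<otimes> word_val G \<phi> w"
proof -
  let ?b = "base \<phi> [^] word_deg d w" and ?v = "word_val G \<phi> w"
  have "inv ?b \<otimes> ?v \<in> deg0_vals \<phi>"
    using deg0_I[OF \<phi> w, of "- word_deg d w" 0] w \<phi> by (simp add: int_pow_neg)
  then have "k \<otimes> (inv ?b \<otimes> ?v) = inv ?b \<otimes> ?v \<otimes> k" using k by (simp add: core_def)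
  then have "?b \<otimes> (k \<otimes> (inv ?b \<otimes> ?v)) = ?b \<otimes> (inv ?b \<otimes> ?v \<otimes> k)" by simp
  then show ?thesis using \<phi> k w by (simp add: m_assoc)
qed

section \<open>The twisting factor as a cocycle in the exponent\<close>

lemma tw_closed [simp]: "b \<in> carrier G \<Longrightarrow> k \<in> carrier G \<Longrightarrow> tw b k e \<in> carrier G"
  by (simp add: tw_def)

lemma tw_0 [simp]: "b \<in> carrier G \<Longrightarrow> k \<in> carrier G \<Longrightarrow> tw b k 0 = \<one>"
  by (simp add: tw_def)

lemma tw_1: "b \<in> carrier G \<Longrightarrow> k \<in> carrier G \<Longrightarrow> tw b k 1 = b \<otimes> k \<otimes> inv b"
  by (simp add: tw_def)

lemma tw_pow: "b \<in> carrier G \<Longrightarrow> k \<in> carrier G \<Longrightarrow> (b \<otimes> k) [^] e = tw b k e \<otimes> b [^] e"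
  by (simp add: tw_def m_assoc)

lemma tw_add:
  "b \<in> carrier G \<Longrightarrow> k \<in> carrier G \<Longrightarrow>
    tw b k (i + j) = tw b k i \<otimes> (b [^] i \<otimes> tw b k j \<otimes> inv (b [^] i))"
  by (simp add: tw_def int_pow_mult inv_mult_group m_assoc)

text \<open>By \<open>tw_add\<close> each factor is a product of conjugates of
  \<open>tw b k 1\<close> by powers of the base value, or of their inverses.\<close>

lemma tw_core:
  assumes \<phi>: "\<phi> \<in> pts" and k: "k \<in> core \<phi>"
  shows "tw (base \<phi>) k e \<in> core \<phi>"
proof -
  let ?t = "tw (base \<phi>) k"
  have c: "base \<phi> [^] i \<otimes> ?t 1 \<otimes> inv (base \<phi> [^] i) \<in> core \<phi>" for i :: int
  proof (rule core_conj[OF \<phi>])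
    show "?t 1 \<in> core \<phi>" using core_conj[OF \<phi> k, of 1] \<phi> k by (simp add: tw_1)
  qed
  show ?thesis
  proof (induction e rule: int_induct[of _ 0])
    case base
    then show ?case using core_1 \<phi> k by simp
  next
    case (step1 i)
    then show ?case using core_m[OF \<phi> _ c[of i]] \<phi> k by (simp add: tw_add)
  next
    case (step2 i)
    define c' where "c' = base \<phi> [^] (i - 1) \<otimes> ?t 1 \<otimes> inv (base \<phi> [^] (i - 1))"
    have c': "c' \<in> core \<phi>" unfolding c'_def by (rule c)
    have "?t i = ?t (i - 1) \<otimes> c'"
      using tw_add[of "base \<phi>" k "i - 1" 1] \<phi> k by (simp add: c'_def)
    then have "?t i \<otimes> inv c' = ?t (i - 1)" using \<phi> k c' by (simp add: m_assoc)
    then show ?case using core_m[OF \<phi> step2(2) core_i[OF \<phi> c']] by simp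
  qed
qed

text \<open>Brauer's lemma applies to \<open>U = core \<phi>\<close>: \<open>b^n\<close> is a value
  of degree 0 modulo \<open>n\<close> and so centralises \<open>core \<phi>\<close>, whose order
  divides that of \<open>H\<close> and hence \<open>n\<close>. For \<open>n = 0\<close> the
  exponents are equal.\<close>

lemma tw_cong:
  assumes \<phi>: "\<phi> \<in> pts" and k: "k \<in> core \<phi>" and e: "[e = e'] (mod int n)"
  shows "tw (base \<phi>) k e = tw (base \<phi>) k e'"
proof (cases "n = 0")
  case True
  then show ?thesis using e by simp
next
  case False
  let ?b = "base \<phi>"
  have fin: "finite H" "card H dvd n" using ord False by auto
  have sub: "subgroup (core \<phi>) (G\<lparr>carrier := H\<rparr>)"
    by (rule subgroup_incl[OF core_subgroup[OF \<phi>] H]) (use core_H in blast)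
  interpret GH: group "G\<lparr>carrier := H\<rparr>" by (rule subgroup_imp_group[OF H])
  have "card (core \<phi>) dvd card H"
    using GH.lagrange_finite[OF _ sub] fin(1) by (simp add: Coset.order_def) (metis dvd_triv_right)
  then have dvd: "card (core \<phi>) dvd n" using fin(2) dvd_trans by blast
  have finc: "finite (core \<phi>)" using fin(1) core_H by (metis finite_subset subsetI)
  have "(?b \<otimes> k) [^] n = ?b [^] n"
  proof (rule Brauer_pow_eq[OF core_subgroup[OF \<phi>] finc dvd])
    show "n > 0" "?b \<in> carrier G" "k \<in> core \<phi>" using False \<phi> k by auto
    show "inv ?b \<otimes> x \<otimes> ?b \<in> core \<phi>" if "x \<in> core \<phi>" for x
      using core_conj[OF \<phi> that, of "- 1"] \<phi> by (simp add: int_pow_neg)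
    have "?b [^] int n \<otimes> word_val G \<phi> [] \<otimes> ?b [^] (0 :: int) \<in> deg0_vals \<phi>"
      by (rule deg0_I[OF \<phi>]) (auto simp: cong_def)
    then have "?b [^] n \<in> deg0_vals \<phi>" using \<phi> by (simp add: int_pow_int)
    then show "?b [^] n \<otimes> x = x \<otimes> ?b [^] n" if "x \<in> core \<phi>" for x
      using that by (simp add: core_def)
  qed
  then have pn: "(?b \<otimes> k) [^] (int n * j) = ?b [^] (int n * j)" for j
    using \<phi> k by (metis base_closed coreG int_pow_int int_pow_pow m_closed)
  obtain j where "e = e' + int n * j" using e by (metis cong_iff_lin cong_sym)
  then show ?thesis using \<phi> k by (simp add: tw_add) (simp add: tw_def pn)
qed

text \<open>Moving the second factor past the value of \<open>v\<close> conjugates it by a power of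
  the base value, exactly as the cocycle identity \<open>tw_add\<close> requires.\<close>

lemma tw_mult:
  assumes \<phi>: "\<phi> \<in> pts" and k: "k \<in> core \<phi>" and v: "v \<in> words S X" and w: "w \<in> words S X"
  shows "(tw (base \<phi>) k (word_deg d v) \<otimes> word_val G \<phi> v) \<otimes> (tw (base \<phi>) k (word_deg d w) \<otimes> word_val G \<phi> w)
    = tw (base \<phi>) k (word_deg d v + word_deg d w) \<otimes> (word_val G \<phi> v \<otimes> word_val G \<phi> w)"
proof -
  let ?t = "tw (base \<phi>) k" and ?b = "base \<phi> [^] word_deg d v"
  have "(?t (word_deg d v) \<otimes> word_val G \<phi> v) \<otimes> (?t (word_deg d w) \<otimes> word_val G \<phi> w)
     = ?t (word_deg d v) \<otimes> (word_val G \<phi> v \<otimes> ?t (word_deg d w)) \<otimes> word_val G \<phi> w"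
    using \<phi> k v w by (simp add: m_assoc)
  also have "\<dots> = ?t (word_deg d v) \<otimes> (?b \<otimes> ?t (word_deg d w) \<otimes> inv ?b \<otimes> word_val G \<phi> v) \<otimes> word_val G \<phi> w"
    by (subst val_core[OF \<phi> tw_core[OF \<phi> k] v]) simp
  also have "\<dots> = ?t (word_deg d v + word_deg d w) \<otimes> (word_val G \<phi> v \<otimes> word_val G \<phi> w)"
    using \<phi> k v w by (simp add: tw_add m_assoc)
  finally show ?thesis .
qed

lemma twist_pts [simp]: "\<phi> \<in> pts \<Longrightarrow> k \<in> core \<phi> \<Longrightarrow> twist \<phi> k \<in> pts"
  by (auto simp: twist_def dest: PiE_mem)

lemma val_twist:
  assumes \<phi>: "\<phi> \<in> pts" and k: "k \<in> core \<phi>" and w: "w \<in> words S X"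
  shows "word_val G (twist \<phi> k) w = tw (base \<phi>) k (word_deg d w) \<otimes> word_val G \<phi> w"
proof -
  note X = PiE_mem[OF \<phi>]
  have letter: "letter_val G (twist \<phi> k) l = tw (base \<phi>) k (letter_deg d l) \<otimes> letter_val G \<phi> l"
    if l: "[l] \<in> words S X" for l
  proof (cases l)
    case (Coef g)
    then show ?thesis using l \<phi> k by simp
  next
    case (Lit x b)
    then have x: "x \<in> X" using l by simp
    show ?thesis
    proof (cases b)
      case True
      then show ?thesis using Lit x by (simp add: twist_def)
    next
      case False
      have "(tw (base \<phi>) k (- d x) \<otimes> inv (\<phi> x)) \<otimes> (tw (base \<phi>) k (d x) \<otimes> \<phi> x) = \<one>"
        using tw_mult[OF \<phi> k, of "[Lit x False]" "[Lit x True]"] x X \<phi> k by simp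
      then have "inv (tw (base \<phi>) k (d x) \<otimes> \<phi> x) = tw (base \<phi>) k (- d x) \<otimes> inv (\<phi> x)"
        using \<phi> k x X by (intro inv_equality) auto
      then show ?thesis using Lit False x by (simp add: twist_def)
    qed
  qed
  have step: "word_val G (twist \<phi> k) (l # w) = tw (base \<phi>) k (word_deg d (l # w)) \<otimes> word_val G \<phi> (l # w)"
    if "[l] \<in> words S X" "w \<in> words S X"
      "word_val G (twist \<phi> k) w = tw (base \<phi>) k (word_deg d w) \<otimes> word_val G \<phi> w" for l w
  proof -
    have "letter_val G \<phi> l \<in> carrier G" using that(1) X by (cases l) auto
    then show ?thesis using tw_mult[OF \<phi> k that(1,2)] letter[OF that(1)] that(3) by simp
  qed
  show ?thesis using w
  proof (induction rule: words_induct)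
    case Nil
    then show ?case using \<phi> k by simp
  next
    case (Coef g w)
    show ?case by (rule step) (use Coef in simp_all)
  next
    case (Lit x b w)
    show ?case by (rule step) (use Lit in simp_all)
  qed
qed

text \<open>Here the degree 1 of \<open>f\<close> enters. The twist can be read off from the base
  value, which is why twists act freely.\<close>

lemma base_twist: "\<phi> \<in> pts \<Longrightarrow> k \<in> core \<phi> \<Longrightarrow> base (twist \<phi> k) = base \<phi> \<otimes> k"
proof -
  assume \<phi>: "\<phi> \<in> pts" and k: "k \<in> core \<phi>"
  have "base (twist \<phi> k) = tw (base \<phi>) k (word_deg d f) \<otimes> base \<phi>"
    unfolding base_def[of "twist \<phi> k"] using val_twist[OF \<phi> k f(1)] by (simp add: base_def)
  also have "tw (base \<phi>) k (word_deg d f) = tw (base \<phi>) k 1" by (rule tw_cong[OF \<phi> k f(2)])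
  finally show ?thesis using \<phi> k by (simp add: tw_1 m_assoc)
qed

lemma val_twist_deg0:
  assumes "\<phi> \<in> pts" "k \<in> core \<phi>" "w \<in> words S X" "[word_deg d w = 0] (mod int n)"
  shows "word_val G (twist \<phi> k) w = word_val G \<phi> w"
  using assms val_twist[OF assms(1-3)] tw_cong[OF assms(1,2,4)] by simp

lemma deg0_vals_twist: "\<phi> \<in> pts \<Longrightarrow> k \<in> core \<phi> \<Longrightarrow> deg0_vals (twist \<phi> k) = deg0_vals \<phi>"
  unfolding deg0_vals_def by (intro Collect_cong ex_cong1) (auto simp: val_twist_deg0)

lemma twist_one: "\<phi> \<in> pts \<Longrightarrow> twist \<phi> \<one> = \<phi>"
proof -
  assume \<phi>: "\<phi> \<in> pts"
  have "twist \<phi> \<one> x = \<phi> x" for x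
    using \<phi> PiE_mem[OF \<phi>, of x] PiE_arb[OF \<phi>, of x] by (cases "x \<in> X") (auto simp: twist_def tw_def)
  then show ?thesis by blast
qed

lemma twist_twist:
  assumes \<phi>: "\<phi> \<in> pts" and k: "k \<in> core \<phi>" "k' \<in> core \<phi>"
  shows "twist (twist \<phi> k) k' = twist \<phi> (k \<otimes> k')"
proof
  fix x
  show "twist (twist \<phi> k) k' x = twist \<phi> (k \<otimes> k') x"
  proof (cases "x \<in> X")
    case True
    then have "twist (twist \<phi> k) k' x = tw (base (twist \<phi> k)) k' (d x) \<otimes> twist \<phi> k x"
      by (simp add: twist_def[of "twist \<phi> k" k'])
    then have "twist (twist \<phi> k) k' x = tw (base \<phi> \<otimes> k) k' (d x) \<otimes> (tw (base \<phi>) k (d x) \<otimes> \<phi> x)"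
      using True unfolding base_twist[OF \<phi> k(1)] by (simp add: twist_def[of \<phi> k])
    then show ?thesis using \<phi> k True PiE_mem[OF \<phi> True] by (simp add: twist_def tw_def m_assoc)
  qed (simp add: twist_def)
qed

text \<open>Values of degree 0 are unchanged, and \<open>(b k)^i\<close> differs from
  \<open>b^i\<close> by a left factor in \<open>H\<close>. The reverse inclusion comes from twisting
  back by \<open>inv k\<close>.\<close>

lemma core_twist:
  assumes \<phi>: "\<phi> \<in> pts" and k: "k \<in> core \<phi>"
  shows "core (twist \<phi> k) = core \<phi>"
proof -
  have sub: "core \<phi> \<subseteq> core (twist \<phi> k)" if \<phi>: "\<phi> \<in> pts" and k: "k \<in> core \<phi>" for \<phi> k
  proof
    fix h assume h: "h \<in> core \<phi>"
    have "(base \<phi> \<otimes> k) [^] i \<otimes> h \<otimes> inv ((base \<phi> \<otimes> k) [^] i) \<in> H" for i :: int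
    proof -
      let ?t = "tw (base \<phi>) k i" and ?c = "base \<phi> [^] i \<otimes> h \<otimes> inv (base \<phi> [^] i)"
      have "?t \<in> H" using tw_core[OF \<phi> k] by (rule core_H)
      moreover have "?c \<in> H" using core_conj[OF \<phi> h] by (rule core_H)
      ultimately have "?t \<otimes> ?c \<otimes> inv ?t \<in> H" using H_m H_i by blast
      also have "?t \<otimes> ?c \<otimes> inv ?t = (base \<phi> \<otimes> k) [^] i \<otimes> h \<otimes> inv ((base \<phi> \<otimes> k) [^] i)"
        using \<phi> k h by (simp add: tw_pow inv_mult_group m_assoc)
      finally show ?thesis .
    qed
    then show "h \<in> core (twist \<phi> k)"
      using h by (simp add: core_def deg0_vals_twist[OF \<phi> k] base_twist[OF \<phi> k])
  qed
  have k': "inv k \<in> core \<phi>" using core_i[OF \<phi> k] .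
  have "core (twist \<phi> k) \<subseteq> core (twist (twist \<phi> k) (inv k))"
    by (rule sub) (use sub[OF \<phi> k] k' \<phi> k in auto)
  also have "twist (twist \<phi> k) (inv k) = \<phi>" using twist_twist[OF \<phi> k k'] twist_one[OF \<phi>] k by simp
  finally show ?thesis using sub[OF \<phi> k] by blast
qed

text \<open>This brings a twist into the form required by \<open>sat_gauge\<close>, with
  \<open>\<beta> = tw b k\<close>; the cocycle identity removes the dependence on
  \<open>q\<close>.\<close>

lemma twist_gauge:
  assumes \<phi>: "\<phi> \<in> pts" and k: "k \<in> core \<phi>" and x: "x \<in> X"
  shows "twist \<phi> k x = tw (base \<phi>) k q \<otimes> \<phi> x \<otimes> inv (tw (base \<phi>) k (q - d x))"
proof -
  let ?t = "tw (base \<phi>) k" and ?b = "base \<phi> [^] d x"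
  note \<phi>x = PiE_mem[OF \<phi> x]
  have "\<phi> x \<otimes> inv (?t (q - d x)) = ?b \<otimes> inv (?t (q - d x)) \<otimes> inv ?b \<otimes> \<phi> x"
    using val_core[OF \<phi> core_i[OF \<phi> tw_core[OF \<phi> k]], of "[Lit x True]"] x \<phi>x by simp
  moreover have "?t q = ?t (d x) \<otimes> (?b \<otimes> ?t (q - d x) \<otimes> inv ?b)"
    using tw_add[of "base \<phi>" k "d x" "q - d x"] \<phi> k by simp
  ultimately have "?t q \<otimes> (\<phi> x \<otimes> inv (?t (q - d x))) = ?t (d x) \<otimes> \<phi> x"
    using \<phi> k \<phi>x by (simp add: m_assoc)
  then show ?thesis using \<phi> k \<phi>x x by (simp add: twist_def m_assoc)
qed

section \<open>Conjugation and the stabiliser of a family of twists\<close>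

lemma conjugate_pts [simp]: "\<phi> \<in> pts \<Longrightarrow> h \<in> H \<Longrightarrow> conjugate h \<phi> \<in> pts"
  by (auto simp: conjugate_def dest: PiE_mem)

lemma val_conjugate:
  assumes \<phi>: "\<phi> \<in> pts" and h: "h \<in> H" and w: "w \<in> words S X"
  shows "word_val G (conjugate h \<phi>) w = h \<otimes> word_val G \<phi> w \<otimes> inv h"
  using w
proof (induction rule: words_induct)
  case Nil
  then show ?case using h by simp
next
  case (Coef g w)
  have "g \<otimes> h = h \<otimes> g" using comm[OF h Coef(1)] by simp
  then have "g \<otimes> (h \<otimes> (word_val G \<phi> w \<otimes> inv h)) = h \<otimes> (g \<otimes> (word_val G \<phi> w \<otimes> inv h))"
    using h Coef \<phi> by (simp flip: m_assoc)
  then show ?case using Coef h \<phi> by (simp add: m_assoc)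
next
  case (Lit x b w)
  then show ?case using h \<phi> PiE_mem[OF \<phi> Lit(1)]
    by (simp add: conjugate_def inv_mult_group m_assoc)
qed

lemma base_conjugate: "\<phi> \<in> pts \<Longrightarrow> h \<in> H \<Longrightarrow> base (conjugate h \<phi>) = h \<otimes> base \<phi> \<otimes> inv h"
  by (simp add: base_def val_conjugate f)

lemma core_conjugate:
  assumes \<phi>: "\<phi> \<in> pts" and h: "h \<in> H" and k: "k \<in> core \<phi>"
  shows "h \<otimes> k \<otimes> inv h \<in> core (conjugate h \<phi>)"
  unfolding core_def
proof (intro CollectI conjI ballI allI)
  show "h \<otimes> k \<otimes> inv h \<in> H" using h core_H[OF k] by (intro H_m H_i)
  show "h \<otimes> k \<otimes> inv h \<otimes> g = g \<otimes> (h \<otimes> k \<otimes> inv h)" if g0: "g \<in> deg0_vals (conjugate h \<phi>)" for g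
  proof -
    obtain w where w: "w \<in> words S X" "[word_deg d w = 0] (mod int n)"
      and "g = word_val G (conjugate h \<phi>) w"
      using g0 by (auto simp: deg0_vals_def)
    then have g: "g = h \<otimes> word_val G \<phi> w \<otimes> inv h" using val_conjugate[OF \<phi> h] by simp
    let ?v = "word_val G \<phi> w"
    have "?v \<in> deg0_vals \<phi>" using w by (auto simp: deg0_vals_def)
    then have "k \<otimes> ?v = ?v \<otimes> k" using k by (simp add: core_def)
    then have "h \<otimes> (k \<otimes> ?v) \<otimes> inv h = h \<otimes> (?v \<otimes> k) \<otimes> inv h" by simp
    then show ?thesis using h k w \<phi> by (simp add: g m_assoc)
  qed
  fix i :: int
  have "h \<otimes> (base \<phi> [^] i \<otimes> k \<otimes> inv (base \<phi> [^] i)) \<otimes> inv h \<in> H"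
    by (rule H_m[OF H_m[OF h] H_i[OF h]]) (use k in \<open>simp add: core_def\<close>)
  moreover have "base (conjugate h \<phi>) [^] i = h \<otimes> base \<phi> [^] i \<otimes> inv h"
    using \<phi> h by (simp add: base_conjugate conj_int_pow)
  ultimately show "base (conjugate h \<phi>) [^] i \<otimes> (h \<otimes> k \<otimes> inv h) \<otimes> inv (base (conjugate h \<phi>) [^] i) \<in> H"
    using \<phi> h k by (simp add: inv_mult_group m_assoc)
qed

lemma conjugate_twist:
  assumes \<phi>: "\<phi> \<in> pts" and h: "h \<in> H" and k: "k \<in> core \<phi>"
  shows "conjugate h (twist \<phi> k) = twist (conjugate h \<phi>) (h \<otimes> k \<otimes> inv h)"
proof
  fix x
  show "conjugate h (twist \<phi> k) x = twist (conjugate h \<phi>) (h \<otimes> k \<otimes> inv h) x"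
  proof (cases "x \<in> X")
    case True
    let ?b = "base \<phi>"
    have "h \<otimes> ?b \<otimes> inv h \<otimes> (h \<otimes> k \<otimes> inv h) = h \<otimes> (?b \<otimes> k) \<otimes> inv h"
      using \<phi> h k by (simp add: m_assoc)
    then have "tw (h \<otimes> ?b \<otimes> inv h) (h \<otimes> k \<otimes> inv h) (d x) = h \<otimes> tw ?b k (d x) \<otimes> inv h"
      using \<phi> h k by (simp add: tw_def conj_int_pow inv_mult_group m_assoc del: m_assoc)
         (simp add: m_assoc inv_mult_group)
    then have "twist (conjugate h \<phi>) (h \<otimes> k \<otimes> inv h) x = (h \<otimes> tw ?b k (d x) \<otimes> inv h) \<otimes> (h \<otimes> \<phi> x \<otimes> inv h)"
      using True by (simp add: twist_def base_conjugate[OF \<phi> h]) (simp add: conjugate_def)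
    then show ?thesis using True \<phi> h k PiE_mem[OF \<phi> True]
      by (simp add: conjugate_def twist_def m_assoc)
  qed (simp add: conjugate_def twist_def)
qed

text \<open>Twists fix the values of degree 0, so \<open>h\<close> commutes with them. On base
  values the equation reads \<open>h b h^-1 = b k\<close>; its \<open>i\<close>-th power gives
  \<open>b^i h b^-i = t^-1 h\<close> with \<open>t\<close> in \<open>core \<phi>\<close>.\<close>

lemma stabiliser_core:
  assumes \<phi>: "\<phi> \<in> pts" and h: "h \<in> H" and k: "k \<in> core \<phi>" and eq: "conjugate h \<phi> = twist \<phi> k"
  shows "h \<in> core \<phi>"
  unfolding core_def
proof (intro CollectI conjI ballI allI h)
  show "h \<otimes> g = g \<otimes> h" if g: "g \<in> deg0_vals \<phi>" for g
  proof -
    obtain w where w: "w \<in> words S X" "[word_deg d w = 0] (mod int n)" "g = word_val G \<phi> w"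
      using g by (auto simp: deg0_vals_def)
    have "h \<otimes> g \<otimes> inv h = g"
      using val_conjugate[OF \<phi> h w(1)] val_twist_deg0[OF \<phi> k w(1,2)] w(3) eq by simp
    then have "h \<otimes> g \<otimes> inv h \<otimes> h = g \<otimes> h" by simp
    then show ?thesis using h deg0_closed[OF \<phi> g] by (simp add: m_assoc)
  qed
  fix i :: int
  let ?b = "base \<phi>" and ?t = "tw (base \<phi>) k i"
  have "h \<otimes> ?b \<otimes> inv h = ?b \<otimes> k" using base_conjugate[OF \<phi> h] base_twist[OF \<phi> k] eq by simp
  then have "h \<otimes> ?b [^] i \<otimes> inv h = ?t \<otimes> ?b [^] i"
    using conj_int_pow[of h ?b i] \<phi> h k by (simp add: tw_pow)
  then have "inv ?t \<otimes> (h \<otimes> ?b [^] i \<otimes> inv h) \<otimes> h \<otimes> inv (?b [^] i) = inv ?t \<otimes> (?t \<otimes> ?b [^] i) \<otimes> h \<otimes> inv (?b [^] i)"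
    by simp
  then have "?b [^] i \<otimes> h \<otimes> inv (?b [^] i) = inv ?t \<otimes> h"
    using \<phi> h k by (simp add: m_assoc)
  then show "?b [^] i \<otimes> h \<otimes> inv (?b [^] i) \<in> H"
    using H_m[OF H_i[OF core_H[OF tw_core[OF \<phi> k]]] h] by simp
qed

lemma core_stabilises:
  assumes \<phi>: "\<phi> \<in> pts" and h: "h \<in> core \<phi>"
  shows "\<exists>k\<in>core \<phi>. conjugate h \<phi> = twist \<phi> k"
proof
  let ?b = "base \<phi>"
  \<comment> \<open>The solution of \<open>h b h^-1 = b k\<close>, forced by comparing base
    values.\<close>
  let ?k = "inv ?b \<otimes> h \<otimes> ?b \<otimes> inv h"
  have "inv ?b \<otimes> h \<otimes> ?b \<in> core \<phi>"
    using core_conj[OF \<phi> h, of "- 1"] \<phi> by (simp add: int_pow_neg)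
  then show k: "?k \<in> core \<phi>" using core_m[OF \<phi>] core_i[OF \<phi> h] by blast
  show "conjugate h \<phi> = twist \<phi> ?k"
  proof
    fix x
    show "conjugate h \<phi> x = twist \<phi> ?k x"
    proof (cases "x \<in> X")
      case True
      note \<phi>x = PiE_mem[OF \<phi> True]
      let ?bd = "?b [^] d x"
      have "?b \<otimes> ?k = h \<otimes> ?b \<otimes> inv h" using \<phi> h by (simp add: m_assoc)
      then have "tw ?b ?k (d x) = h \<otimes> ?bd \<otimes> inv h \<otimes> inv ?bd"
        using \<phi> h by (simp add: tw_def conj_int_pow)
      moreover have "\<phi> x \<otimes> inv h = ?bd \<otimes> inv h \<otimes> inv ?bd \<otimes> \<phi> x"
        using val_core[OF \<phi> core_i[OF \<phi> h], of "[Lit x True]"] True \<phi>x by simp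
      ultimately show ?thesis using True \<phi> h \<phi>x by (simp add: conjugate_def twist_def m_assoc)
    qed (simp add: conjugate_def twist_def)
  qed
qed

lemma twisting_eqpoll:
  assumes sub: "\<Phi> \<subseteq> pts"
    and tc: "\<And>\<phi> k. \<phi> \<in> \<Phi> \<Longrightarrow> k \<in> core \<phi> \<Longrightarrow> twist \<phi> k \<in> \<Phi>"
    and cc: "\<And>\<phi> h. \<phi> \<in> \<Phi> \<Longrightarrow> h \<in> H \<Longrightarrow> conjugate h \<phi> \<in> \<Phi>"
  shows "\<exists>Q\<subseteq>\<Phi>. \<Phi> \<approx> H \<times> Q"
proof (rule fibred_action_eqpoll[where c = conjugate and t = twist and K = core])
  have P: "\<phi> \<in> pts" if "\<phi> \<in> \<Phi>" for \<phi> using that sub by blast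
  note [simp] = P
  show "subgroup H G" by (rule H)
  show "conjugate h \<phi> \<in> \<Phi>" if "h \<in> H" "\<phi> \<in> \<Phi>" for h \<phi> using cc that by blast
  show "conjugate \<one> \<phi> = \<phi>" if "\<phi> \<in> \<Phi>" for \<phi>
  proof
    fix x show "conjugate \<one> \<phi> x = \<phi> x"
      using PiE_mem[OF P[OF that], of x] PiE_arb[OF P[OF that], of x] by (cases "x \<in> X") (auto simp: conjugate_def)
  qed
  show "conjugate h (conjugate h' \<phi>) = conjugate (h \<otimes> h') \<phi>" if "h \<in> H" "h' \<in> H" "\<phi> \<in> \<Phi>" for h h' \<phi>
  proof
    fix x show "conjugate h (conjugate h' \<phi>) x = conjugate (h \<otimes> h') \<phi> x"
      using PiE_mem[OF P[OF that(3)], of x] that by (cases "x \<in> X") (auto simp: conjugate_def m_assoc inv_mult_group)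
  qed
  show "core \<phi> \<subseteq> H" if "\<phi> \<in> \<Phi>" for \<phi> using core_H by blast
  show "k = k'" if "\<phi> \<in> \<Phi>" "k \<in> core \<phi>" "k' \<in> core \<phi>" "twist \<phi> k = twist \<phi> k'" for \<phi> k k'
  proof -
    have "base \<phi> \<otimes> k = base \<phi> \<otimes> k'" using that base_twist[OF P] by metis
    then have "inv base \<phi> \<otimes> (base \<phi> \<otimes> k) = inv base \<phi> \<otimes> (base \<phi> \<otimes> k')" by simp
    then show ?thesis using that by simp
  qed
qed (use sub tc in \<open>auto intro: core_subgroup core_conjugate conjugate_twist stabiliser_core core_stabilises
       simp: twist_one twist_twist core_twist\<close>)

end

section \<open>Divisibility of the number of solutions\<close>

lemma exists_word_deg:
  assumes "\<And>j. j < k \<Longrightarrow> xs ! j \<in> X"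
  shows "\<exists>f\<in>words S X. word_deg d f = (\<Sum>j<k. c j * d (xs ! j))"
  using assms
proof (induction k)
  case 0
  then show ?case by (intro bexI[of _ "[]"]) auto
next
  case (Suc k)
  then obtain f where f: "f \<in> words S X" "word_deg d f = (\<Sum>j<k. c j * d (xs ! j))" by auto
  let ?g = "replicate (nat \<bar>c k\<bar>) (Lit (xs ! k) (c k \<ge> 0)) :: 'a letter list"
  have "?g \<in> words S X" using Suc.prems by (auto simp: words_def)
  moreover have "word_deg d ?g = c k * d (xs ! k)" by (auto simp: sum_list_replicate)
  ultimately show ?case using f by (intro bexI[of _ "f @ ?g"]) auto
qed

lemma cycle_row_mult:
  fixes l :: "'e \<Rightarrow> int vec"
  shows "(\<Sum>j<m. cycle_row m l c $ j * d j) =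
    (\<Sum>(e, b)\<leftarrow>c. if b then \<Sum>j<m. l e $ j * d j else - (\<Sum>j<m. l e $ j * d j))"
proof -
  have "(\<Sum>j<m. (\<Sum>(e, b)\<leftarrow>c. if b then l e $ j else - (l e $ j)) * d j) =
    (\<Sum>(e, b)\<leftarrow>c. if b then \<Sum>j<m. l e $ j * d j else - (\<Sum>j<m. l e $ j * d j))"
    by (induction c) (auto simp: distrib_right sum.distrib sum_negf)
  then show ?thesis by (simp add: cycle_row_def)
qed

text \<open>The cycle rows make the labels sum to degree 0 modulo \<open>n\<close> around generating
  cycles, which yields a potential on the graph; the other rows give degree 0 to atoms without bound
  variables.\<close>

lemma exists_potential:
  fixes G :: "('a, 'b) monoid_scheme" and \<gamma> :: "'a fm"
  assumes disj: "set xs \<inter> bound_vars \<gamma> = {}" and dist: "distinct xs"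
    and A: "is_matrix_of G xs \<gamma> A"
    and d0: "\<And>y. y \<notin> set xs \<Longrightarrow> d y = 0"
    and Ad: "\<And>a. a < dim_row A \<Longrightarrow> n dvd (\<Sum>j<length xs. A $$ (a, j) * d (xs ! j))"
  shows "\<exists>p. \<forall>u\<in>set (atom_words G \<gamma>). \<exists>q. potential (bound_vars \<gamma>) d p n u q"
proof -
  let ?m = "length xs" and ?B = "bound_vars \<gamma>"
  let ?bd = "filter (\<lambda>u. word_vars u \<inter> ?B \<noteq> {}) (atom_words G \<gamma>)"
  let ?fr = "filter (\<lambda>u. word_vars u \<inter> ?B = {}) (atom_words G \<gamma>)"
  obtain Fs E cs where Fs: "list_all2 (is_factorization ?B (set xs)) ?bd Fs"
    and E: "E = concat (map (atom_edges xs) Fs)"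
    and gen: "generates_H1 (edge_graph ?B E) cs"
    and Aeq: "A = mat_of_rows ?m (map (cycle_row ?m (edge_label E)) cs @ map (exp_vec xs) ?fr)"
    using A unfolding is_matrix_of_def by blast
  let ?\<Gamma> = "edge_graph ?B E"
  have row: "n dvd (\<Sum>j<?m. r $ j * d (xs ! j))"
    if r: "r \<in> set (map (cycle_row ?m (edge_label E)) cs @ map (exp_vec xs) ?fr)" for r
  proof -
    let ?rows = "map (cycle_row ?m (edge_label E)) cs @ map (exp_vec xs) ?fr"
    obtain i where i: "i < length ?rows" "r = ?rows ! i" using r by (metis in_set_conv_nth)
    have "A $$ (i, j) = r $ j" if "j < ?m" for j
      unfolding Aeq i(2) by (rule mat_of_rows_index[OF i(1) that])
    moreover have "i < dim_row A" using i(1) by (simp add: Aeq)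
    ultimately show ?thesis using Ad[of i] by simp
  qed
  have dX: "(\<lambda>x. if x \<in> set xs then d x else 0) = d" using d0 by auto
  have exp: "(\<Sum>j<?m. exp_vec xs w $ j * d (xs ! j)) = word_deg d w" for w :: "'a letter list"
    using word_deg_exp_sum[OF dist, of w d] by (simp add: dX exp_vec_def)
  define \<delta> where "\<delta> e = (\<Sum>j<?m. edge_label E e $ j * d (xs ! j))" for e
  have fin: "finite (arcs ?\<Gamma>)" by (simp add: edge_graph_def)
  have "n dvd (\<Sum>(e, b)\<leftarrow>c. if b then \<delta> e else - \<delta> e)" if "c \<in> set cs" for c
    using row[of "cycle_row ?m (edge_label E) c"] that unfolding cycle_row_mult \<delta>_def by simp
  then have "n dvd (\<Sum>e\<in>arcs ?\<Gamma>. z e * \<delta> e)" if "z \<in> H1 ?\<Gamma>" for z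
    using generates_H1_dvd[OF fin gen _ that] by blast
  then obtain p where p: "\<And>e. e \<in> arcs ?\<Gamma> \<Longrightarrow> [p (head ?\<Gamma> e) - p (tail ?\<Gamma> e) = \<delta> e] (mod n)"
    using potential_exists[OF fin] by blast
  have edge: "[p z - p y = (\<Sum>j<?m. l $ j * d (xs ! j))] (mod n)" if "(y, l, z) \<in> set E" for y l z
  proof -
    obtain e where e: "e < length E" "E ! e = (y, l, z)" using \<open>(y, l, z) \<in> set E\<close> by (metis in_set_conv_nth)
    then show ?thesis using p[of e] by (simp add: edge_graph_def \<delta>_def edge_label_def)
  qed
  \<comment> \<open>The sign is reversed because \<open>p\<close> rises by the label along an arc,
    while the level falls by the degree as a word is read.\<close>
  have "\<exists>q. potential ?B d (\<lambda>y. - p y) n u q" if u: "u \<in> set (atom_words G \<gamma>)" for u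
  proof (cases "word_vars u \<inter> ?B = {}")
    case True
    then have "n dvd word_deg d u" using row[of "exp_vec xs u"] u by (simp add: exp)
    moreover have "y \<notin> ?B" if "u = a @ Lit y b # c" for a y b c using True that by auto
    ultimately show ?thesis by (auto simp: potential_def cong_0_iff)
  next
    case False
    then have "u \<in> set ?bd" using u by simp
    then obtain i where "i < length ?bd" "?bd ! i = u" by (metis in_set_conv_nth)
    then obtain fs where fs: "fs \<in> set Fs" and fact: "is_factorization ?B (set xs) u fs"
      using Fs unfolding list_all2_conv_all_nth by (metis nth_mem)
    show ?thesis
    proof (rule potential_factorization[OF fact False disj])
      show "d y = 0" if "y \<in> ?B" for y using d0 disj that by blast
      fix i v y w v' y' w'
      assume i: "i < length fs" "fs ! i = (v, y, w)" "fs ! ((i + 1) mod length fs) = (v', y', w')"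
      show "[- p y - - p y' = word_deg d w] (mod n)"
      proof (cases "y = y' \<and> exp_vec xs w = 0\<^sub>v ?m")
        \<comment> \<open>A loop with zero label is no arc of the graph; here both sides are
          0.\<close>
        case True
        then show ?thesis using exp[of w] by simp
      next
        case False
        let ?e = "\<lambda>i. case fs ! i of (v, y, w) \<Rightarrow> (y, exp_vec xs w, fst (snd (fs ! ((i + 1) mod length fs))))"
        have "?e i \<in> ?e ` {0..<length fs}" using i(1) by auto
        moreover have "?e i = (y, exp_vec xs w, y')" using i(2,3) by simp
        ultimately have "(y, exp_vec xs w, y') \<in> set (atom_edges xs fs)"
          using False by (simp add: atom_edges_def)
        then have "(y, exp_vec xs w, y') \<in> set E" using fs by (auto simp: E)
        then show ?thesis using edge[of y "exp_vec xs w" y'] by (simp add: exp)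
      qed
    qed
  qed
  then show ?thesis by blast
qed

lemma (in group) centralizer_subgroup:
  assumes "T \<subseteq> carrier G"
  shows "subgroup (centralizer G T) G"
proof (rule subgroupI)
  have "\<one> \<in> centralizer G T" using assms by (auto simp: centralizer_def)
  then show "centralizer G T \<noteq> {}" by blast
  show "inv c \<in> centralizer G T" if "c \<in> centralizer G T" for c
    using that assms by (auto simp: centralizer_def intro: inv_comm_commute)
  show "c \<otimes> c' \<in> centralizer G T" if "c \<in> centralizer G T" "c' \<in> centralizer G T" for c c'
  proof -
    have c: "c \<in> carrier G" "c' \<in> carrier G" using that by (auto simp: centralizer_def)
    have "c \<otimes> c' \<otimes> s = s \<otimes> (c \<otimes> c')" if s: "s \<in> T" for s
    proof -
      have "c \<otimes> s = s \<otimes> c" "c' \<otimes> s = s \<otimes> c'"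
        using s \<open>c \<in> centralizer G T\<close> \<open>c' \<in> centralizer G T\<close> by (auto simp: centralizer_def)
      then show ?thesis using c s assms by (metis m_assoc subsetD)
    qed
    then show ?thesis using c by (simp add: centralizer_def)
  qed
qed (auto simp: centralizer_def)

lemma nonisolated_coeffs_carrier:
  assumes "group G" "fm_consts \<gamma> \<subseteq> carrier G"
  shows "nonisolated_coeffs G \<gamma> \<subseteq> carrier G"
  using group.atom_words_carrier[OF assms] by (fastforce simp: nonisolated_coeffs_def)

lemma solutions_bij_betw:
  fixes G :: "('a, 'b) monoid_scheme"
  assumes dist: "distinct xs" and X: "set xs = free_vars \<gamma>"
  shows "bij_betw (\<lambda>\<phi>. map \<phi> xs) {\<phi> \<in> set xs \<rightarrow>\<^sub>E carrier G. sat G \<phi> \<gamma>} (solutions G xs \<gamma>)"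
proof (rule bij_betw_imageI)
  show "inj_on (\<lambda>\<phi>. map \<phi> xs) {\<phi> \<in> set xs \<rightarrow>\<^sub>E carrier G. sat G \<phi> \<gamma>}"
    by (rule inj_onI) (auto intro: PiE_ext)
  show "(\<lambda>\<phi>. map \<phi> xs) ` {\<phi> \<in> set xs \<rightarrow>\<^sub>E carrier G. sat G \<phi> \<gamma>} = solutions G xs \<gamma>"
  proof (intro equalityI subsetI)
    fix gs assume "gs \<in> (\<lambda>\<phi>. map \<phi> xs) ` {\<phi> \<in> set xs \<rightarrow>\<^sub>E carrier G. sat G \<phi> \<gamma>}"
    then obtain \<phi> where gs: "gs = map \<phi> xs" and \<phi>: "\<phi> \<in> set xs \<rightarrow>\<^sub>E carrier G" "sat G \<phi> \<gamma>" by blast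
    have "sat G (the \<circ> map_of (zip xs gs)) \<gamma> \<longleftrightarrow> sat G \<phi> \<gamma>"
      by (rule sat_cong) (simp add: gs map_of_zip_map flip: X)
    then show "gs \<in> solutions G xs \<gamma>" using gs \<phi> by (auto simp: solutions_def dest: PiE_mem)
  next
    fix gs assume gs: "gs \<in> solutions G xs \<gamma>"
    let ?\<nu> = "the \<circ> map_of (zip xs gs)"
    let ?\<phi> = "restrict ?\<nu> (set xs)"
    have len: "length xs = length gs" and car: "set gs \<subseteq> carrier G" and sat: "sat G ?\<nu> \<gamma>"
      using gs by (auto simp: solutions_def)
    have nth: "?\<nu> (xs ! i) = gs ! i" if "i < length xs" for i
      using map_of_zip_nth[OF len dist] that len by simp
    have "map ?\<phi> xs = gs" by (rule nth_equalityI) (use len nth in auto)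
    moreover have "?\<phi> \<in> set xs \<rightarrow>\<^sub>E carrier G"
    proof (rule restrict_PiE_iff[THEN iffD2], intro ballI)
      fix x assume "x \<in> set xs"
      then obtain i where "i < length xs" "x = xs ! i" by (metis in_set_conv_nth)
      then show "?\<nu> x \<in> carrier G" using nth len car by (metis nth_mem subsetD)
    qed
    moreover have "sat G ?\<phi> \<gamma> \<longleftrightarrow> sat G ?\<nu> \<gamma>" by (rule sat_cong) (simp flip: X)
    ultimately show "gs \<in> (\<lambda>\<phi>. map \<phi> xs) ` {\<phi> \<in> set xs \<rightarrow>\<^sub>E carrier G. sat G \<phi> \<gamma>}"
      using sat by (intro image_eqI[of _ _ ?\<phi>]) auto
  qed
qed

lemma card_dvd_subgroup_solutions:
  fixes G :: "('a, 'b) monoid_scheme" (structure) and \<gamma> :: "'a fm"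
  assumes "group G" and co: "fm_consts \<gamma> \<subseteq> carrier G"
    and disj: "free_vars \<gamma> \<inter> bound_vars \<gamma> = {}"
    and dist: "distinct xs" and X: "set xs = free_vars \<gamma>" and m: "length xs = m" "m \<ge> 1"
    and A: "is_matrix_of G xs \<gamma> A"
    and n: "n = minors_gcd A m div minors_gcd A (m - 1)"
    and C: "C = centralizer G (nonisolated_coeffs G \<gamma>)"
    and H: "subgroup H G" "H \<subseteq> C" and ord: "n > 0 \<Longrightarrow> finite H \<and> card H dvd n"
  shows "card_dvd H (solutions G xs \<gamma>)"
proof -
  interpret group G by fact
  let ?X = "set xs" and ?N = "nonisolated_coeffs G \<gamma>"
  have N: "?N \<subseteq> carrier G" using \<open>group G\<close> co by (rule nonisolated_coeffs_carrier)
  have CG: "C \<subseteq> carrier G" by (auto simp: C centralizer_def)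
  have dim: "dim_col A = m" using A m(1) by (auto simp: is_matrix_of_def)
  obtain d0 c :: "nat \<Rightarrow> int" where d0: "\<And>a. a < dim_row A \<Longrightarrow> int n dvd (\<Sum>j<m. A $$ (a, j) * d0 j)"
    and c: "[(\<Sum>j<m. c j * d0 j) = 1] (mod int n)"
    using exists_degree[OF dim m(2) n] by blast
  define d where "d x = (\<Sum>j<m. if xs ! j = x then d0 j else 0)" for x
  have d: "d (xs ! j) = d0 j" if "j < m" for j
  proof -
    have "d (xs ! j) = (\<Sum>i<m. if i = j then d0 i else 0)"
      unfolding d_def by (rule sum.cong) (use that m(1) dist in \<open>auto simp: nth_eq_iff_index_eq\<close>)
    then show ?thesis using that by simp
  qed
  have dX: "d y = 0" if "y \<notin> ?X" for y
    unfolding d_def by (rule sum.neutral) (use that m(1) in auto)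
  have "\<exists>p. \<forall>u\<in>set (atom_words G \<gamma>). \<exists>q. potential (bound_vars \<gamma>) d p (int n) u q"
    by (rule exists_potential[OF _ dist A]) (use disj dX d0 d m(1) X in auto)
  then obtain p where p: "\<forall>u\<in>set (atom_words G \<gamma>). \<exists>q. potential (bound_vars \<gamma>) d p (int n) u q" ..
  \<comment> \<open>The centralizer of \<open>C\<close> contains the non-isolated coefficients,
    commutes with \<open>H\<close> and is closed under inverses, as negative powers of the base
    value require.\<close>
  let ?S = "centralizer G C"
  have S: "subgroup ?S G" using CG by (rule centralizer_subgroup)
  have NS: "?N \<subseteq> ?S" using N by (auto simp: centralizer_def C)
  obtain f where f: "f \<in> words ?S ?X" "word_deg d f = (\<Sum>j<m. c j * d (xs ! j))"
    using exists_word_deg[of m xs ?X ?S d c] m(1) by auto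
  have "word_deg d f = (\<Sum>j<m. c j * d0 j)" using f(2) d by simp
  then have f1: "[word_deg d f = 1] (mod int n)" using c by simp
  interpret tw: twisting G ?X ?S d n f H
  proof (intro twisting.intro twisting_axioms.intro)
    show "?S \<subseteq> carrier G" by (rule subgroup.subset[OF S])
    show "inv s \<in> ?S" if "s \<in> ?S" for s using S that by (rule subgroup.m_inv_closed)
    show "h \<otimes> s = s \<otimes> h" if "h \<in> H" "s \<in> ?S" for h s
      using that H(2) by (auto simp: centralizer_def)
  qed (use group_axioms f f1 H ord in auto)
  let ?\<Phi> = "{\<phi> \<in> ?X \<rightarrow>\<^sub>E carrier G. sat G \<phi> \<gamma>}"
  have HN: "h \<otimes> g = g \<otimes> h" if "h \<in> H" "g \<in> ?N" for h g using tw.comm that NS by blast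
  \<comment> \<open>Used for both operations: \<beta> is \<open>tw\<close> for a twist and constant
    for a conjugation.\<close>
  have gauge: "sat G \<phi> \<gamma> \<longleftrightarrow> sat G \<phi>' \<gamma>"
    if \<beta>: "\<And>q. \<beta> q \<in> H" "\<And>q q'. [q = q'] (mod int n) \<Longrightarrow> \<beta> q = \<beta> q'" and \<phi>: "\<phi> \<in> ?X \<rightarrow>\<^sub>E carrier G"
      and \<phi>': "\<And>x q. x \<in> ?X \<Longrightarrow> \<phi>' x = \<beta> q \<otimes> \<phi> x \<otimes> inv (\<beta> (q - d x))" for \<beta> \<phi> \<phi>'
  proof -
    interpret gauge G \<gamma> ?X d p "int n" \<beta>
    proof
      show "\<exists>q. potential (bound_vars \<gamma>) d p (int n) u q" if "u \<in> set (atom_words G \<gamma>)" for u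
        using p that by blast
      show "d y = 0" if "y \<in> bound_vars \<gamma>" for y using dX X disj that by blast
      show "\<beta> q \<otimes> g = g \<otimes> \<beta> q" if "g \<in> ?N" for q g using HN \<beta>(1) that by blast
      show "\<beta> q \<in> carrier G" for q using \<beta>(1) by (rule tw.HG)
    qed (use co X disj \<beta>(2) in auto)
    show ?thesis by (rule sat_gauge) (use \<phi> \<phi>' in \<open>auto dest: PiE_mem\<close>)
  qed
  obtain Q where Q: "Q \<subseteq> ?\<Phi>" "?\<Phi> \<approx> H \<times> Q"
  proof (rule exE[OF tw.twisting_eqpoll[of ?\<Phi>]])
    show "?\<Phi> \<subseteq> ?X \<rightarrow>\<^sub>E carrier G" by blast
    show "tw.twist \<phi> k \<in> ?\<Phi>" if "\<phi> \<in> ?\<Phi>" "k \<in> tw.core \<phi>" for \<phi> k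
    proof -
      have \<phi>: "\<phi> \<in> ?X \<rightarrow>\<^sub>E carrier G" "sat G \<phi> \<gamma>" using that(1) by auto
      have "sat G \<phi> \<gamma> \<longleftrightarrow> sat G (tw.twist \<phi> k) \<gamma>"
        by (rule gauge[of "tw.tw (tw.base \<phi>) k"])
          (use \<phi>(1) that(2) in \<open>auto intro: tw.core_H tw.tw_core tw.tw_cong tw.twist_gauge\<close>)
      then show ?thesis using tw.twist_pts[OF \<phi>(1) that(2)] \<phi>(2) by simp
    qed
    show "tw.conjugate h \<phi> \<in> ?\<Phi>" if "\<phi> \<in> ?\<Phi>" "h \<in> H" for \<phi> h
    proof -
      have \<phi>: "\<phi> \<in> ?X \<rightarrow>\<^sub>E carrier G" "sat G \<phi> \<gamma>" using that(1) by auto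
      have "sat G \<phi> \<gamma> \<longleftrightarrow> sat G (tw.conjugate h \<phi>) \<gamma>"
        by (rule gauge[of "\<lambda>_. h"]) (use \<phi>(1) that(2) in \<open>auto simp: tw.conjugate_def\<close>)
      then show ?thesis using tw.conjugate_pts[OF \<phi>(1) that(2)] \<phi>(2) by simp
    qed
  qed (use that in blast)
  let ?F = "\<lambda>\<phi>. map \<phi> xs"
  have bij: "bij_betw ?F ?\<Phi> (solutions G xs \<gamma>)" by (rule solutions_bij_betw[OF dist X])
  then have "solutions G xs \<gamma> \<approx> ?\<Phi>" using eqpoll_sym unfolding eqpoll_def by blast
  also have "?\<Phi> \<approx> H \<times> Q" by (rule Q(2))
  \<comment> \<open>\<open>card_dvd\<close> asks for a cofactor of the type of the dividend, hence
    the passage to tuples.\<close>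
  also have "H \<times> Q \<approx> H \<times> ?F ` Q"
    using bij Q(1) by (intro times_eqpoll_cong eqpoll_refl eqpoll_sym[OF inj_on_image_eqpoll_self])
      (auto simp: bij_betw_def intro: inj_on_subset)
  finally show ?thesis unfolding card_dvd_def by blast
qed

lemma card_dvd_eqpoll_left:
  fixes B :: "'b set"
  assumes "card_dvd A B" "A' \<approx> A"
  shows "card_dvd A' B"
proof -
  obtain D :: "'b set" where "B \<approx> A \<times> D" using assms(1) unfolding card_dvd_def by blast
  then have "B \<approx> A' \<times> D"
    by (rule eqpoll_trans[OF _ times_eqpoll_cong[OF eqpoll_sym[OF assms(2)] eqpoll_refl]])
  then show ?thesis unfolding card_dvd_def by blast
qed

theorem mainTheorem1:
  fixes G :: "('a, 'b) monoid_scheme" and \<gamma> :: "'a fm" and xs :: "var list" and m n :: nat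
    and A :: "int mat" and C :: "'a set"
  assumes "group G"
    and "fm_consts \<gamma> \<subseteq> carrier G"
    and "free_vars \<gamma> \<inter> bound_vars \<gamma> = {}"
    and "distinct xs" and "set xs = free_vars \<gamma>" and "length xs = m" and "m \<ge> 1"
    and "is_matrix_of G xs \<gamma> A"
    and "n = minors_gcd A m div minors_gcd A (m - 1)"
    and "C = centralizer G (nonisolated_coeffs G \<gamma>)"
  shows "card_dvd (card_GCD (G\<lparr>carrier := C\<rparr>) n) (solutions G xs \<gamma>)"
proof -
  interpret group G by fact
  have C: "subgroup C G"
    unfolding assms(10) by (rule centralizer_subgroup[OF nonisolated_coeffs_carrier[OF assms(1,2)]])
  have GC: "group (G\<lparr>carrier := C\<rparr>)" using C by (rule subgroup_imp_group)
  note main = card_dvd_subgroup_solutions[OF assms]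
  show ?thesis
  proof (cases "n = 0")
    case True
    have "card_dvd C (solutions G xs \<gamma>)" by (rule main[OF C]) (use True in auto)
    then show ?thesis
      using card_dvd_eqpoll_left card_GCD_0[OF GC] True by fastforce
  next
    case False
    let ?N = "{card H | H. subgroup H (G\<lparr>carrier := C\<rparr>) \<and> finite H \<and> card H dvd n}"
    let ?l = "Lcm ?N"
    have dvd: "card_dvd H (solutions G xs \<gamma>)"
      if H: "subgroup H (G\<lparr>carrier := C\<rparr>)" "finite H" "card H dvd n" for H
      using incl_subgroup[OF C H(1)] subgroup.subset[OF H(1)] H by (intro main) auto
    have "?l dvd n" by (rule Lcm_least) auto
    then have l: "0 < ?l" using False dvd_pos_nat by blast
    \<comment> \<open>A finite number of solutions is divisible by each \<open>card H\<close>, hence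
      by their lcm; an infinite one by every positive integer.\<close>
    have "card_dvd {..<?l} (solutions G xs \<gamma>)"
    proof (cases "finite (solutions G xs \<gamma>)")
      case True
      have "?l dvd card (solutions G xs \<gamma>)"
        by (rule Lcm_least) (use dvd True in \<open>auto simp: card_dvd_finite\<close>)
      then show ?thesis using True by (simp add: card_dvd_finite)
    next
      case False
      then show ?thesis using l by (auto simp: card_dvd_infinite finite_lepoll_infinite lessThan_empty_iff)
    qed
    then show ?thesis
      using card_dvd_eqpoll_left card_GCD_pos[OF GC, of n] False by blast
  qed
qed

end
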